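(* Let $Z\sim p$ belong to the integrated Pearson family, let $n\ge2$, and suppose that $n+1$ is admissible. Then, for $x\in\mathcal I_p$, $$|f_{p,\tau_p,h}^{(n)}(x)|\le\min\left\{\frac2{\tau_p(x)}\|h^{(n-1)}\|,\ U_{p,\tau_p}^{n,n}(x)\|h^{(n)}\|,\ \frac1{q_{n+1}}\|h^{(n+1)}\|\right\}.$$
   Context: $p$ is a probability density on $\mathbb R$ and $Z$ a random variable with density $p$. There are $m\ge1$ and $-\infty\le l=e_0<\dots<e_m=u\le\infty$ with $\{p>0\}=\mathcal I_p:=\bigcup_{r=1}^m(e_{r-1},e_r)$, and $p$ is locally absolutely continuous on each $(e_{r-1},e_r)$. Integrated Pearson family: $Z$ has finite mean $\mu$ and its Stein kernel $\tau_p(x)=\frac1{p(x)}\int_l^x(\mu-t)p(t)\,dt$ is, on $\mathcal I_p$, a polynomial $\kappa_2x^2+\kappa_1x+\kappa_0$. Put $q_k=k(1-(k-1)\kappa_2)$; an integer $k\ge0$ is admissible if $q_j>0$ for all $1\le j\le k$. For $h\in L^1(p)$, $f_{p,\tau_p,h}(x)=\frac1{\tau_p(x)p(x)}\int_l^x(h(t)-\mathbb E[h(Z)])p(t)\,dt$. With $P(x)=\int_l^xp$, $\overline P(x)=\int_x^up$: $\underline m_{p,\tau_p}=P/(\tau_pp)$, $\overline m_{p,\tau_p}=\overline P/(\tau_pp)$; $\underline P_0=\overline P_0=p$, $\underline P_j(x)=\int_l^x\underline P_{j-1}$, $\overline P_j(x)=\int_x^u\overline P_{j-1}$ ($j\ge1$);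 and $U_{p,\tau_p}^{n,n}=|\overline m_{p,\tau_p}^{(n)}|\,\underline P_{n+1}+|\underline m_{p,\tau_p}^{(n)}|\,\overline P_{n+1}$. Convention: $\|h^{(i)}\|$ is the essential supremum of $|h^{(i)}|$ on $\mathbb R$ if $h^{(i-1)}$ is locally absolutely continuous, and $\infty$ otherwise; a bound is asserted only when the seminorm on its right-hand side is finite, and derivatives of locally absolutely continuous functions (hence the pointwise inequality) are understood almost everywhere. *)

theory Defs
  imports "HOL-Probability.Probability"
begin

text \<open>Absolute continuity on \<open>[a, b]\<close>: the families of intervals are finite and non-overlapping.\<close>

definition abs_cont_on :: "real \<Rightarrow> real \<Rightarrow> (real \<Rightarrow> real) \<Rightarrow> bool" where
  "abs_cont_on a b f \<longleftrightarrow>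
     (\<forall>\<epsilon>>0. \<exists>\<delta>>0. \<forall>(N::nat) s t.
        (\<forall>i<N. a \<le> s i \<and> s i \<le> t i \<and> t i \<le> b) \<and>
        disjoint_family_on (\<lambda>i. {s i<..<t i}) {..<N} \<and>
        (\<Sum>i<N. t i - s i) < \<delta> \<longrightarrow>
        (\<Sum>i<N. \<bar>f (t i) - f (s i)\<bar>) < \<epsilon>)"

definition loc_abs_cont_on :: "real set \<Rightarrow> (real \<Rightarrow> real) \<Rightarrow> bool" where
  "loc_abs_cont_on S f \<longleftrightarrow> (\<forall>a b. a \<le> b \<and> {a..b} \<subseteq> S \<longrightarrow> abs_cont_on a b f)"

text \<open>On the open set \<open>S\<close>, the derivatives of \<open>f\<close> up to order \<open>k\<close> exist everywhere and the
  \<open>k\<close>-th one is locally absolutely continuous; the derivative of order \<open>k + 1\<close> then exists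
  almost everywhere on \<open>S\<close>.\<close>

definition deriv_loc_abs_cont_on :: "nat \<Rightarrow> real set \<Rightarrow> (real \<Rightarrow> real) \<Rightarrow> bool" where
  "deriv_loc_abs_cont_on k S f \<longleftrightarrow>
     (\<forall>j<k. \<forall>x\<in>S. (deriv ^^ j) f field_differentiable (at x)) \<and>
     loc_abs_cont_on S ((deriv ^^ k) f)"

text \<open>The seminorm of the \<open>i\<close>-th derivative, for \<open>i \<ge> 1\<close> only. The null set where the
  derivative of order \<open>i\<close> does not exist, and where \<^const>\<open>deriv\<close> has an unspecified value,
  does not affect the essential supremum.\<close>

definition deriv_seminorm :: "nat \<Rightarrow> (real \<Rightarrow> real) \<Rightarrow> ereal" where
  "deriv_seminorm i h =
     (if deriv_loc_abs_cont_on (i - 1) UNIV h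
      then esssup lebesgue (\<lambda>x. ereal \<bar>(deriv ^^ i) h x\<bar>) else \<infinity>)"

text \<open>A bound with infinite seminorm asserts nothing. The case distinction excludes the
  convention \<open>0 * \<infinity> = 0\<close> of \<^typ>\<open>ereal\<close>.\<close>

definition bound_term :: "real \<Rightarrow> ereal \<Rightarrow> ereal" where
  "bound_term c s = (if s < \<infinity> then ereal c * s else \<infinity>)"

definition interval_union :: "nat \<Rightarrow> (nat \<Rightarrow> ereal) \<Rightarrow> real set" where
  "interval_union m e = (\<Union>r\<in>{1..m}. einterval (e (r - 1)) (e r))"

definition interval_density :: "nat \<Rightarrow> (nat \<Rightarrow> ereal) \<Rightarrow> (real \<Rightarrow> real) \<Rightarrow> bool" where
  "interval_density m e p \<longleftrightarrow>
     1 \<le> m \<and> (\<forall>r\<in>{1..m}. e (r - 1) < e r) \<and>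
     (\<forall>x. 0 \<le> p x) \<and> {x. 0 < p x} = interval_union m e \<and>
     (\<forall>r\<in>{1..m}. loc_abs_cont_on (einterval (e (r - 1)) (e r)) p)"

definition stein_kernel :: "(real \<Rightarrow> real) \<Rightarrow> ereal \<Rightarrow> real \<Rightarrow> real \<Rightarrow> real" where
  "stein_kernel p l \<mu> x = 1 / p x * (LBINT t=l..ereal x. (\<mu> - t) * p t)"

definition integrated_pearson ::
    "'a measure \<Rightarrow> ('a \<Rightarrow> real) \<Rightarrow> nat \<Rightarrow> (nat \<Rightarrow> ereal) \<Rightarrow> (real \<Rightarrow> real) \<Rightarrow>
     real \<Rightarrow> real \<Rightarrow> real \<Rightarrow> bool" where
  "integrated_pearson M Z m e p \<kappa>\<^sub>0 \<kappa>\<^sub>1 \<kappa>\<^sub>2 \<longleftrightarrow>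
     integrable M Z \<and>
     (\<forall>x\<in>interval_union m e.
        stein_kernel p (e 0) (integral\<^sup>L M Z) x = \<kappa>\<^sub>2 * x\<^sup>2 + \<kappa>\<^sub>1 * x + \<kappa>\<^sub>0)"

definition pearson_q :: "real \<Rightarrow> nat \<Rightarrow> real" where
  "pearson_q \<kappa>\<^sub>2 k = real k * (1 - (real k - 1) * \<kappa>\<^sub>2)"

definition admissible :: "real \<Rightarrow> nat \<Rightarrow> bool" where
  "admissible \<kappa>\<^sub>2 k \<longleftrightarrow> (\<forall>j. 1 \<le> j \<and> j \<le> k \<longrightarrow> pearson_q \<kappa>\<^sub>2 j > 0)"

text \<open>The argument \<open>Eh\<close> is the expectation of \<open>h\<close> under \<open>p\<close>.\<close>

definition stein_solution ::
    "(real \<Rightarrow> real) \<Rightarrow> ereal \<Rightarrow> (real \<Rightarrow> real) \<Rightarrow> (real \<Rightarrow> real) \<Rightarrow> real \<Rightarrow> real \<Rightarrow> real" where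
  "stein_solution p l \<tau> h Eh x =
     1 / (\<tau> x * p x) * (LBINT t=l..ereal x. (h t - Eh) * p t)"

primrec lower_P :: "(real \<Rightarrow> real) \<Rightarrow> ereal \<Rightarrow> nat \<Rightarrow> real \<Rightarrow> real" where
  "lower_P p l 0 = p"
| "lower_P p l (Suc j) = (\<lambda>x. LBINT t=l..ereal x. lower_P p l j t)"

primrec upper_P :: "(real \<Rightarrow> real) \<Rightarrow> ereal \<Rightarrow> nat \<Rightarrow> real \<Rightarrow> real" where
  "upper_P p u 0 = p"
| "upper_P p u (Suc j) = (\<lambda>x. LBINT t=ereal x..u. upper_P p u j t)"

definition lower_m :: "(real \<Rightarrow> real) \<Rightarrow> ereal \<Rightarrow> (real \<Rightarrow> real) \<Rightarrow> real \<Rightarrow> real" where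
  "lower_m p l \<tau> x = (LBINT t=l..ereal x. p t) / (\<tau> x * p x)"

definition upper_m :: "(real \<Rightarrow> real) \<Rightarrow> ereal \<Rightarrow> (real \<Rightarrow> real) \<Rightarrow> real \<Rightarrow> real" where
  "upper_m p u \<tau> x = (LBINT t=ereal x..u. p t) / (\<tau> x * p x)"

definition stein_U ::
    "(real \<Rightarrow> real) \<Rightarrow> ereal \<Rightarrow> ereal \<Rightarrow> (real \<Rightarrow> real) \<Rightarrow> nat \<Rightarrow> real \<Rightarrow> real" where
  "stein_U p l u \<tau> n x =
     \<bar>(deriv ^^ n) (upper_m p u \<tau>) x\<bar> * lower_P p l (n + 1) x +
     \<bar>(deriv ^^ n) (lower_m p l \<tau>) x\<bar> * upper_P p u (n + 1) x"

end

theory Submission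
  imports Defs
begin

text \<open>Write \<open>P\<^sub>k\<close>, \<open>R\<^sub>k\<close> for the iterated lower and upper integrals of \<open>p\<close> and \<open>Q\<close> for the quadratic
  kernel. Integration by parts gives \<open>Q P\<^sub>k - (k Q' + \<mu> - x) P\<^sub>k\<^sub>+\<^sub>1 = q\<^sub>k\<^sub>+\<^sub>1 P\<^sub>k\<^sub>+\<^sub>2\<close> and its mirror
  image, and \<open>q\<^sub>k\<^sub>+\<^sub>1 > 0\<close> makes the moment of order \<open>k + 1\<close> finite. With \<open>c\<^sub>k = q\<^sub>1 \<dots> q\<^sub>k\<close> these
  identities yield \<open>c\<^sub>k (R\<^sub>k\<^sub>+\<^sub>1 P\<^sub>k + P\<^sub>k\<^sub>+\<^sub>1 R\<^sub>k) = Q\<^sup>k p\<close> and, by induction, on the support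
  \<open>f^(j) = c\<^sub>j (R\<^sub>j\<^sub>+\<^sub>1 S\<^sub>j - P\<^sub>j\<^sub>+\<^sub>1 S'\<^sub>j) / (Q\<^sup>j\<^sup>+\<^sup>1 p)\<close>, where \<open>S\<^sub>j\<close> and \<open>S'\<^sub>j\<close> integrate, up to sign, the
  Taylor remainder of order \<open>j\<close> of \<open>h\<close> at \<open>x\<close> against \<open>p\<close> to the left and to the right of \<open>x\<close>.
  If \<open>h^(j)\<close> is \<open>K\<close>-Lipschitz, then \<open>\<bar>S\<^sub>j\<^sub>+\<^sub>1\<bar> \<le> K P\<^sub>j\<^sub>+\<^sub>2\<close> and \<open>\<bar>S'\<^sub>j\<^sub>+\<^sub>1\<bar> \<le> K R\<^sub>j\<^sub>+\<^sub>2\<close>; expressing \<open>f^(n)\<close>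
  through the remainders of order \<open>n - 1\<close>, \<open>n\<close> or \<open>n + 1\<close> gives the three bounds. A finite seminorm
  gives the Lipschitz condition because an absolutely continuous function is differentiable almost
  everywhere and is \<open>K\<close>-Lipschitz if its derivative is bounded by \<open>K\<close> almost everywhere.\<close>

section \<open>Absolutely continuous functions\<close>

text \<open>The density is only absolutely continuous, so it is never differentiated: near a point
  of the support \<open>Q * p\<close> is the integral \<open>T\<close>, whose derivative is
  \<open>(\<mu> - x) * p x\<close>. Hence \<open>Q ^ (k + 1) * p\<close> has derivative
  \<open>Q ^ k * p * (k * Q' + \<mu> - x)\<close>, with the very factor of the two recurrences. This
  is why the quotient rule merely shifts indices, for the two weights as well as for the solution.
  The closed form of order \<open>n\<close> contains derivatives of \<open>h\<close> up to order
  \<open>n - 1\<close> only. The recursions for the Taylor integrals add or remove one order: going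
  down costs the factor 2, staying gives the weight, and going up cancels the derivative of order
  \<open>n\<close> altogether. Lipschitz constants replace the highest derivative under every
  integral. Only the first bound evaluates a derivative of \<open>h\<close> that may fail to exist
  on a null set, and it alone makes the final inequality an almost everywhere statement.\<close>

lemma division_real_intervalE:
  fixes D :: "real set set"
  assumes "D division_of S" "K \<in> D"
  obtains c d where "K = {c..d}" "c \<le> d" "Inf K = c" "Sup K = d"
proof -
  obtain c d where "K = {c..d}" "K \<noteq> {}"
    using division_ofD(3,4)[OF assms] by (metis box_real(2))
  then show ?thesis
    using that[of c d] by auto
qed

text \<open>Finite divisions are the form in which the covering and completion arguments below are
  carried out; \<open>Inf K\<close> and \<open>Sup K\<close> are the endpoints of
  \<open>K\<close>.\<close>

lemma abs_cont_on_division: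
  assumes "abs_cont_on a b f" "\<epsilon> > 0"
  obtains \<delta> where "\<delta> > 0"
    "\<And>D S. D division_of S \<Longrightarrow> S \<subseteq> {a..b} \<Longrightarrow> measure lebesgue S < \<delta> \<Longrightarrow>
       (\<Sum>K\<in>D. \<bar>f (Sup K) - f (Inf K)\<bar>) < \<epsilon>"
proof -
  obtain \<delta> where "\<delta> > 0" and \<delta>: "\<forall>(N::nat) s t.
        (\<forall>i<N. a \<le> s i \<and> s i \<le> t i \<and> t i \<le> b) \<and> disjoint_family_on (\<lambda>i. {s i<..<t i}) {..<N} \<and>
        (\<Sum>i<N. t i - s i) < \<delta> \<longrightarrow> (\<Sum>i<N. \<bar>f (t i) - f (s i)\<bar>) < \<epsilon>"
    using assms(1)[unfolded abs_cont_on_def, rule_format, OF assms(2)] by (elim exE conjE) (rule that)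
  show ?thesis
  proof (rule that[OF \<open>\<delta> > 0\<close>])
    fix D S assume D: "D division_of S" and S: "S \<subseteq> {a..b}" and less: "measure lebesgue S < \<delta>"
    obtain g where g: "bij_betw g {..<card D} D"
      using ex_bij_betw_nat_finite[OF division_ofD(1)[OF D]] by (auto simp: lessThan_atLeast0)
    have gD: "g i \<in> D" if "i < card D" for i
      using g that by (auto simp: bij_betw_def)
    have len: "(\<Sum>i<card D. Sup (g i) - Inf (g i)) = (\<Sum>K\<in>D. measure lebesgue K)"
      unfolding sum.reindex_bij_betw[OF g, of "\<lambda>K. Sup K - Inf K"]
    proof (rule sum.cong[OF refl])
      fix K assume "K \<in> D"
      then show "Sup K - Inf K = measure lebesgue K"
        by (rule division_real_intervalE[OF D]) simp
    qed
    have "(\<Sum>i<card D. \<bar>f (Sup (g i)) - f (Inf (g i))\<bar>) < \<epsilon>"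
    proof (rule \<delta>[rule_format], intro conjI)
      show "\<forall>i<card D. a \<le> Inf (g i) \<and> Inf (g i) \<le> Sup (g i) \<and> Sup (g i) \<le> b"
      proof (intro allI impI)
        fix i assume "i < card D"
        then obtain c d where "g i = {c..d}" "c \<le> d" "Inf (g i) = c" "Sup (g i) = d"
          using division_real_intervalE[OF D gD] by metis
        moreover have "g i \<subseteq> {a..b}"
          using division_ofD(2)[OF D gD] S \<open>i < card D\<close> by blast
        ultimately show "a \<le> Inf (g i) \<and> Inf (g i) \<le> Sup (g i) \<and> Sup (g i) \<le> b"
          by auto
      qed
      show "disjoint_family_on (\<lambda>i. {Inf (g i)<..<Sup (g i)}) {..<card D}"
        unfolding disjoint_family_on_def
      proof (intro ballI impI)
        fix i j assume ij: "i \<in> {..<card D}" "j \<in> {..<card D}" "i \<noteq> j"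
        then have "g i \<noteq> g j"
          using g by (auto simp: bij_betw_def inj_on_def)
        then have "interior (g i) \<inter> interior (g j) = {}"
          using division_ofD(5)[OF D gD gD] ij by blast
        moreover have "interior (g k) = {Inf (g k)<..<Sup (g k)}" if "k < card D" for k
          using division_real_intervalE[OF D gD[OF that]] by (metis interior_atLeastAtMost_real)
        ultimately show "{Inf (g i)<..<Sup (g i)} \<inter> {Inf (g j)<..<Sup (g j)} = {}"
          using ij by auto
      qed
      show "(\<Sum>i<card D. Sup (g i) - Inf (g i)) < \<delta>"
        using less unfolding len content_division[OF D] .
    qed
    then show "(\<Sum>K\<in>D. \<bar>f (Sup K) - f (Inf K)\<bar>) < \<epsilon>"
      unfolding sum.reindex_bij_betw[OF g, of "\<lambda>K. \<bar>f (Sup K) - f (Inf K)\<bar>"] .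
  qed
qed

lemma sum_increments_division:
  fixes f :: "real \<Rightarrow> real"
  assumes "D division_of {a..b}" "a \<le> b"
  shows "(\<Sum>K\<in>D. f (Sup K) - f (Inf K)) = f b - f a"
proof -
  \<comment> \<open>The tags are immaterial; left endpoints serve to reach additivity for tagged
    divisions.\<close>
  have "(\<lambda>K. (Inf K, K)) ` D tagged_division_of {a..b}"
  proof (rule tagged_division_ofI)
    show "finite ((\<lambda>K. (Inf K, K)) ` D)"
      using division_ofD(1)[OF assms(1)] by (rule finite_imageI)
    fix x K assume xK: "(x, K) \<in> (\<lambda>K. (Inf K, K)) ` D"
    then have "K \<in> D" "x = Inf K"
      by auto
    from division_real_intervalE[OF assms(1) this(1)] obtain c d where "K = {c..d}" "c \<le> d" "Inf K = c" .
    with \<open>x = Inf K\<close> show "x \<in> K" "\<exists>a b. K = cbox a b"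
      by auto
    show "K \<subseteq> {a..b}"
      using xK division_ofD(2)[OF assms(1)] by auto
  next
    fix x1 K1 x2 K2
    assume "(x1, K1) \<in> (\<lambda>K. (Inf K, K)) ` D" "(x2, K2) \<in> (\<lambda>K. (Inf K, K)) ` D" "(x1, K1) \<noteq> (x2, K2)"
    then show "interior K1 \<inter> interior K2 = {}"
      using division_ofD(5)[OF assms(1)] by auto
  next
    show "\<Union>{K. \<exists>x. (x, K) \<in> (\<lambda>K. (Inf K, K)) ` D} = {a..b}"
      using division_ofD(6)[OF assms(1)] by (simp add: image_iff)
  qed
  from additive_tagged_division_1[OF assms(2) this, of f] show ?thesis
    by (subst (asm) sum.reindex) (auto simp: inj_on_def)
qed

text \<open>Intervals are closed balls around their midpoints, so the Vitali theorem for balls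
  covers \<open>B\<close> by countably many disjoint ones up to a null set. Finitely many of them
  already exhaust \<open>B\<close> up to measure \<open>\<eta>\<close>.\<close>

lemma Vitali_intervals:
  fixes B :: "real set"
  assumes B: "B \<in> lmeasurable"
    and cov: "\<And>x d. x \<in> B \<Longrightarrow> d > 0 \<Longrightarrow> \<exists>s t. s < x \<and> x < t \<and> t - s < d \<and> P s t"
    and "\<eta> > 0"
  obtains G where "G division_of \<Union>G" "\<And>K. K \<in> G \<Longrightarrow> \<exists>s t. K = {s..t} \<and> s < t \<and> P s t"
    "measure lebesgue (B - \<Union>G) < \<eta>"
proof -
  define a where "a = (\<lambda>(s::real, t). (s + t) / 2)"
  define r where "r = (\<lambda>(s::real, t). (t - s) / 2)"
  define K where "K = {(s, t). s < t \<and> P s t}"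
  have cb: "cball (a i) (r i) = {fst i..snd i}" for i
    by (cases i) (auto simp: a_def r_def cball_eq_atLeastAtMost field_simps)
  obtain C where C: "countable C" "C \<subseteq> K"
     "pairwise (\<lambda>i j. disjnt (cball (a i) (r i)) (cball (a j) (r j))) C"
     "negligible (B - (\<Union>i\<in>C. cball (a i) (r i)))"
  proof (rule Vitali_covering_theorem_cballs[of K r B a])
    show "0 < r i" if "i \<in> K" for i
      using that by (auto simp: K_def r_def)
    show "\<exists>i. i \<in> K \<and> x \<in> cball (a i) (r i) \<and> r i < d" if "x \<in> B" "0 < d" for x d
    proof -
      obtain s t where "s < x" "x < t" "t - s < d" "P s t"
        using cov[OF \<open>x \<in> B\<close> \<open>0 < d\<close>] by blast
      then show ?thesis
        by (intro exI[of _ "(s, t)"]) (auto simp: cb K_def, simp add: r_def)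
    qed
  qed
  let ?I = "\<lambda>i::real \<times> real. {fst i..snd i}"
  have IC: "?I i \<in> lmeasurable" for i
    by (simp add: lmeasurable_interval)
  have "countable ((\<lambda>i. B \<inter> ?I i) ` C)"
    using C(1) by auto
  then obtain \<D> where \<D>: "\<D> \<subseteq> (\<lambda>i. B \<inter> ?I i) ` C" "finite \<D>"
    "measure lebesgue (\<Union>((\<lambda>i. B \<inter> ?I i) ` C)) - \<eta> < measure lebesgue (\<Union>\<D>)"
  proof (rule measure_countable_Union_approachable[OF _ \<open>\<eta> > 0\<close>, where B = "measure lebesgue B"])
    show "d \<in> lmeasurable" if "d \<in> (\<lambda>i. B \<inter> ?I i) ` C" for d
      using that B IC by (auto intro: fmeasurable.Int)
    show "measure lebesgue (\<Union>D') \<le> measure lebesgue B"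
      if "D' \<subseteq> (\<lambda>i. B \<inter> ?I i) ` C" "finite D'" for D'
    proof (rule measure_mono_fmeasurable[OF _ _ B])
      show "\<Union>D' \<in> sets lebesgue"
      proof (rule sets.finite_Union[OF \<open>finite D'\<close>])
        show "D' \<subseteq> sets lebesgue"
          using that(1) B IC by (auto dest!: subsetD intro!: fmeasurableD fmeasurable.Int)
      qed
    qed (use that in auto)
  qed
  obtain C' where C': "C' \<subseteq> C" "finite C'" "\<D> = (\<lambda>i. B \<inter> ?I i) ` C'"
    using finite_subset_image[OF \<D>(2,1)] by metis
  show ?thesis
  proof (rule that[of "?I ` C'"])
    show "?I ` C' division_of \<Union>(?I ` C')"
    proof (rule division_ofI)
      show "finite (?I ` C')"
        using C' by simp
      fix J assume J: "J \<in> ?I ` C'"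
      then show "J \<subseteq> \<Union>(?I ` C')" "\<exists>a b. J = cbox a b"
        by auto
      show "J \<noteq> {}"
        using J C' C(2) by (auto simp: K_def dest!: subsetD)
      fix J' assume J': "J' \<in> ?I ` C'" and "J \<noteq> J'"
      from J J' obtain i j where ij: "i \<in> C'" "j \<in> C'" "J = ?I i" "J' = ?I j"
        by auto
      with \<open>J \<noteq> J'\<close> have "disjnt (cball (a i) (r i)) (cball (a j) (r j))"
        using C(3) C'(1) by (metis (no_types, lifting) pairwiseD subsetD)
      then show "interior J \<inter> interior J' = {}"
        using ij interior_subset unfolding cb disjnt_def by blast
    qed simp
    show "\<exists>s t. J = {s..t} \<and> s < t \<and> P s t" if "J \<in> ?I ` C'" for J
      using that C' C(2) by (auto simp: K_def dest!: subsetD)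
    have UB: "\<Union>\<D> = B \<inter> \<Union>(?I ` C')"
      using C' by auto
    have mU: "\<Union>(?I ` C') \<in> lmeasurable"
      using C' IC by (intro fmeasurable.finite_UN) auto
    have "measure lebesgue B \<le> measure lebesgue (\<Union>((\<lambda>i. B \<inter> ?I i) ` C))"
    proof -
      have "measure lebesgue (B - (\<Union>i\<in>C. ?I i)) = 0"
        using C(4) unfolding cb by (simp add: negligible_imp_measure0)
      moreover have mc: "\<Union>((\<lambda>i. B \<inter> ?I i) ` C) \<in> lmeasurable" "B - (\<Union>i\<in>C. ?I i) \<in> lmeasurable"
        using B C(1) by (auto intro!: fmeasurable.Diff fmeasurableI2[OF B] sets.countable_UN')
      have "B = (B - (\<Union>i\<in>C. ?I i)) \<union> \<Union>((\<lambda>i. B \<inter> ?I i) ` C)"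
        by auto
      with measure_Un_le[OF fmeasurableD fmeasurableD, OF mc(2,1)]
      have "measure lebesgue B \<le> measure lebesgue (B - (\<Union>i\<in>C. ?I i)) + measure lebesgue (\<Union>((\<lambda>i. B \<inter> ?I i) ` C))"
        by simp
      ultimately show ?thesis
        by linarith
    qed
    moreover have "measure lebesgue (B - \<Union>(?I ` C')) = measure lebesgue B - measure lebesgue (B \<inter> \<Union>(?I ` C'))"
      using measurable_measure_Diff[OF B fmeasurableD[OF fmeasurable.Int[OF B mU]]] by (simp add: Diff_Int)
    ultimately show "measure lebesgue (B - \<Union>(?I ` C')) < \<eta>"
      using \<D>(3) unfolding UB by linarith
  qed
qed

text \<open>Only the part of \<open>F\<close> that \<open>B\<close> misses can carry negative increments, and by absolute
  continuity it carries little: a Vitali cover of \<open>B\<close> by intervals with nonnegative increments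
  is completed to a division.\<close>

lemma sum_increments_ge_of_cover:
  assumes ac: "abs_cont_on a b g" and "a \<le> b" "\<epsilon> > 0"
  obtains \<delta> where "\<delta> > 0"
    "\<And>F B. F division_of \<Union>F \<Longrightarrow> \<Union>F \<subseteq> {a..b} \<Longrightarrow> B \<in> lmeasurable \<Longrightarrow> B \<subseteq> \<Union>(interior ` F) \<Longrightarrow>
       (\<And>x d. x \<in> B \<Longrightarrow> d > 0 \<Longrightarrow> \<exists>s t. s < x \<and> x < t \<and> t - s < d \<and> g s \<le> g t) \<Longrightarrow>
       measure lebesgue (\<Union>F) - measure lebesgue B < \<delta> \<Longrightarrow>
       (\<Sum>K\<in>F. g (Sup K) - g (Inf K)) > - \<epsilon>"
proof -
  obtain \<delta> where "\<delta> > 0" and \<delta>: "\<And>D S. D division_of S \<Longrightarrow> S \<subseteq> {a..b} \<Longrightarrow>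
      measure lebesgue S < \<delta> \<Longrightarrow> (\<Sum>K\<in>D. \<bar>g (Sup K) - g (Inf K)\<bar>) < \<epsilon>"
    using abs_cont_on_division[OF ac \<open>\<epsilon> > 0\<close>] by blast
  show ?thesis
  proof (rule that[OF \<open>\<delta> > 0\<close>])
    fix F B
    assume F: "F division_of \<Union>F" "\<Union>F \<subseteq> {a..b}" and B: "B \<in> lmeasurable" "B \<subseteq> \<Union>(interior ` F)"
      and cov: "\<And>x d. x \<in> B \<Longrightarrow> d > 0 \<Longrightarrow> \<exists>s t. s < x \<and> x < t \<and> t - s < d \<and> g s \<le> g t"
      and small: "measure lebesgue (\<Union>F) - measure lebesgue B < \<delta>"
    define \<eta> where "\<eta> = \<delta> - (measure lebesgue (\<Union>F) - measure lebesgue B)"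
    have "\<eta> > 0"
      using small by (simp add: \<eta>_def)
    obtain G where G: "G division_of \<Union>G"
      and GP: "\<And>K. K \<in> G \<Longrightarrow> \<exists>s t. K = {s..t} \<and> s < t \<and> g s \<le> g t \<and> (\<exists>J\<in>F. {s..t} \<subseteq> J)"
      and Gm: "measure lebesgue (B - \<Union>G) < \<eta>"
    proof (rule Vitali_intervals[OF B(1) _ \<open>\<eta> > 0\<close>, where P = "\<lambda>s t. g s \<le> g t \<and> (\<exists>J\<in>F. {s..t} \<subseteq> J)"])
      fix x d :: real assume "x \<in> B" "d > 0"
      then obtain J where J: "J \<in> F" "x \<in> interior J"
        using B(2) by blast
      then obtain e where "e > 0" "ball x e \<subseteq> interior J"
        using open_contains_ball[of "interior J"] by auto
      obtain s t where st: "s < x" "x < t" "t - s < min d e" "g s \<le> g t"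
        using cov[OF \<open>x \<in> B\<close>, of "min d e"] \<open>d > 0\<close> \<open>e > 0\<close> by auto
      have "{s..t} \<subseteq> ball x e"
        using st by (auto simp: dist_real_def)
      then have "{s..t} \<subseteq> J"
        using \<open>ball x e \<subseteq> interior J\<close> interior_subset by blast
      then show "\<exists>s t. s < x \<and> x < t \<and> t - s < d \<and> g s \<le> g t \<and> (\<exists>J\<in>F. {s..t} \<subseteq> J)"
        using st J(1) by auto
    qed blast
    \<comment> \<open>\<open>H\<close> fills \<open>[a, b]\<close> outside \<open>F\<close>, and
      \<open>N\<close> is what \<open>G\<close> leaves of \<open>F\<close>. Both
      \<open>F \<union> H\<close> and \<open>G \<union> H \<union> N\<close> are divisions of
      \<open>[a, b]\<close>, so telescoping makes the increments over \<open>F\<close> equal to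
      those over \<open>G\<close> and \<open>N\<close> together.\<close>
    obtain D where D: "F \<subseteq> D" "D division_of {a..b}"
      using partial_division_extend_interval[of F a b] F by auto
    define H where "H = D - F"
    have GH: "G \<union> H division_of \<Union>(G \<union> H)"
    proof (rule division_ofI)
      show "finite (G \<union> H)"
        using division_ofD(1)[OF G] division_ofD(1)[OF D(2)] by (simp add: H_def)
      fix K assume K: "K \<in> G \<union> H"
      show "K \<subseteq> \<Union>(G \<union> H)" "K \<noteq> {}" "\<exists>a b. K = cbox a b"
        using K division_ofD(3,4)[OF G] division_ofD(3,4)[OF D(2)] by (auto simp: H_def)
      have *: "interior K \<inter> interior K' = {}" if K: "K \<in> G" and K': "K' \<in> H" for K K'
      proof -
        obtain J where J: "J \<in> F" "K \<subseteq> J"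
          using GP[OF K] by blast
        then have "interior J \<inter> interior K' = {}"
          using K' D by (intro division_ofD(5)[OF D(2)]) (auto simp: H_def)
        then show ?thesis
          using interior_mono[OF J(2)] by blast
      qed
      fix K' assume K': "K' \<in> G \<union> H" "K \<noteq> K'"
      consider "K \<in> G" "K' \<in> G" | "K \<in> G" "K' \<in> H" | "K \<in> H" "K' \<in> G" | "K \<in> H" "K' \<in> H"
        using K K' by blast
      then show "interior K \<inter> interior K' = {}"
      proof cases
        case 1 then show ?thesis using division_ofD(5)[OF G] K'(2) by blast
      next
        case 2 then show ?thesis using * by blast
      next
        case 3 then show ?thesis using *[of K' K] by blast
      next
        case 4 then show ?thesis using division_ofD(5)[OF D(2)] K'(2) by (simp add: H_def)
      qed
    qed simp
    have "G \<inter> H = {}"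
    proof -
      have False if K: "K \<in> G" "K \<in> H" for K
      proof -
        obtain s t J where J: "K = {s..t}" "s < t" "J \<in> F" "K \<subseteq> J"
          using GP[OF K(1)] by blast
        then have "interior J \<inter> interior K = {}"
          using K D by (intro division_ofD(5)[OF D(2)]) (auto simp: H_def)
        then have "interior K = {}"
          using interior_mono[OF J(4)] by blast
        then show False
          using J(1,2) by simp
      qed
      then show ?thesis by blast
    qed
    have "\<Union>G \<subseteq> \<Union>F"
      using GP by blast
    then have "\<Union>(G \<union> H) \<subseteq> {a..b}"
      using F(2) division_ofD(2)[OF D(2)] unfolding H_def by blast
    then obtain R where R: "G \<union> H \<subseteq> R" "R division_of {a..b}"
      using partial_division_extend_interval[of "G \<union> H" a b] GH by auto
    define N where "N = R - (G \<union> H)"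
    have fin: "finite G" "finite H" "finite N" "finite F"
      using division_ofD(1)[OF G] division_ofD(1)[OF D(2)] division_ofD(1)[OF R(2)] division_ofD(1)[OF F(1)]
      by (auto simp: H_def N_def)
    have split: "sum \<phi> G + sum \<phi> H + sum \<phi> N = sum \<phi> R" "sum \<phi> F + sum \<phi> H = sum \<phi> D"
      for \<phi> :: "real set \<Rightarrow> real"
    proof -
      have "R = (G \<union> H) \<union> N" "D = F \<union> H"
        using R(1) D(1) by (auto simp: N_def H_def)
      moreover have "(G \<union> H) \<inter> N = {}" "F \<inter> H = {}"
        by (auto simp: N_def H_def)
      ultimately show "sum \<phi> G + sum \<phi> H + sum \<phi> N = sum \<phi> R" "sum \<phi> F + sum \<phi> H = sum \<phi> D"
        using fin \<open>G \<inter> H = {}\<close> by (simp_all add: sum.union_disjoint)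
    qed
    have N: "N division_of \<Union>N"
      using R(2) division_ofD(6)[OF R(2)] division_of_subset[of R N] by (auto simp: N_def)
    have mG: "\<Union>G \<in> lmeasurable"
      using lmeasurable_division[OF G] .
    have "measure lebesgue (\<Union>N) = measure lebesgue (\<Union>F) - measure lebesgue (\<Union>G)"
      using split[of "measure lebesgue"]
      unfolding content_division[OF N] content_division[OF F(1)] content_division[OF G]
        content_division[OF R(2)] content_division[OF D(2)] by linarith
    also have "measure lebesgue B \<le> measure lebesgue (B - \<Union>G) + measure lebesgue (\<Union>G)"
    proof -
      have "measure lebesgue B \<le> measure lebesgue ((B - \<Union>G) \<union> \<Union>G)"
        using B(1) mG by (intro measure_mono_fmeasurable fmeasurable.Un fmeasurable.Diff) auto
      also have "\<dots> \<le> measure lebesgue (B - \<Union>G) + measure lebesgue (\<Union>G)"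
        using B(1) mG by (intro measure_Un_le) auto
      finally show ?thesis .
    qed
    then have "measure lebesgue (\<Union>F) - measure lebesgue (\<Union>G) < \<delta>"
      using Gm by (simp add: \<eta>_def)
    finally have "measure lebesgue (\<Union>N) < \<delta>" .
    moreover have "\<Union>N \<subseteq> {a..b}"
      using division_ofD(2)[OF R(2)] by (auto simp: N_def)
    ultimately have "(\<Sum>K\<in>N. \<bar>g (Sup K) - g (Inf K)\<bar>) < \<epsilon>"
      using \<delta>[OF N] by blast
    then have "(\<Sum>K\<in>N. g (Sup K) - g (Inf K)) > - \<epsilon>"
      using sum_abs[of "\<lambda>K. g (Sup K) - g (Inf K)" N] by linarith
    moreover have "(\<Sum>K\<in>G. g (Sup K) - g (Inf K)) \<ge> 0"
    proof (rule sum_nonneg)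
      fix K assume "K \<in> G"
      from GP[OF this] show "0 \<le> g (Sup K) - g (Inf K)" by auto
    qed
    ultimately show "(\<Sum>K\<in>F. g (Sup K) - g (Inf K)) > - \<epsilon>"
      using split[of "\<lambda>K. g (Sup K) - g (Inf K)"] sum_increments_division[OF R(2) \<open>a \<le> b\<close>, of g]
        sum_increments_division[OF D(2) \<open>a \<le> b\<close>, of g] by linarith
  qed
qed

section \<open>Elementary properties of absolute continuity\<close>

lemma loc_abs_cont_on_UNIV: "loc_abs_cont_on UNIV f \<Longrightarrow> a \<le> b \<Longrightarrow> abs_cont_on a b f"
  by (simp add: loc_abs_cont_on_def)

lemma abs_cont_on_increment:
  assumes "abs_cont_on a b f" "\<epsilon> > 0"
  obtains \<delta> where "\<delta> > 0" "\<And>s t. a \<le> s \<Longrightarrow> s \<le> t \<Longrightarrow> t \<le> b \<Longrightarrow> t - s < \<delta> \<Longrightarrow> \<bar>f t - f s\<bar> < \<epsilon>"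
proof -
  obtain \<delta> where "\<delta> > 0" and \<delta>: "\<And>D S. D division_of S \<Longrightarrow> S \<subseteq> {a..b} \<Longrightarrow>
      measure lebesgue S < \<delta> \<Longrightarrow> (\<Sum>K\<in>D. \<bar>f (Sup K) - f (Inf K)\<bar>) < \<epsilon>"
    using abs_cont_on_division[OF assms] by blast
  show ?thesis
  proof (rule that[OF \<open>\<delta> > 0\<close>])
    fix s t assume st: "a \<le> s" "s \<le> t" "t \<le> b" "t - s < \<delta>"
    have "{{s..t}} division_of {s..t}"
      using division_of_self[of s t] st by simp
    from \<delta>[OF this] show "\<bar>f t - f s\<bar> < \<epsilon>"
      using st by simp
  qed
qed

lemma loc_abs_cont_on_isCont:
  assumes "loc_abs_cont_on A f" "open A" "x \<in> A"
  shows "isCont f x"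
  unfolding continuous_at_eps_delta
proof (intro allI impI)
  fix e :: real assume "e > 0"
  obtain r where "r > 0" and r: "cball x r \<subseteq> A"
    using assms(2,3) open_contains_cball by blast
  then have "abs_cont_on (x - r) (x + r) f"
    using assms(1) by (auto simp: loc_abs_cont_on_def cball_eq_atLeastAtMost)
  then obtain \<delta> where "\<delta> > 0" and
    \<delta>: "\<And>s t. x - r \<le> s \<Longrightarrow> s \<le> t \<Longrightarrow> t \<le> x + r \<Longrightarrow> t - s < \<delta> \<Longrightarrow> \<bar>f t - f s\<bar> < e"
    using abs_cont_on_increment \<open>e > 0\<close> by blast
  show "\<exists>d>0. \<forall>x'. dist x' x < d \<longrightarrow> dist (f x') (f x) < e"
  proof (intro exI[of _ "min \<delta> r"] conjI allI impI)
    show "min \<delta> r > 0" using \<open>\<delta> > 0\<close> \<open>r > 0\<close> by simp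
    fix y assume "dist y x < min \<delta> r"
    then show "dist (f y) (f x) < e"
      using \<delta>[of x y] \<delta>[of y x] by (cases "x \<le> y") (auto simp: dist_real_def abs_minus_commute)
  qed
qed

lemma abs_cont_on_lipschitz:
  assumes "\<And>s t. a \<le> s \<Longrightarrow> s \<le> t \<Longrightarrow> t \<le> b \<Longrightarrow> \<bar>f t - f s\<bar> \<le> L * (t - s)"
  shows "abs_cont_on a b f"
  unfolding abs_cont_on_def
proof (intro allI impI)
  fix \<epsilon> :: real assume "\<epsilon> > 0"
  show "\<exists>\<delta>>0. \<forall>(N::nat) s t.
        (\<forall>i<N. a \<le> s i \<and> s i \<le> t i \<and> t i \<le> b) \<and>
        disjoint_family_on (\<lambda>i. {s i<..<t i}) {..<N} \<and>
        (\<Sum>i<N. t i - s i) < \<delta> \<longrightarrow>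
        (\<Sum>i<N. \<bar>f (t i) - f (s i)\<bar>) < \<epsilon>"
  proof (intro exI[of _ "\<epsilon> / (\<bar>L\<bar> + 1)"] conjI allI impI; (elim conjE)?)
    show "\<epsilon> / (\<bar>L\<bar> + 1) > 0"
      using \<open>\<epsilon> > 0\<close> by simp
    fix N and s t :: "nat \<Rightarrow> real"
    assume st: "\<forall>i<N. a \<le> s i \<and> s i \<le> t i \<and> t i \<le> b" and less: "(\<Sum>i<N. t i - s i) < \<epsilon> / (\<bar>L\<bar> + 1)"
    have "(\<Sum>i<N. \<bar>f (t i) - f (s i)\<bar>) \<le> (\<Sum>i<N. (\<bar>L\<bar> + 1) * (t i - s i))"
    proof (rule sum_mono)
      fix i assume "i \<in> {..<N}"
      then have "\<bar>f (t i) - f (s i)\<bar> \<le> L * (t i - s i)" "t i - s i \<ge> 0"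
        using st assms[of "s i" "t i"] by auto
      moreover have "L * (t i - s i) \<le> (\<bar>L\<bar> + 1) * (t i - s i)"
        using calculation(2) by (intro mult_right_mono) auto
      ultimately show "\<bar>f (t i) - f (s i)\<bar> \<le> (\<bar>L\<bar> + 1) * (t i - s i)" by linarith
    qed
    also have "\<dots> = (\<bar>L\<bar> + 1) * (\<Sum>i<N. t i - s i)"
      by (simp add: sum_distrib_left)
    also have "\<dots> < \<epsilon>"
      using less by (simp add: pos_less_divide_eq mult.commute)
    finally show "(\<Sum>i<N. \<bar>f (t i) - f (s i)\<bar>) < \<epsilon>" .
  qed
qed

lemma abs_cont_on_add:
  assumes "abs_cont_on a b f" "abs_cont_on a b g"
  shows "abs_cont_on a b (\<lambda>x. f x + g x)"
  unfolding abs_cont_on_def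
proof (intro allI impI)
  fix \<epsilon> :: real assume "\<epsilon> > 0"
  then have e2: "\<epsilon> / 2 > 0" by simp
  obtain d1 where d1: "d1 > 0" "\<forall>(N::nat) s t.
        (\<forall>i<N. a \<le> s i \<and> s i \<le> t i \<and> t i \<le> b) \<and> disjoint_family_on (\<lambda>i. {s i<..<t i}) {..<N} \<and>
        (\<Sum>i<N. t i - s i) < d1 \<longrightarrow> (\<Sum>i<N. \<bar>f (t i) - f (s i)\<bar>) < \<epsilon> / 2"
    using assms(1)[unfolded abs_cont_on_def, rule_format, OF e2] by (elim exE conjE) (rule that)
  obtain d2 where d2: "d2 > 0" "\<forall>(N::nat) s t.
        (\<forall>i<N. a \<le> s i \<and> s i \<le> t i \<and> t i \<le> b) \<and> disjoint_family_on (\<lambda>i. {s i<..<t i}) {..<N} \<and>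
        (\<Sum>i<N. t i - s i) < d2 \<longrightarrow> (\<Sum>i<N. \<bar>g (t i) - g (s i)\<bar>) < \<epsilon> / 2"
    using assms(2)[unfolded abs_cont_on_def, rule_format, OF e2] by (elim exE conjE) (rule that)
  show "\<exists>\<delta>>0. \<forall>(N::nat) s t.
        (\<forall>i<N. a \<le> s i \<and> s i \<le> t i \<and> t i \<le> b) \<and>
        disjoint_family_on (\<lambda>i. {s i<..<t i}) {..<N} \<and>
        (\<Sum>i<N. t i - s i) < \<delta> \<longrightarrow>
        (\<Sum>i<N. \<bar>f (t i) + g (t i) - (f (s i) + g (s i))\<bar>) < \<epsilon>"
  proof (intro exI[of _ "min d1 d2"] conjI allI impI; (elim conjE)?)
    show "min d1 d2 > 0"
      using d1 d2 by simp
    fix N and s t :: "nat \<Rightarrow> real"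
    assume A: "\<forall>i<N. a \<le> s i \<and> s i \<le> t i \<and> t i \<le> b" "disjoint_family_on (\<lambda>i. {s i<..<t i}) {..<N}"
      and less: "(\<Sum>i<N. t i - s i) < min d1 d2"
    have "(\<Sum>i<N. \<bar>f (t i) + g (t i) - (f (s i) + g (s i))\<bar>) \<le>
        (\<Sum>i<N. \<bar>f (t i) - f (s i)\<bar> + \<bar>g (t i) - g (s i)\<bar>)"
      by (rule sum_mono) linarith
    also have "\<dots> = (\<Sum>i<N. \<bar>f (t i) - f (s i)\<bar>) + (\<Sum>i<N. \<bar>g (t i) - g (s i)\<bar>)"
      by (rule sum.distrib)
    also have "\<dots> < \<epsilon>"
      using d1(2)[rule_format, of N s t] d2(2)[rule_format, of N s t] A less by simp
    finally show "(\<Sum>i<N. \<bar>f (t i) + g (t i) - (f (s i) + g (s i))\<bar>) < \<epsilon>" .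
  qed
qed

lemma abs_cont_on_minus: "abs_cont_on a b f \<Longrightarrow> abs_cont_on a b (\<lambda>x. - f x)"
  unfolding abs_cont_on_def by (simp add: abs_minus_commute)

lemma abs_cont_on_diff_linear: "abs_cont_on a b f \<Longrightarrow> abs_cont_on a b (\<lambda>x. f x - q * x)"
  using abs_cont_on_add[of a b f "\<lambda>x. - q * x"] abs_cont_on_lipschitz[of a b "\<lambda>x. - q * x" "\<bar>q\<bar>"]
  by (simp add: abs_mult flip: right_diff_distrib)

section \<open>Slopes over short intervals and differentiability almost everywhere\<close>

text \<open>Arbitrarily short intervals strictly around \<open>x\<close> have mean slope above
  \<open>q\<close>: the intervals are small, not the slopes. Applied to \<open>- p\<close> and the
  negative of \<open>f\<close>, it describes slopes below \<open>p\<close>.\<close>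

definition small_slopes :: "real \<Rightarrow> (real \<Rightarrow> real) \<Rightarrow> real set" where
  "small_slopes q f = {x. \<forall>d>0. \<exists>s t. s < x \<and> x < t \<and> t - s < d \<and> q * (t - s) < f t - f s}"

lemma small_slopesD:
  "x \<in> small_slopes q f \<Longrightarrow> d > 0 \<Longrightarrow> \<exists>s t. s < x \<and> x < t \<and> t - s < d \<and> q * (t - s) < f t - f s"
  by (simp add: small_slopes_def)

text \<open>The open intervals of length below \<open>d\<close> with slope above \<open>q\<close>
  have an open union, so the set is a countable intersection of open sets, whatever \<open>f\<close>
  is.\<close>

lemma small_slopes_borel [measurable]: "small_slopes q f \<in> sets borel"
proof -
  define U where "U = (\<lambda>d. \<Union>(s, t)\<in>{(s, t). t - s < d \<and> q * (t - s) < f t - f s}. {s<..<t})"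
  have "small_slopes q f = (\<Inter>n. U (inverse (real (Suc n))))"
  proof (intro equalityI subsetI)
    fix x assume "x \<in> small_slopes q f"
    then show "x \<in> (\<Inter>n. U (inverse (real (Suc n))))"
      using small_slopesD[of x q f "inverse (real (Suc _))"] by (fastforce simp: U_def)
  next
    fix x assume x: "x \<in> (\<Inter>n. U (inverse (real (Suc n))))"
    show "x \<in> small_slopes q f"
      unfolding small_slopes_def
    proof (intro CollectI allI impI)
      fix d :: real assume "d > 0"
      then obtain n where n: "inverse (real (Suc n)) < d"
        using reals_Archimedean by blast
      have "x \<in> U (inverse (real (Suc n)))"
        using x by blast
      then show "\<exists>s t. s < x \<and> x < t \<and> t - s < d \<and> q * (t - s) < f t - f s"
        using n unfolding U_def by force
    qed
  qed
  moreover have "open (U d)" for d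
    by (auto simp: U_def)
  ultimately show ?thesis
    by auto
qed

lemma small_slopes_antimono: "q \<le> q' \<Longrightarrow> small_slopes q' f \<subseteq> small_slopes q f"
proof
  fix x assume "q \<le> q'" and x: "x \<in> small_slopes q' f"
  show "x \<in> small_slopes q f"
    unfolding small_slopes_def
  proof (intro CollectI allI impI)
    fix d :: real assume "d > 0"
    then obtain s t where st: "s < x" "x < t" "t - s < d" "q' * (t - s) < f t - f s"
      using small_slopesD[OF x] by blast
    have "q * (t - s) \<le> q' * (t - s)"
      using \<open>q \<le> q'\<close> st by (intro mult_right_mono) auto
    then have "q * (t - s) < f t - f s"
      using st(4) by linarith
    then show "\<exists>s t. s < x \<and> x < t \<and> t - s < d \<and> q * (t - s) < f t - f s"
      using st by blast
  qed
qed

lemma lmeasurable_borel_Int_interval: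
  "S \<in> sets borel \<Longrightarrow> S \<inter> {a<..<b::real} \<in> lmeasurable"
  by (intro bounded_set_imp_lmeasurable sets_completionI_sets) (auto intro: bounded_Int)

text \<open>On intervals of slope below \<open>p\<close> that fill at least half of the set,
  \<open>g = f - q x\<close> falls at least at the rate \<open>q - p\<close>. The same points also
  lie in short intervals of slope above \<open>q\<close>, where \<open>g\<close> grows, so by
  absolute continuity the total increment of \<open>g\<close> cannot be far below 0.\<close>

lemma negligible_opposite_slopes_interval:
  assumes ac: "abs_cont_on a b f" and "a \<le> b" "p < q"
  shows "negligible (small_slopes q f \<inter> small_slopes (- p) (\<lambda>x. - f x) \<inter> {a<..<b})"
proof -
  define B where "B = small_slopes q f \<inter> small_slopes (- p) (\<lambda>x. - f x) \<inter> {a<..<b}"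
  have Bm: "B \<in> lmeasurable"
    unfolding B_def by (intro lmeasurable_borel_Int_interval sets.Int small_slopes_borel)
  have "measure lebesgue B = 0"
  proof (rule ccontr)
    assume "measure lebesgue B \<noteq> 0"
    then have \<alpha>: "measure lebesgue B > 0"
      by (simp add: zero_less_measure_iff)
    define \<alpha> where "\<alpha> = measure lebesgue B"
    define g where "g = (\<lambda>x. f x - q * x)"
    \<comment> \<open>The family \<open>F\<close> below has measure at least
      \<open>\<alpha> / 2\<close>, which forces an increment of at most
      \<open>- ((q - p) * \<alpha> / 2)\<close>; an error of half that size is then a
      contradiction.\<close>
    have "(q - p) * \<alpha> / 4 > 0"
      using \<alpha> \<open>p < q\<close> by (simp add: \<alpha>_def)
    then obtain \<delta> where "\<delta> > 0" and \<delta>: "\<And>F B. F division_of \<Union>F \<Longrightarrow> \<Union>F \<subseteq> {a..b} \<Longrightarrow> B \<in> lmeasurable \<Longrightarrow>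
       B \<subseteq> \<Union>(interior ` F) \<Longrightarrow>
       (\<And>x d. x \<in> B \<Longrightarrow> d > 0 \<Longrightarrow> \<exists>s t. s < x \<and> x < t \<and> t - s < d \<and> g s \<le> g t) \<Longrightarrow>
       measure lebesgue (\<Union>F) - measure lebesgue B < \<delta> \<Longrightarrow>
       (\<Sum>K\<in>F. g (Sup K) - g (Inf K)) > - ((q - p) * \<alpha> / 4)"
      using sum_increments_ge_of_cover[OF abs_cont_on_diff_linear[OF ac] \<open>a \<le> b\<close>, of _ q] unfolding g_def by blast
    \<comment> \<open>The intervals of \<open>F\<close> are kept inside an open \<open>T\<close>
      exceeding \<open>B\<close> by less than \<open>\<delta>\<close>, so that \<open>F\<close> has
      little measure outside \<open>B\<close>.\<close>
    obtain T where T: "open T" "B \<subseteq> T" "T - B \<in> lmeasurable" "emeasure lebesgue (T - B) < ennreal \<delta>"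
      using sets_lebesgue_outer_open[OF fmeasurableD[OF Bm] \<open>\<delta> > 0\<close>] by blast
    have TB: "measure lebesgue (T - B) < \<delta>"
      using T(3,4) \<open>\<delta> > 0\<close> by (simp add: emeasure_eq_measure2 ennreal_less_iff)
    obtain F where F: "F division_of \<Union>F"
      and FP: "\<And>K. K \<in> F \<Longrightarrow> \<exists>s t. K = {s..t} \<and> s < t \<and> - p * (t - s) < - f t + f s \<and> {s..t} \<subseteq> T \<inter> {a<..<b}"
      and Fm: "measure lebesgue (B - \<Union>F) < \<alpha> / 2"
    proof (rule Vitali_intervals[OF Bm, where P = "\<lambda>s t. - p * (t - s) < - f t + f s \<and> {s..t} \<subseteq> T \<inter> {a<..<b}"])
      show "\<alpha> / 2 > 0"
        using \<alpha> by (simp add: \<alpha>_def)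
      fix x d :: real assume "x \<in> B" "d > 0"
      have "open (T \<inter> {a<..<b})" "x \<in> T \<inter> {a<..<b}"
        using T \<open>x \<in> B\<close> by (auto simp: B_def)
      then obtain e where e: "e > 0" "ball x e \<subseteq> T \<inter> {a<..<b}"
        by (meson open_contains_ball)
      obtain s t where st: "s < x" "x < t" "t - s < min d e" "- p * (t - s) < - f t - - f s"
        using small_slopesD[of x "- p" "\<lambda>x. - f x" "min d e"] \<open>x \<in> B\<close> \<open>d > 0\<close> \<open>e > 0\<close> by (auto simp: B_def)
      have "{s..t} \<subseteq> ball x e"
        using st by (auto simp: dist_real_def)
      then show "\<exists>s t. s < x \<and> x < t \<and> t - s < d \<and> - p * (t - s) < - f t + f s \<and> {s..t} \<subseteq> T \<inter> {a<..<b}"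
        using st e(2) by (intro exI[of _ s] exI[of _ t]) auto
    qed blast
    \<comment> \<open>Restricting \<open>B\<close> to the interiors of \<open>F\<close> loses,
      within \<open>F\<close>, only the finitely many endpoints collected in
      \<open>E\<close>.\<close>
    define B' where "B' = B \<inter> \<Union>(interior ` F)"
    define E where "E = (\<Union>K\<in>F. {Inf K, Sup K})"
    have "finite F"
      using division_ofD(1)[OF F] .
    have mF: "\<Union>F \<in> lmeasurable"
      using lmeasurable_division[OF F] .
    have oi: "open (\<Union>(interior ` F))"
      by auto
    have mB': "B' \<in> lmeasurable"
      unfolding B'_def using oi by (intro fmeasurableI2[OF Bm]) (auto intro!: sets.Int fmeasurableD[OF Bm])
    have "\<Union>F - B' \<subseteq> (T - B) \<union> E"
    proof
      fix x assume x: "x \<in> \<Union>F - B'"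
      then obtain K where K: "K \<in> F" "x \<in> K"
        by blast
      from FP[OF this(1)] obtain s t where st: "K = {s..t}" "s < t" "{s..t} \<subseteq> T \<inter> {a<..<b}"
        by blast
      show "x \<in> (T - B) \<union> E"
      proof (cases "x \<in> B")
        case True
        then have "x \<notin> interior K"
          using x K by (auto simp: B'_def)
        then have "x = s \<or> x = t"
          using K(2) st by auto
        moreover have "Inf K = s" "Sup K = t"
          using st by auto
        ultimately show ?thesis
          using K(1) unfolding E_def by blast
      qed (use K st in auto)
    qed
    moreover have "E \<in> lmeasurable" "measure lebesgue E = 0"
    proof -
      have "negligible E"
        using \<open>finite F\<close> by (auto simp: E_def intro!: negligible_finite)
      then show "E \<in> lmeasurable" "measure lebesgue E = 0"
        using negligible_iff_measure by blast+
    qed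
    ultimately have "measure lebesgue (\<Union>F - B') \<le> measure lebesgue (T - B) + 0"
      using T(3) mF mB' measure_mono_fmeasurable[of "\<Union>F - B'" "(T - B) \<union> E" lebesgue]
        measure_Un_le[of "T - B" lebesgue E]
      by (simp add: fmeasurable.Un fmeasurable.Diff fmeasurableD)
    moreover have "B' \<subseteq> \<Union>F"
      using interior_subset by (auto simp: B'_def)
    ultimately have "measure lebesgue (\<Union>F) - measure lebesgue B' < \<delta>"
      using TB measurable_measure_Diff[OF mF fmeasurableD[OF mB']] by simp
    moreover have "\<exists>s t. s < x \<and> x < t \<and> t - s < d \<and> g s \<le> g t" if "x \<in> B'" "d > 0" for x d
    proof -
      have "x \<in> small_slopes q f"
        using that by (simp add: B'_def B_def)
      from small_slopesD[OF this \<open>d > 0\<close>] obtain s t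
        where "s < x" "x < t" "t - s < d" "q * (t - s) < f t - f s" by blast
      then show ?thesis
        by (intro exI[of _ s] exI[of _ t]) (auto simp: g_def algebra_simps)
    qed
    moreover have "\<Union>F \<subseteq> {a..b}"
      using FP by fastforce
    ultimately have "- ((q - p) * \<alpha> / 4) < (\<Sum>K\<in>F. g (Sup K) - g (Inf K))"
      using \<delta>[OF F _ mB'] by (auto simp: B'_def)
    also have "\<dots> \<le> (\<Sum>K\<in>F. (p - q) * measure lebesgue K)"
    proof (rule sum_mono)
      fix K assume "K \<in> F"
      from FP[OF this] obtain s t where "K = {s..t}" "s < t" "- p * (t - s) < - f t + f s" by blast
      then show "g (Sup K) - g (Inf K) \<le> (p - q) * measure lebesgue K"
        by (auto simp: g_def algebra_simps)
    qed
    also have "\<dots> = (p - q) * measure lebesgue (\<Union>F)"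
      by (simp add: sum_distrib_left flip: content_division[OF F])
    also have "\<dots> \<le> (p - q) * (\<alpha> / 2)"
    proof (rule mult_left_mono_neg)
      have "\<alpha> \<le> measure lebesgue ((B - \<Union>F) \<union> \<Union>F)"
        unfolding \<alpha>_def using Bm mF by (intro measure_mono_fmeasurable fmeasurable.Un fmeasurable.Diff) auto
      also have "\<dots> \<le> measure lebesgue (B - \<Union>F) + measure lebesgue (\<Union>F)"
        using Bm mF by (intro measure_Un_le) auto
      finally show "\<alpha> / 2 \<le> measure lebesgue (\<Union>F)"
        using Fm by simp
    qed (use \<open>p < q\<close> in simp)
    also have "\<dots> = - ((q - p) * \<alpha>) / 2"
      by (simp add: field_simps)
    finally have "(q - p) * \<alpha> < 0"
      by linarith
    then show False
      using \<alpha> \<open>p < q\<close> by (simp add: \<alpha>_def mult_less_0_iff)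
  qed
  then show ?thesis
    using Bm unfolding B_def[symmetric] by (simp add: negligible_iff_measure)
qed

text \<open>For the \<open>\<delta>\<close> belonging to \<open>\<epsilon> = 1\<close>, disjoint
  intervals inside \<open>{c<..<d}\<close> have increments of total size below 1. If the set had
  measure \<open>\<alpha> > 0\<close>, disjoint intervals of slope above \<open>n\<close> would
  cover half of it and contribute at least \<open>n * \<alpha> / 2\<close>, which exceeds 1 for
  large \<open>n\<close>.\<close>

lemma negligible_unbounded_slopes_interval:
  assumes ac: "abs_cont_on a b f"
  obtains \<delta> where "\<delta> > 0"
    "\<And>c d. a \<le> c \<Longrightarrow> d \<le> b \<Longrightarrow> d - c < \<delta> \<Longrightarrow> negligible ((\<Inter>n. small_slopes (real n) f) \<inter> {c<..<d})"
proof -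
  obtain \<delta> where "\<delta> > 0" and \<delta>: "\<And>D S. D division_of S \<Longrightarrow> S \<subseteq> {a..b} \<Longrightarrow>
      measure lebesgue S < \<delta> \<Longrightarrow> (\<Sum>K\<in>D. \<bar>f (Sup K) - f (Inf K)\<bar>) < 1"
    using abs_cont_on_division[OF ac zero_less_one] by blast
  show ?thesis
  proof (rule that[OF \<open>\<delta> > 0\<close>])
    fix c d assume cd: "a \<le> c" "d \<le> b" "d - c < \<delta>"
    define B where "B = (\<Inter>n. small_slopes (real n) f) \<inter> {c<..<d}"
    have Bm: "B \<in> lmeasurable"
      unfolding B_def by (intro lmeasurable_borel_Int_interval sets.countable_INT'') (auto intro: small_slopes_borel)
    have "measure lebesgue B = 0"
    proof (rule ccontr)
      assume "measure lebesgue B \<noteq> 0"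
      then have \<alpha>: "measure lebesgue B > 0"
        by (simp add: zero_less_measure_iff)
      define \<alpha> where "\<alpha> = measure lebesgue B"
      obtain n :: nat where n: "real n > 2 / \<alpha>"
        using reals_Archimedean2 by blast
      obtain F where F: "F division_of \<Union>F"
        and FP: "\<And>K. K \<in> F \<Longrightarrow> \<exists>s t. K = {s..t} \<and> s < t \<and> real n * (t - s) < f t - f s \<and> {s..t} \<subseteq> {c<..<d}"
        and Fm: "measure lebesgue (B - \<Union>F) < \<alpha> / 2"
      proof (rule Vitali_intervals[OF Bm, where P = "\<lambda>s t. real n * (t - s) < f t - f s \<and> {s..t} \<subseteq> {c<..<d}"])
        show "\<alpha> / 2 > 0"
          using \<alpha> by (simp add: \<alpha>_def)
        fix x e :: real assume "x \<in> B" "e > 0"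
        then have x: "x \<in> small_slopes (real n) f" "c < x" "x < d"
          by (auto simp: B_def)
        obtain s t where st: "s < x" "x < t" "t - s < min e (min (x - c) (d - x))" "real n * (t - s) < f t - f s"
          using small_slopesD[OF x(1), of "min e (min (x - c) (d - x))"] x \<open>e > 0\<close> by auto
        then show "\<exists>s t. s < x \<and> x < t \<and> t - s < e \<and> real n * (t - s) < f t - f s \<and> {s..t} \<subseteq> {c<..<d}"
          by (intro exI[of _ s] exI[of _ t]) auto
      qed blast
      have mF: "\<Union>F \<in> lmeasurable"
        using lmeasurable_division[OF F] .
      have sub: "\<Union>F \<subseteq> {c<..<d}"
        using FP by blast
      obtain x where "x \<in> B"
        using \<alpha> by fastforce
      then have "c < d" by (auto simp: B_def)
      have "measure lebesgue (\<Union>F) \<le> measure lebesgue {c<..<d}"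
        using sub mF by (intro measure_mono_fmeasurable) (auto simp: lmeasurable_interval)
      then have "(\<Sum>K\<in>F. \<bar>f (Sup K) - f (Inf K)\<bar>) < 1"
        using sub cd \<open>c < d\<close> by (intro \<delta>[OF F]) auto
      moreover have "(\<Sum>K\<in>F. \<bar>f (Sup K) - f (Inf K)\<bar>) \<ge> (\<Sum>K\<in>F. real n * measure lebesgue K)"
      proof (rule sum_mono)
        fix K assume "K \<in> F"
        from FP[OF this] obtain s t where "K = {s..t}" "s < t" "real n * (t - s) < f t - f s" by blast
        then show "real n * measure lebesgue K \<le> \<bar>f (Sup K) - f (Inf K)\<bar>"
          by auto
      qed
      moreover have "(\<Sum>K\<in>F. real n * measure lebesgue K) = real n * measure lebesgue (\<Union>F)"
        by (simp add: sum_distrib_left flip: content_division[OF F])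
      moreover have "\<alpha> / 2 \<le> measure lebesgue (\<Union>F)"
      proof -
        have "\<alpha> \<le> measure lebesgue ((B - \<Union>F) \<union> \<Union>F)"
          unfolding \<alpha>_def using Bm mF by (intro measure_mono_fmeasurable fmeasurable.Un fmeasurable.Diff) auto
        also have "\<dots> \<le> measure lebesgue (B - \<Union>F) + measure lebesgue (\<Union>F)"
          using Bm mF by (intro measure_Un_le) auto
        finally show ?thesis
          using Fm by simp
      qed
      then have "real n * (\<alpha> / 2) \<le> real n * measure lebesgue (\<Union>F)"
        by (intro mult_left_mono) auto
      moreover have "real n * (\<alpha> / 2) > 1"
        using n \<alpha> by (simp add: \<alpha>_def field_simps)
      ultimately show False by linarith
    qed
    then show "negligible ((\<Inter>n. small_slopes (real n) f) \<inter> {c<..<d})"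
      using Bm unfolding B_def[symmetric] by (simp add: negligible_iff_measure)
  qed
qed

lemma negligible_if_locally:
  fixes S :: "real set"
  assumes "\<And>x. \<exists>a b. a < x \<and> x < b \<and> negligible (S \<inter> {a<..<b})"
  shows "negligible S"
proof (subst locally_negligible_alt, rule ballI)
  fix x assume "x \<in> S"
  obtain a b where ab: "a < x" "x < b" "negligible (S \<inter> {a<..<b})"
    using assms by blast
  have "openin (top_of_set S) (S \<inter> {a<..<b})"
    by (simp add: openin_open_Int)
  then show "\<exists>U. openin (top_of_set S) U \<and> x \<in> U \<and> negligible U"
    using ab \<open>x \<in> S\<close> by (intro exI[of _ "S \<inter> {a<..<b}"]) simp
qed

lemma negligible_opposite_slopes:
  assumes "loc_abs_cont_on UNIV f" "p < q"
  shows "negligible (small_slopes q f \<inter> small_slopes (- p) (\<lambda>x. - f x))"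
proof (rule negligible_if_locally)
  fix x :: real
  have "abs_cont_on (x - 1) (x + 1) f"
    using assms(1) by (rule loc_abs_cont_on_UNIV) simp
  then show "\<exists>a b. a < x \<and> x < b \<and> negligible (small_slopes q f \<inter> small_slopes (- p) (\<lambda>x. - f x) \<inter> {a<..<b})"
    using negligible_opposite_slopes_interval[of "x - 1" "x + 1" f p q] assms(2)
    by (intro exI[of _ "x - 1"] exI[of _ "x + 1"]) simp
qed

lemma negligible_unbounded_slopes:
  assumes "loc_abs_cont_on UNIV f"
  shows "negligible (\<Inter>n. small_slopes (real n) f)"
proof (rule negligible_if_locally)
  fix x :: real
  have "abs_cont_on (x - 1) (x + 1) f"
    using assms by (rule loc_abs_cont_on_UNIV) simp
  then obtain \<delta> where "\<delta> > 0" and \<delta>: "\<And>c d. x - 1 \<le> c \<Longrightarrow> d \<le> x + 1 \<Longrightarrow> d - c < \<delta> \<Longrightarrow>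
      negligible ((\<Inter>n. small_slopes (real n) f) \<inter> {c<..<d})"
    using negligible_unbounded_slopes_interval by blast
  define e where "e = min 1 \<delta> / 3"
  have "e > 0" "e \<le> 1" "x + e - (x - e) < \<delta>"
    using \<open>\<delta> > 0\<close> by (auto simp: e_def min_def)
  then show "\<exists>a b. a < x \<and> x < b \<and> negligible ((\<Inter>n. small_slopes (real n) f) \<inter> {a<..<b})"
    using \<delta>[of "x - e" "x + e"] by (intro exI[of _ "x - e"] exI[of _ "x + e"]) simp
qed

text \<open>The slopes in \<open>small_slopes\<close> straddle \<open>x\<close>. Letting one
  endpoint tend to \<open>x\<close> by continuity carries the bound over to the one-sided difference
  quotients at \<open>x\<close>.\<close>

lemma slope_le_of_not_small_slopes:
  assumes cont: "isCont f x" and "x \<notin> small_slopes q f"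
  obtains d where "d > 0" "\<And>t. x < t \<Longrightarrow> t < x + d \<Longrightarrow> f t - f x \<le> q * (t - x)"
    "\<And>s. x - d < s \<Longrightarrow> s < x \<Longrightarrow> f x - f s \<le> q * (x - s)"
proof -
  obtain d where "d > 0" and d: "\<And>s t. s < x \<Longrightarrow> x < t \<Longrightarrow> t - s < d \<Longrightarrow> f t - f s \<le> q * (t - s)"
    using assms(2) unfolding small_slopes_def by force
  have cl: "(f \<longlongrightarrow> f x) (at_left x)" and cr: "(f \<longlongrightarrow> f x) (at_right x)"
    using cont unfolding isCont_def filterlim_at_split by auto
  show ?thesis
  proof (rule that[OF \<open>d > 0\<close>])
    fix t assume t: "x < t" "t < x + d"
    have "((\<lambda>s. q * (t - s) - (f t - f s)) \<longlongrightarrow> q * (t - x) - (f t - f x)) (at_left x)"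
      by (intro tendsto_intros cl)
    moreover have "\<forall>\<^sub>F s in at_left x. 0 \<le> q * (t - s) - (f t - f s)"
      unfolding eventually_at_left_field
      using t d by (intro exI[of _ "t - d"]) (auto simp: le_diff_eq)
    ultimately show "f t - f x \<le> q * (t - x)"
      using tendsto_lowerbound[of _ _ "at_left x" 0] by fastforce
  next
    fix s assume s: "x - d < s" "s < x"
    have "((\<lambda>t. q * (t - s) - (f t - f s)) \<longlongrightarrow> q * (x - s) - (f x - f s)) (at_right x)"
      by (intro tendsto_intros cr)
    moreover have "\<forall>\<^sub>F t in at_right x. 0 \<le> q * (t - s) - (f t - f s)"
      unfolding eventually_at_right_field
      using s d by (intro exI[of _ "s + d"]) (auto simp: le_diff_eq)
    ultimately show "f x - f s \<le> q * (x - s)"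
      using tendsto_lowerbound[of _ _ "at_right x" 0] by fastforce
  qed
qed

text \<open>The derivative is the supremum \<open>D\<close> of the \<open>q\<close> for which slopes
  above \<open>q\<close> persist. Just above \<open>D\<close> they do not persist, and their
  persistence just below \<open>D\<close> excludes, by \<open>opp\<close>, slopes below a slightly
  smaller rational.\<close>

lemma differentiable_if_not_small_slopes:
  assumes cont: "isCont f x"
    and opp: "\<And>p q. p \<in> \<rat> \<Longrightarrow> q \<in> \<rat> \<Longrightarrow> p < q \<Longrightarrow>
      x \<notin> small_slopes q f \<inter> small_slopes (- p) (\<lambda>x. - f x)"
    and k: "x \<notin> small_slopes k f" and k': "x \<notin> small_slopes k' (\<lambda>x. - f x)"
  shows "f field_differentiable (at x)"
proof -
  define S where "S = {q. x \<in> small_slopes q f}"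
  have bdd: "q < k" if "q \<in> S" for q
    using that k small_slopes_antimono[of k q f] unfolding S_def by (metis mem_Collect_eq not_le subsetD)
  \<comment> \<open>Slopes over short intervals are at least \<open>- k'\<close>, hence above
    \<open>- k' - 1\<close>; so \<open>S\<close> is not empty.\<close>
  have "- k' - 1 \<in> S"
  proof -
    obtain d where "d > 0" and d: "\<And>s t. s < x \<Longrightarrow> x < t \<Longrightarrow> t - s < d \<Longrightarrow> - f t - - f s \<le> k' * (t - s)"
      using k' unfolding small_slopes_def by force
    have "\<exists>s t. s < x \<and> x < t \<and> t - s < e \<and> (- k' - 1) * (t - s) < f t - f s" if "e > 0" for e
    proof -
      define m where "m = min d e / 3"
      have "m > 0" "x + m - (x - m) < d" "x + m - (x - m) < e"
        using \<open>d > 0\<close> \<open>e > 0\<close> by (auto simp: m_def min_def)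
      moreover have "- f (x + m) - - f (x - m) \<le> k' * (x + m - (x - m))"
        using calculation by (intro d) auto
      ultimately show ?thesis
        by (intro exI[of _ "x - m"] exI[of _ "x + m"]) (auto simp: algebra_simps)
    qed
    then show ?thesis
      by (simp add: S_def small_slopes_def)
  qed
  then have ne: "S \<noteq> {}" by blast
  have bdd': "bdd_above S"
    using bdd by (intro bdd_aboveI[of _ k]) (simp add: less_imp_le)
  define D where "D = Sup S"
  have "(f has_field_derivative D) (at x)"
    unfolding DERIV_def
  proof (rule LIM_I)
    fix r :: real assume "r > 0"
    \<comment> \<open>\<open>opp\<close> is available for rational pairs only, which keeps the
      exceptional set a countable union.\<close>
    obtain q where q: "q \<in> \<rat>" "D - r / 2 < q" "q < D"
      using Rats_dense_in_real[of "D - r / 2" D] \<open>r > 0\<close> by auto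
    obtain p where p: "p \<in> \<rat>" "D - r < p" "p < D - r / 2"
      using Rats_dense_in_real[of "D - r" "D - r / 2"] \<open>r > 0\<close> by auto
    obtain q' where "q' \<in> S" "q < q'"
      using less_cSup_iff[OF ne bdd'] q(3) by (auto simp: D_def)
    then have "x \<in> small_slopes q f"
      using small_slopes_antimono[of q q' f] by (auto simp: S_def)
    then have "x \<notin> small_slopes (- p) (\<lambda>x. - f x)"
      using opp[of p q] p q by auto
    then obtain d1 where d1: "d1 > 0" "\<And>t. x < t \<Longrightarrow> t < x + d1 \<Longrightarrow> - f t - - f x \<le> - p * (t - x)"
       "\<And>s. x - d1 < s \<Longrightarrow> s < x \<Longrightarrow> - f x - - f s \<le> - p * (x - s)"
      using slope_le_of_not_small_slopes[of x "\<lambda>x. - f x" "- p"] cont by (metis isCont_minus)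
    have "D + r / 2 \<notin> S"
      using cSup_upper[OF _ bdd', of "D + r / 2"] \<open>r > 0\<close> by (auto simp: D_def)
    then obtain d2 where d2: "d2 > 0" "\<And>t. x < t \<Longrightarrow> t < x + d2 \<Longrightarrow> f t - f x \<le> (D + r / 2) * (t - x)"
       "\<And>s. x - d2 < s \<Longrightarrow> s < x \<Longrightarrow> f x - f s \<le> (D + r / 2) * (x - s)"
      using slope_le_of_not_small_slopes[OF cont, of "D + r / 2"] by (auto simp: S_def)
    show "\<exists>s>0. \<forall>h. h \<noteq> 0 \<and> norm (h - 0) < s \<longrightarrow> norm ((f (x + h) - f x) / h - D) < r"
    proof (intro exI[of _ "min d1 d2"] conjI allI impI)
      show "min d1 d2 > 0"
        using d1 d2 by simp
      fix h :: real assume h: "h \<noteq> 0 \<and> norm (h - 0) < min d1 d2"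
      have "p \<le> (f (x + h) - f x) / h \<and> (f (x + h) - f x) / h \<le> D + r / 2"
      proof (cases "h > 0")
        case True
        then show ?thesis
          using d1(2)[of "x + h"] d2(2)[of "x + h"] h by (simp add: field_simps)
      next
        case False
        then show ?thesis
          using d1(3)[of "x + h"] d2(3)[of "x + h"] h by (simp add: field_simps)
      qed
      then show "norm ((f (x + h) - f x) / h - D) < r"
        using p \<open>r > 0\<close> by (simp add: abs_less_iff)
    qed
  qed
  then show ?thesis
    using field_differentiable_def by blast
qed

lemma loc_abs_cont_on_minus: "loc_abs_cont_on S f \<Longrightarrow> loc_abs_cont_on S (\<lambda>x. - f x)"
  by (simp add: loc_abs_cont_on_def abs_cont_on_minus)

text \<open>Where \<open>f\<close> is not differentiable, \<^const>\<open>deriv\<close> has a junk value that may respect any given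
  bound, so a bound on \<^const>\<open>deriv\<close> is useless unless that set is known to be negligible.\<close>

theorem loc_abs_cont_differentiable_ae:
  assumes ac: "loc_abs_cont_on UNIV f"
  shows "negligible {x. \<not> f field_differentiable (at x)}"
proof -
  define P where "P = {(p, q). p \<in> \<rat> \<and> q \<in> \<rat> \<and> p < (q::real)}"
  have "countable P"
  proof (rule countable_subset)
    show "P \<subseteq> \<rat> \<times> \<rat>" by (auto simp: P_def)
    show "countable ((\<rat> :: real set) \<times> (\<rat> :: real set))"
      by (intro countable_SIGMA countable_rat)
  qed
  then have "negligible (\<Union>(p, q)\<in>P. small_slopes q f \<inter> small_slopes (- p) (\<lambda>x. - f x))"
    using negligible_opposite_slopes[OF ac] by (intro negligible_countable_Union) (auto simp: P_def)
  then have "negligible ((\<Union>(p, q)\<in>P. small_slopes q f \<inter> small_slopes (- p) (\<lambda>x. - f x)) \<union>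
      ((\<Inter>n. small_slopes (real n) f) \<union> (\<Inter>n. small_slopes (real n) (\<lambda>x. - f x))))"
    using negligible_unbounded_slopes[OF ac] negligible_unbounded_slopes[OF loc_abs_cont_on_minus[OF ac]]
    by (intro negligible_Un)
  then show ?thesis
  proof (rule negligible_subset)
    have "f field_differentiable (at x)"
      if x: "x \<notin> (\<Union>(p, q)\<in>P. small_slopes q f \<inter> small_slopes (- p) (\<lambda>x. - f x))"
        "x \<notin> (\<Inter>n. small_slopes (real n) f)" "x \<notin> (\<Inter>n. small_slopes (real n) (\<lambda>x. - f x))" for x
    proof -
      obtain n n' where n: "x \<notin> small_slopes (real n) f" "x \<notin> small_slopes (real n') (\<lambda>x. - f x)"
        using x(2,3) by blast
      have "isCont f x"
        using loc_abs_cont_on_isCont[OF ac open_UNIV] by simp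
      then show ?thesis
        using x(1) n by (intro differentiable_if_not_small_slopes[of x f "real n" "real n'"]) (auto simp: P_def)
    qed
    then show "{x. \<not> f field_differentiable (at x)} \<subseteq>
      (\<Union>(p, q)\<in>P. small_slopes q f \<inter> small_slopes (- p) (\<lambda>x. - f x)) \<union>
      ((\<Inter>n. small_slopes (real n) f) \<union> (\<Inter>n. small_slopes (real n) (\<lambda>x. - f x)))"
      by blast
  qed
qed

section \<open>From almost everywhere bounds on the derivative to Lipschitz constants\<close>

text \<open>A positive derivative makes \<open>g\<close> grow over short intervals around the point.
  Almost every point of \<open>{a<..<b}\<close> has such intervals, so
  \<open>sum_increments_ge_of_cover\<close> applies to the division consisting of
  \<open>{a..b}\<close> alone.\<close>

lemma increment_nonneg_of_deriv_pos_ae: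
  assumes ac: "abs_cont_on a b g" and "a < b"
    and der: "negligible {x. \<not> (\<exists>D>0. (g has_field_derivative D) (at x))}" (is "negligible ?N")
  shows "g a \<le> g b"
proof (rule field_le_epsilon)
  fix \<epsilon> :: real assume "\<epsilon> > 0"
  obtain \<delta> where "\<delta> > 0" and \<delta>: "\<And>F B. F division_of \<Union>F \<Longrightarrow> \<Union>F \<subseteq> {a..b} \<Longrightarrow> B \<in> lmeasurable \<Longrightarrow>
       B \<subseteq> \<Union>(interior ` F) \<Longrightarrow>
       (\<And>x d. x \<in> B \<Longrightarrow> d > 0 \<Longrightarrow> \<exists>s t. s < x \<and> x < t \<and> t - s < d \<and> g s \<le> g t) \<Longrightarrow>
       measure lebesgue (\<Union>F) - measure lebesgue B < \<delta> \<Longrightarrow>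
       (\<Sum>K\<in>F. g (Sup K) - g (Inf K)) > - \<epsilon>"
    using sum_increments_ge_of_cover[OF ac less_imp_le[OF \<open>a < b\<close>] \<open>\<epsilon> > 0\<close>] by blast
  have N: "?N \<in> null_sets lebesgue"
    using der by (simp add: negligible_iff_null_sets)
  have "(\<Sum>K\<in>{{a..b}}. g (Sup K) - g (Inf K)) > - \<epsilon>"
  proof (rule \<delta>)
    show "{{a..b}} division_of \<Union>{{a..b}}"
      using division_of_self[of a b] \<open>a < b\<close> by simp
    show "{a<..<b} - ?N \<in> lmeasurable"
      by (rule fmeasurableI2[OF lmeasurable_interval(2)[of a b, unfolded box_real]])
        (use null_setsD2[OF N] in auto)
    have "measure lebesgue ({a<..<b} - ?N) = measure lebesgue {a<..<b}"
      using N by (intro measure_Diff_null_set) auto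
    then show "measure lebesgue (\<Union>{{a..b}}) - measure lebesgue ({a<..<b} - ?N) < \<delta>"
      using \<open>\<delta> > 0\<close> \<open>a < b\<close> by simp
    fix x d :: real assume x: "x \<in> {a<..<b} - ?N" and "d > 0"
    then obtain D where D: "D > 0" "(g has_field_derivative D) (at x)"
      by auto
    obtain d1 where d1: "d1 > 0" "\<And>h. 0 < h \<Longrightarrow> h < d1 \<Longrightarrow> g x < g (x + h)"
      using DERIV_pos_inc_right[OF D(2,1)] by blast
    obtain d2 where d2: "d2 > 0" "\<And>h. 0 < h \<Longrightarrow> h < d2 \<Longrightarrow> g (x - h) < g x"
      using DERIV_pos_inc_left[OF D(2,1)] by blast
    define m where "m = min d (min d1 d2) / 3"
    have "m > 0" "x + m - (x - m) < d" "m < d1" "m < d2"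
      using \<open>d > 0\<close> d1(1) d2(1) by (auto simp: m_def min_def)
    then show "\<exists>s t. s < x \<and> x < t \<and> t - s < d \<and> g s \<le> g t"
      using d1(2)[of m] d2(2)[of m] by (intro exI[of _ "x - m"] exI[of _ "x + m"]) auto
  qed auto
  then show "g a \<le> g b + \<epsilon>"
    using \<open>a < b\<close> by simp
qed

lemma increment_le_of_deriv_le_ae:
  assumes ac: "loc_abs_cont_on UNIV f" and L: "AE x in lebesgue. deriv f x \<le> L" and "a \<le> b"
  shows "f b - f a \<le> L * (b - a)"
proof (cases "a < b")
  case True
  show ?thesis
  proof (rule field_le_epsilon)
    fix e :: real assume "e > 0"
    \<comment> \<open>The covering argument needs a strictly positive derivative; raising
      \<open>L\<close> by \<open>e / (b - a)\<close> provides it at the cost of \<open>e\<close>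
      over \<open>{a..b}\<close>.\<close>
    define K where "K = L + e / (b - a)"
    have "K > L"
      using \<open>e > 0\<close> True by (simp add: K_def)
    define g where "g = (\<lambda>x. - (f x - K * x))"
    have "abs_cont_on a b g"
      unfolding g_def using loc_abs_cont_on_UNIV[OF ac \<open>a \<le> b\<close>]
      by (intro abs_cont_on_minus abs_cont_on_diff_linear)
    moreover have "negligible {x. \<not> (\<exists>D>0. (g has_field_derivative D) (at x))}"
    proof -
      have "AE x in lebesgue. f field_differentiable (at x)"
        using loc_abs_cont_differentiable_ae[OF ac]
        by (intro AE_I'[of "{x. \<not> f field_differentiable (at x)}"]) (auto simp: negligible_iff_null_sets)
      with L have "AE x in lebesgue. \<exists>D>0. (g has_field_derivative D) (at x)"
      proof eventually_elim
        case (elim x)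
        then have "(f has_field_derivative deriv f x) (at x)"
          by (simp add: DERIV_deriv_iff_field_differentiable)
        then have "(g has_field_derivative - (deriv f x - K * 1)) (at x)"
          unfolding g_def by (intro derivative_intros DERIV_cmult DERIV_ident)
        then show ?case
          using elim(1) \<open>K > L\<close> by (intro exI[of _ "- (deriv f x - K * 1)"]) auto
      qed
      then show ?thesis
        by (simp add: negligible_iff_null_sets AE_iff_null_sets completion.AE_iff_null_sets)
    qed
    ultimately have "g a \<le> g b"
      by (rule increment_nonneg_of_deriv_pos_ae[OF _ True])
    then have "f b - f a \<le> K * (b - a)"
      by (simp add: g_def algebra_simps)
    also have "\<dots> = L * (b - a) + e"
      using True by (simp add: K_def field_simps)
    finally show "f b - f a \<le> L * (b - a) + e" .
  qed
qed (use \<open>a \<le> b\<close> in simp)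

lemma lipschitz_of_deriv_bounded_ae:
  assumes ac: "loc_abs_cont_on UNIV f" and L: "AE x in lebesgue. \<bar>deriv f x\<bar> \<le> L"
  shows "\<bar>f y - f x\<bar> \<le> L * \<bar>y - x\<bar>"
proof -
  have *: "\<bar>f b - f a\<bar> \<le> L * (b - a)" if "a \<le> b" for a b
  proof -
    have "f b - f a \<le> L * (b - a)"
      using L by (intro increment_le_of_deriv_le_ae[OF ac _ that]) (auto elim!: eventually_mono)
    \<comment> \<open>\<open>deriv\<close> of the negative of \<open>f\<close> is minus
      \<open>deriv f\<close> only where \<open>f\<close> is differentiable, so the lower bound
      cannot be transferred at every point.\<close>
    moreover have "AE x in lebesgue. f field_differentiable (at x)"
      using loc_abs_cont_differentiable_ae[OF ac]
      by (intro AE_I'[of "{x. \<not> f field_differentiable (at x)}"]) (auto simp: negligible_iff_null_sets)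
    with L have "AE x in lebesgue. deriv (\<lambda>x. - f x) x \<le> L"
    proof eventually_elim
      case (elim x)
      then have "deriv (\<lambda>x. - f x) x = - deriv f x"
        by (intro DERIV_imp_deriv derivative_intros) (simp add: DERIV_deriv_iff_field_differentiable)
      then show ?case using elim by simp
    qed
    then have "- f b - - f a \<le> L * (b - a)"
      by (rule increment_le_of_deriv_le_ae[OF loc_abs_cont_on_minus[OF ac] _ that])
    ultimately show ?thesis
      by linarith
  qed
  show ?thesis
    using *[of x y] *[of y x] by (cases "x \<le> y") (auto simp: abs_minus_commute)
qed

section \<open>Taylor remainders and integrals over half lines\<close>

lemma DERIV_power_div_fact:
  "((\<lambda>t. (t - x) ^ Suc i / fact (Suc i)) has_field_derivative (s - x) ^ i / fact i) (at s)" for x s :: real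
proof -
  have "((\<lambda>t. t - x) has_field_derivative 1) (at s)"
    by (auto intro!: derivative_eq_intros)
  from DERIV_cdivide[OF DERIV_power[OF this, of "Suc i"], of "fact (Suc i)"] show ?thesis
    by (simp del: power_Suc add: divide_simps)
qed

text \<open>Induction on \<open>j\<close> with \<open>d\<close> shifted: the remainder
  \<open>r\<close> has as derivative the remainder \<open>r'\<close> of \<open>d 1\<close>, which is
  bounded by the derivative of \<open>G\<close>. So \<open>G + r\<close> and \<open>G - r\<close>
  are nondecreasing to the right of \<open>x\<close>, where both vanish.\<close>

lemma Taylor_lipschitz_right:
  fixes d :: "nat \<Rightarrow> real \<Rightarrow> real"
  assumes "\<And>i t. i < j \<Longrightarrow> (d i has_field_derivative d (Suc i) t) (at t)"
    and "\<And>s t. \<bar>d j t - d j s\<bar> \<le> L * \<bar>t - s\<bar>" and "x \<le> t"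
  shows "\<bar>d 0 t - (\<Sum>i\<le>j. d i x * ((t - x) ^ i / fact i))\<bar> \<le> L * ((t - x) ^ Suc j / fact (Suc j))"
  using assms
proof (induction j arbitrary: d t)
  case 0
  then show ?case
    using 0(2)[of t x] by simp
next
  case (Suc j)
  define r where "r = (\<lambda>t. d 0 t - (\<Sum>i\<le>Suc j. d i x * ((t - x) ^ i / fact i)))"
  define r' where "r' = (\<lambda>t. d 1 t - (\<Sum>i\<le>j. d (Suc i) x * ((t - x) ^ i / fact i)))"

  have r: "(r has_field_derivative r' s) (at s)" for s
  proof -
    have "r = (\<lambda>t. d 0 t - (d 0 x + (\<Sum>i\<le>j. d (Suc i) x * ((t - x) ^ Suc i / fact (Suc i)))))"
      by (simp add: r_def sum.atMost_Suc_shift del: sum.atMost_Suc fact_Suc power_Suc)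
    moreover have "(d 0 has_field_derivative d 1 s) (at s)"
      using Suc.prems(1)[of 0 s] by simp
    moreover have "((\<lambda>t. d 0 x + (\<Sum>i\<le>j. d (Suc i) x * ((t - x) ^ Suc i / fact (Suc i)))) has_field_derivative
        0 + (\<Sum>i\<le>j. d (Suc i) x * ((s - x) ^ i / fact i))) (at s)"
      by (intro DERIV_add DERIV_const DERIV_sum DERIV_cmult DERIV_power_div_fact)
    ultimately show ?thesis
      using DERIV_diff by (fastforce simp: r'_def)
  qed
  have r'_le: "\<bar>r' s\<bar> \<le> L * ((s - x) ^ Suc j / fact (Suc j))" if "x \<le> s" for s
    using Suc.IH[of "\<lambda>i. d (Suc i)" s] Suc.prems(1,2) that by (simp add: r'_def)
  have r0: "r x = 0"
    by (simp add: r_def sum.atMost_Suc_shift del: sum.atMost_Suc)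
  define G where "G = (\<lambda>t. L * ((t - x) ^ Suc (Suc j) / fact (Suc (Suc j))))"
  have G: "(G has_field_derivative L * ((s - x) ^ Suc j / fact (Suc j))) (at s)" for s
    unfolding G_def by (intro DERIV_cmult DERIV_power_div_fact)
  have "G x + r x \<le> G t + r t"
  proof (rule DERIV_nonneg_imp_nondecreasing[OF \<open>x \<le> t\<close>])
    fix s assume "x \<le> s"
    show "\<exists>y. ((\<lambda>a. G a + r a) has_real_derivative y) (at s) \<and> 0 \<le> y"
      using DERIV_add[OF G r, of s] r'_le[OF \<open>x \<le> s\<close>] by (auto simp del: fact_Suc power_Suc)
  qed
  moreover have "G x - r x \<le> G t - r t"
  proof (rule DERIV_nonneg_imp_nondecreasing[OF \<open>x \<le> t\<close>])
    fix s assume "x \<le> s"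
    show "\<exists>y. ((\<lambda>a. G a - r a) has_real_derivative y) (at s) \<and> 0 \<le> y"
      using DERIV_diff[OF G r, of s] r'_le[OF \<open>x \<le> s\<close>] by (auto simp del: fact_Suc power_Suc)
  qed
  ultimately have "\<bar>r t\<bar> \<le> G t"
    using r0 by (simp add: G_def abs_le_iff)
  then show ?case
    by (simp add: r_def G_def del: fact_Suc power_Suc sum.atMost_Suc)
qed

lemma Taylor_lipschitz:
  fixes d :: "nat \<Rightarrow> real \<Rightarrow> real"
  assumes d: "\<And>i t. i < j \<Longrightarrow> (d i has_field_derivative d (Suc i) t) (at t)"
    and L: "\<And>s t. \<bar>d j t - d j s\<bar> \<le> L * \<bar>t - s\<bar>"
  shows "\<bar>d 0 t - (\<Sum>i\<le>j. d i x * ((t - x) ^ i / fact i))\<bar> \<le> L * (\<bar>t - x\<bar> ^ Suc j / fact (Suc j))"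
proof (cases "x \<le> t")
  case True
  then show ?thesis
    using Taylor_lipschitz_right[OF d L True] by simp
next
  case False
  \<comment> \<open>Reflection at 0 turns the left side of \<open>x\<close> into the right side of
    \<open>- x\<close>; the sign makes the \<open>e i\<close> successive derivatives of
    \<open>d 0 (- s)\<close>.\<close>
  define e where "e = (\<lambda>i s. (- 1) ^ i * d i (- s))"
  have "(e i has_field_derivative e (Suc i) s) (at s)" if "i < j" for i s
  proof -
    have "((\<lambda>s. d i (- s)) has_field_derivative d (Suc i) (- s) * (- 1)) (at s)"
      by (rule DERIV_chain2[OF d[OF that]]) (auto intro!: derivative_eq_intros)
    from DERIV_cmult[OF this, of "(- 1) ^ i"] show ?thesis
      by (simp add: e_def)
  qed
  moreover have "\<bar>e j t - e j s\<bar> \<le> L * \<bar>t - s\<bar>" for s t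
  proof -
    have "\<bar>e j t - e j s\<bar> = \<bar>d j (- t) - d j (- s)\<bar>"
      by (simp add: e_def abs_mult power_abs flip: right_diff_distrib)
    also have "\<dots> \<le> L * \<bar>- t - - s\<bar>"
      by (rule L)
    also have "\<bar>- t - - s\<bar> = \<bar>t - s\<bar>" by linarith
    finally show ?thesis .
  qed
  ultimately have "\<bar>e 0 (- t) - (\<Sum>i\<le>j. e i (- x) * ((- t - - x) ^ i / fact i))\<bar> \<le> L * ((- t - - x) ^ Suc j / fact (Suc j))"
    using False by (intro Taylor_lipschitz_right) auto
  moreover have "e i (- x) * ((- t - - x) ^ i / fact i) = d i x * ((t - x) ^ i / fact i)" for i
  proof -
    have "(- t - - x) ^ i = (- 1) ^ i * (t - x) ^ i"
      by (simp flip: power_mult_distrib)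
    moreover have "(- 1 :: real) ^ i * (- 1) ^ i = 1"
      by (simp flip: power_mult_distrib)
    ultimately show ?thesis
      by (simp add: e_def)
  qed
  moreover have "- t - - x = \<bar>t - x\<bar>"
    using False by simp
  moreover have "e 0 (- t) = d 0 t"
    by (simp add: e_def)
  ultimately show ?thesis
    by (simp only:)
qed

section \<open>Integrals over half lines\<close>

lemma set_integrable_of_integrable: "A \<in> sets borel \<Longrightarrow> integrable lborel g \<Longrightarrow> set_integrable lborel A g"
  for g :: "real \<Rightarrow> real"
  unfolding set_integrable_def by (intro integrable_mult_indicator) auto

lemma LINT_atMost_split:
  fixes g :: "real \<Rightarrow> real"
  assumes "set_integrable lborel {..x} g" "a \<le> x"
  shows "(LINT t:{..x}|lborel. g t) = (LINT t:{..<a}|lborel. g t) + integral {a..x} g"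
    "g integrable_on {a..x}"
proof -
  have u: "{..x} = {..<a} \<union> {a..x}"
    using assms(2) by auto
  have s: "set_integrable lborel {a..x} g" "set_integrable lborel {..<a} g"
    using assms by (auto intro: set_integrable_subset)
  show "g integrable_on {a..x}"
    using set_borel_integral_eq_integral(1)[OF s(1)] .
  show "(LINT t:{..x}|lborel. g t) = (LINT t:{..<a}|lborel. g t) + integral {a..x} g"
    unfolding u set_borel_integral_eq_integral(2)[OF s(1), symmetric]
    using s by (intro set_integral_Un) auto
qed

text \<open>Near \<open>x\<close> the half line is a fixed half line ending at \<open>x - 1\<close>
  followed by a compact interval, on which the fundamental theorem applies.\<close>

lemma
  fixes g :: "real \<Rightarrow> real"
  assumes si: "\<And>u. set_integrable lborel {..u} g"
  shows LINT_atMost_continuous: "isCont (\<lambda>x. LINT t:{..x}|lborel. g t) x"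
    and LINT_atMost_deriv: "isCont g x \<Longrightarrow> ((\<lambda>x. LINT t:{..x}|lborel. g t) has_field_derivative g x) (at x)"
proof -
  have eq: "(LINT t:{..u}|lborel. g t) = (LINT t:{..<x-1}|lborel. g t) + integral {x-1..u} g"
    if "u \<in> {x-1<..<x+1}" for u
    using LINT_atMost_split(1)[OF si, of "x - 1" u] that by auto
  have int: "g integrable_on {x-1..x+1}"
    using LINT_atMost_split(2)[OF si] by simp
  have x: "x \<in> {x-1<..<x+1}" "open {x-1<..<x+1}" by auto
  have ev: "\<forall>\<^sub>F u in nhds x. (LINT t:{..u}|lborel. g t) = (LINT t:{..<x-1}|lborel. g t) + integral {x-1..u} g"
    using eq x unfolding eventually_nhds by blast
  have "continuous_on {x-1<..<x+1} (\<lambda>u. integral {x-1..u} g)"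
    using indefinite_integral_continuous_1[OF int] by (rule continuous_on_subset) auto
  then have "isCont (\<lambda>u. (LINT t:{..<x-1}|lborel. g t) + integral {x-1..u} g) x"
    using x by (intro continuous_intros) (simp add: continuous_on_eq_continuous_at)
  then show "isCont (\<lambda>x. LINT t:{..x}|lborel. g t) x"
    using isCont_cong[OF ev] by simp
  assume "isCont g x"
  then have "((\<lambda>u. integral {x-1..u} g) has_vector_derivative g x) (at x within ({x-1..x+1} - {}))"
    by (intro integral_has_vector_derivative_continuous_at[OF int]) (auto intro: continuous_at_imp_continuous_at_within)
  then have "((\<lambda>u. integral {x-1..u} g) has_field_derivative g x) (at x)"
    by (simp add: at_within_Icc_at has_real_derivative_iff_has_vector_derivative)
  from DERIV_add[OF DERIV_const this]
  have "((\<lambda>u. (LINT t:{..<x-1}|lborel. g t) + integral {x-1..u} g) has_field_derivative g x) (at x)"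
    by simp
  then show "((\<lambda>x. LINT t:{..x}|lborel. g t) has_field_derivative g x) (at x)"
    using DERIV_cong_ev[OF refl ev refl] by simp
qed

lemma LINT_Icc_tendsto:
  fixes g :: "real \<Rightarrow> real"
  assumes "set_integrable lborel {..x} g"
  shows "(\<lambda>n. LINT t:{x - real n..x}|lborel. g t) \<longlonglongrightarrow> (LINT t:{..x}|lborel. g t)"
proof -
  have u: "(\<Union>n. {x - real n..x}) = {..x}"
  proof (intro equalityI subsetI)
    fix t assume "t \<in> {..x}"
    moreover obtain n :: nat where "x - t \<le> real n"
      using real_arch_simple by blast
    ultimately show "t \<in> (\<Union>n. {x - real n..x})"
      by (auto intro!: exI[of _ n])
  qed auto
  have "incseq (\<lambda>n. {x - real n..x})"
    by (auto simp: incseq_def)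
  with set_integral_cont_up[of "\<lambda>n. {x - real n..x}" lborel g] assms show ?thesis
    unfolding u by simp
qed

lemma LINT_atMost_tendsto_0:
  fixes g :: "real \<Rightarrow> real"
  assumes "set_integrable lborel {..x} g"
  shows "(\<lambda>n. LINT t:{..x - real n}|lborel. g t) \<longlonglongrightarrow> 0"
proof -
  have u: "(\<Inter>n. {..x - real n}) = {}"
  proof -
    have "\<exists>n. \<not> t \<le> x - real n" for t
      using reals_Archimedean2[of "x - t"] by (auto simp: not_le algebra_simps)
    then show ?thesis by auto
  qed
  have "decseq (\<lambda>n. {..x - real n})"
    by (auto simp: decseq_def)
  with set_integral_cont_down[of "\<lambda>n. {..x - real n}" lborel g] assms show ?thesis
    unfolding u by (simp add: set_lebesgue_integral_def)
qed

text \<open>Monotone convergence along \<open>{x - n..x}\<close>; this is how uniform bounds on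
  truncated moments become finite moments.\<close>

lemma set_integrable_atMost_if_bounded:
  fixes g :: "real \<Rightarrow> real"
  assumes [measurable]: "g \<in> borel_measurable borel" and nonneg: "\<And>t. t \<le> x \<Longrightarrow> 0 \<le> g t"
    and int: "\<And>a. a \<le> x \<Longrightarrow> set_integrable lborel {a..x} g"
    and bound: "\<And>a. a \<le> x \<Longrightarrow> (LINT t:{a..x}|lborel. g t) \<le> C"
  shows "set_integrable lborel {..x} g"
proof -
  define F where "F = (\<lambda>n t. indicator {x - real n..x} t *\<^sub>R g t)"
  have mono: "mono (\<lambda>n. F n t)" for t
    using nonneg by (auto simp: F_def mono_def split: split_indicator)
  have iF: "integrable lborel (F n)" for n
    using int[of "x - real n"] by (simp add: F_def set_integrable_def)
  have inc: "incseq (\<lambda>n. integral\<^sup>L lborel (F n))"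
    using mono by (auto simp: incseq_def intro!: integral_mono iF dest: monoD)
  moreover have "integral\<^sup>L lborel (F n) \<le> C" for n
    using bound[of "x - real n"] by (simp add: F_def set_lebesgue_integral_def)
  ultimately obtain l where l: "(\<lambda>n. integral\<^sup>L lborel (F n)) \<longlonglongrightarrow> l"
    using incseq_convergent by blast
  have lim: "(\<lambda>n. F n t) \<longlonglongrightarrow> indicator {..x} t *\<^sub>R g t" for t
  proof (rule tendsto_eventually)
    obtain N :: nat where "x - t \<le> real N"
      using real_arch_simple by blast
    then show "\<forall>\<^sub>F n in sequentially. F n t = indicator {..x} t *\<^sub>R g t"
      by (intro eventually_sequentiallyI[of N]) (auto simp: F_def split: split_indicator)
  qed
  show ?thesis
    unfolding set_integrable_def
    by (rule integrable_monotone_convergence[OF iF _ _ l]) (auto simp: mono lim[simplified])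
qed

text \<open>One step of Cauchy's formula for repeated integrals: by Tonelli the triangle
  \<open>s \<le> t \<le> x\<close> is integrated in \<open>t\<close> first, where
  \<open>(t - s) ^ k / fact k\<close> has the power of order \<open>k + 1\<close> as primitive. As
  \<open>p\<close> is nonnegative, finiteness of the result also gives integrability.\<close>

lemma LINT_atMost_iterate:
  fixes p :: "real \<Rightarrow> real"
  assumes [measurable]: "p \<in> borel_measurable borel" and nonneg: "\<And>t. 0 \<le> p t"
    and k: "\<And>t. set_integrable lborel {..t} (\<lambda>s. (t - s) ^ k / fact k * p s)"
    and Sk: "set_integrable lborel {..x} (\<lambda>s. (x - s) ^ Suc k / fact (Suc k) * p s)"
  shows "set_integrable lborel {..x} (\<lambda>t. LINT s:{..t}|lborel. (t - s) ^ k / fact k * p s)"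
    and "(LINT t:{..x}|lborel. LINT s:{..t}|lborel. (t - s) ^ k / fact k * p s) =
      (LINT s:{..x}|lborel. (x - s) ^ Suc k / fact (Suc k) * p s)"
proof -
  define G where "G = (\<lambda>t. LINT s:{..t}|lborel. (t - s) ^ k / fact k * p s)"
  define H where "H = (LINT s:{..x}|lborel. (x - s) ^ Suc k / fact (Suc k) * p s)"
  define f where "f = (\<lambda>t s. ennreal ((if t \<le> x \<and> s \<le> t then 1 else 0) * ((t - s) ^ k / fact k * p s)))"
  \<comment> \<open>Moving the domain into the integrand makes measurability in \<open>t\<close>
    apparent.\<close>
  have G_alt: "G t = (\<integral>s. (if s \<le> t then 1 else 0) * ((t - s) ^ k / fact k * p s) \<partial>lborel)" for t
    unfolding G_def set_lebesgue_integral_def by (intro Bochner_Integration.integral_cong) auto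
  have [measurable]: "G \<in> borel_measurable borel"
    unfolding G_alt by measurable
  have G_nonneg: "0 \<le> G t" for t
    unfolding G_alt using nonneg by (intro integral_nonneg_AE) auto
  have "(\<integral>\<^sup>+t. ennreal (indicator {..x} t *\<^sub>R G t) \<partial>lborel) = (\<integral>\<^sup>+t. (\<integral>\<^sup>+s. f t s \<partial>lborel) \<partial>lborel)"
  proof (rule nn_integral_cong)
    fix t
    show "ennreal (indicator {..x} t *\<^sub>R G t) = (\<integral>\<^sup>+s. f t s \<partial>lborel)"
    proof (cases "t \<le> x")
      case True
      have "integrable lborel (\<lambda>s. (if s \<le> t then 1 else 0) * ((t - s) ^ k / fact k * p s))"
        using k[of t] unfolding set_integrable_def
        by (rule Bochner_Integration.integrable_cong[THEN iffD1, rotated 2]) auto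
      then have "(\<integral>\<^sup>+s. ennreal ((if s \<le> t then 1 else 0) * ((t - s) ^ k / fact k * p s)) \<partial>lborel) = ennreal (G t)"
        unfolding G_alt using nonneg by (intro nn_integral_eq_integral) auto
      with True show ?thesis
        by (simp add: f_def)
    qed (simp add: f_def)
  qed
  also have "\<dots> = (\<integral>\<^sup>+s. (\<integral>\<^sup>+t. f t s \<partial>lborel) \<partial>lborel)"
    unfolding f_def by (rule lborel_pair.Fubini') measurable
  also have "\<dots> = (\<integral>\<^sup>+s. ennreal (indicator {..x} s *\<^sub>R ((x - s) ^ Suc k / fact (Suc k) * p s)) \<partial>lborel)"
  proof (rule nn_integral_cong)
    fix s
    show "(\<integral>\<^sup>+t. f t s \<partial>lborel) = ennreal (indicator {..x} s *\<^sub>R ((x - s) ^ Suc k / fact (Suc k) * p s))"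
    proof (cases "s \<le> x")
      case True
      have "(\<integral>\<^sup>+t. f t s \<partial>lborel) = (\<integral>\<^sup>+t. ennreal (p s) * (ennreal ((t - s) ^ k / fact k) * indicator {s..x} t) \<partial>lborel)"
        unfolding f_def using nonneg[of s]
        by (intro nn_integral_cong) (auto simp flip: ennreal_mult' simp: mult.commute split: split_indicator)
      also have "\<dots> = ennreal (p s) * (\<integral>\<^sup>+t. ennreal ((t - s) ^ k / fact k) * indicator {s..x} t \<partial>lborel)"
        by (rule nn_integral_cmult) measurable
      also have "(\<integral>\<^sup>+t. ennreal ((t - s) ^ k / fact k) * indicator {s..x} t \<partial>lborel) =
          ennreal ((x - s) ^ Suc k / fact (Suc k) - (s - s) ^ Suc k / fact (Suc k))"
      proof (rule nn_integral_FTC_Icc[OF _ _ _ True])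
        show "((\<lambda>t. (t - s) ^ Suc k / fact (Suc k)) has_field_derivative (t - s) ^ k / fact k) (at t)" for t
          by (rule DERIV_power_div_fact)
      qed auto
      finally show ?thesis
        using True nonneg[of s] by (simp add: ennreal_mult'[symmetric] mult.commute del: fact_Suc)
    qed (auto simp: f_def intro!: nn_integral_zero')
  qed
  also have "\<dots> = ennreal H"
    unfolding H_def set_lebesgue_integral_def
    using Sk nonneg unfolding set_integrable_def
    by (intro nn_integral_eq_integral) (auto split: split_indicator simp del: fact_Suc power_Suc)
  finally have nn: "(\<integral>\<^sup>+t. ennreal (indicator {..x} t *\<^sub>R G t) \<partial>lborel) = ennreal H" .
  then show int: "set_integrable lborel {..x} (\<lambda>t. LINT s:{..t}|lborel. (t - s) ^ k / fact k * p s)"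
    unfolding G_def[symmetric] set_integrable_def using G_nonneg by (intro integrableI_nonneg) auto
  have "H \<ge> 0"
    unfolding H_def set_lebesgue_integral_def using nonneg
    by (intro integral_nonneg_AE) (auto split: split_indicator simp del: fact_Suc power_Suc)
  have "(\<integral>t. indicator {..x} t *\<^sub>R G t \<partial>lborel) = enn2real (\<integral>\<^sup>+t. ennreal (indicator {..x} t *\<^sub>R G t) \<partial>lborel)"
    using G_nonneg by (intro integral_eq_nn_integral) auto
  also have "\<dots> = H"
    unfolding nn using \<open>H \<ge> 0\<close> by simp
  finally show "(LINT t:{..x}|lborel. LINT s:{..t}|lborel. (t - s) ^ k / fact k * p s) =
      (LINT s:{..x}|lborel. (x - s) ^ Suc k / fact (Suc k) * p s)"
    by (simp only: G_def[symmetric] H_def[symmetric] set_lebesgue_integral_def[of lborel "{..x}" G])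
qed

section \<open>Integrated Pearson densities\<close>

text \<open>The finite set \<open>X\<close> stands for the endpoints of the intervals. Off the support both sides of
  the kernel identity vanish, so that it can be required at every \<open>x \<notin> X\<close>. The functions \<open>L k\<close> and,
  below, \<open>U k\<close> are the lower and upper iterated integrals of the density, written as single
  integrals by Cauchy's formula.\<close>

locale pearson =
  fixes p :: "real \<Rightarrow> real" and \<kappa>\<^sub>0 \<kappa>\<^sub>1 \<kappa>\<^sub>2 \<mu> :: real and X :: "real set" and N :: nat
  assumes p_measurable [measurable]: "p \<in> borel_measurable borel"
    and p_nonneg: "0 \<le> p t"
    and p_integrable: "integrable lborel p"
    and p_total: "(\<integral>t. p t \<partial>lborel) = 1"
    and mean_integrable: "integrable lborel (\<lambda>t. t * p t)"
    and mean: "(\<integral>t. t * p t \<partial>lborel) = \<mu>"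
    and finite_X: "finite X"
    and p_isCont: "x \<notin> X \<Longrightarrow> isCont p x"
    and kernel: "x \<notin> X \<Longrightarrow> (LINT t:{..x}|lborel. (\<mu> - t) * p t) = (\<kappa>\<^sub>2 * x\<^sup>2 + \<kappa>\<^sub>1 * x + \<kappa>\<^sub>0) * p x"
    and q_pos: "1 \<le> j \<Longrightarrow> j \<le> N \<Longrightarrow> 0 < pearson_q \<kappa>\<^sub>2 j"
begin

definition Q :: "real \<Rightarrow> real" where "Q x = \<kappa>\<^sub>2 * x\<^sup>2 + \<kappa>\<^sub>1 * x + \<kappa>\<^sub>0"
definition Q' :: "real \<Rightarrow> real" where "Q' x = 2 * \<kappa>\<^sub>2 * x + \<kappa>\<^sub>1"
text \<open>Equal to \<open>Q * p\<close> off \<open>X\<close>. It is continuous everywhere, so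
  integration by parts may cross the points of \<open>X\<close>, where \<open>p\<close> may
  jump.\<close>

definition T :: "real \<Rightarrow> real" where "T x = (LINT t:{..x}|lborel. (\<mu> - t) * p t)"
definition M :: "nat \<Rightarrow> real \<Rightarrow> real" where "M k x = (LINT t:{..x}|lborel. (x - t) ^ k * p t)"

primrec L :: "nat \<Rightarrow> real \<Rightarrow> real" where
  "L 0 = p"
| "L (Suc k) = (\<lambda>x. LINT t:{..x}|lborel. (x - t) ^ k / fact k * p t)"

lemma T_eq: "x \<notin> X \<Longrightarrow> T x = Q x * p x"
  using kernel by (simp add: T_def Q_def)

lemma L_Suc_M: "L (Suc k) x = M k x / fact k"
  by (simp add: M_def)

lemma open_off_X: "open (- X)"
  using finite_X by (simp add: finite_imp_closed open_Compl)

lemma off_X_nhds: "x \<notin> X \<Longrightarrow> \<forall>\<^sub>F y in nhds x. y \<notin> X"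
  using open_off_X unfolding eventually_nhds by (auto intro!: exI[of _ "- X"])

lemma p_pos_nhds: "x \<notin> X \<Longrightarrow> 0 < p x \<Longrightarrow> \<forall>\<^sub>F y in nhds x. 0 < p y"
  using order_tendstoD(1)[of p "p x" "nhds x" 0] p_isCont[of x]
  by (simp add: isCont_def tendsto_at_iff_tendsto_nhds)

lemma centered_integrable: "integrable lborel (\<lambda>t. (\<mu> - t) * p t)"
  using Bochner_Integration.integrable_diff[OF integrable_mult_right[OF p_integrable, of \<mu>] mean_integrable]
  by (simp add: left_diff_distrib)

lemma centered_set_integrable: "A \<in> sets borel \<Longrightarrow> set_integrable lborel A (\<lambda>t. (\<mu> - t) * p t)"
  by (rule set_integrable_of_integrable[OF _ centered_integrable])

lemma centered_total: "(\<integral>t. (\<mu> - t) * p t \<partial>lborel) = 0"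
proof -
  have "(\<integral>t. (\<mu> - t) * p t \<partial>lborel) = (\<integral>t. \<mu> * p t - t * p t \<partial>lborel)"
    by (simp add: left_diff_distrib)
  also have "\<dots> = 0"
    using p_integrable mean_integrable by (simp add: p_total mean)
  finally show ?thesis .
qed

section \<open>The integrated kernel and its sign\<close>

lemma T_isCont: "isCont T x"
  unfolding T_def by (rule LINT_atMost_continuous) (simp add: centered_set_integrable)

lemma T_deriv: "x \<notin> X \<Longrightarrow> (T has_field_derivative (\<mu> - x) * p x) (at x)"
  unfolding T_def using p_isCont[of x]
  by (intro LINT_atMost_deriv) (auto simp: centered_set_integrable intro!: continuous_intros)

lemma T_split: "a \<le> x \<Longrightarrow> T x = T a + (LINT t:{a<..x}|lborel. (\<mu> - t) * p t)"
proof -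
  assume "a \<le> x"
  then have u: "{..x} = {..a} \<union> {a<..x}" by auto
  show ?thesis
    unfolding T_def u by (rule set_integral_Un) (auto intro!: centered_set_integrable)
qed

lemma T_upper: "T x = - (LINT t:{x<..}|lborel. (\<mu> - t) * p t)"
proof -
  have u: "UNIV = {..x} \<union> {x<..}" by auto
  have "(LINT t:UNIV|lborel. (\<mu> - t) * p t) = T x + (LINT t:{x<..}|lborel. (\<mu> - t) * p t)"
    unfolding T_def u by (rule set_integral_Un) (auto intro!: centered_set_integrable)
  then show ?thesis
    using centered_total by (simp add: set_lebesgue_integral_def)
qed

text \<open>Left of the mean the integrand is nonnegative. Right of it the complementary tail is
  used, which is possible because the total centered integral vanishes.\<close>

lemma T_nonneg: "0 \<le> T x"
proof (cases "x \<le> \<mu>")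
  case True
  then show ?thesis
    unfolding T_def set_lebesgue_integral_def using p_nonneg
    by (intro integral_nonneg_AE) (auto split: split_indicator)
next
  case False
  then have "0 \<le> (LINT t:{x<..}|lborel. - ((\<mu> - t) * p t))"
    unfolding set_lebesgue_integral_def using p_nonneg
    by (intro integral_nonneg_AE) (auto split: split_indicator intro!: mult_nonpos_nonneg)
  then show ?thesis
    using set_integral_uminus[OF centered_set_integrable[of "{x<..}"]] by (simp add: T_upper)
qed

text \<open>A zero of \<open>T\<close> is a minimum, so where \<open>p\<close> is positive off
  \<open>X\<close> the vanishing derivative \<open>(\<mu> - x) * p x\<close> forces
  \<open>x = \<mu>\<close>. But \<open>T\<close> does not decrease up to the mean, so a point
  slightly to the left would be a second such zero.\<close>

lemma T_pos:
  assumes x: "x \<notin> X" "0 < p x"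
  shows "0 < T x"
proof (rule ccontr)
  assume "\<not> 0 < T x"
  then have T0: "T x = 0"
    using T_nonneg[of x] by linarith
  have eq_mu: "y = \<mu>" if y: "y \<notin> X" "0 < p y" "T y = 0" for y
  proof -
    have "(\<mu> - y) * p y = 0"
      using T_nonneg y(3) by (intro DERIV_local_min[OF T_deriv[OF y(1)] zero_less_one]) auto
    then show ?thesis
      using y(2) by simp
  qed
  have "x = \<mu>"
    using eq_mu x T0 by blast
  have "\<forall>\<^sub>F y in nhds x. y \<notin> X \<and> 0 < p y"
    using off_X_nhds[OF x(1)] p_pos_nhds[OF x] by (rule eventually_conj)
  then obtain d where d: "d > 0" "\<And>y. dist y x < d \<Longrightarrow> y \<notin> X \<and> 0 < p y"
    unfolding eventually_nhds_metric by blast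
  define y where "y = x - d / 2"
  have y: "y \<notin> X" "0 < p y" "y < x"
    using d by (auto simp: y_def dist_real_def)
  have "0 \<le> (LINT t:{y<..x}|lborel. (\<mu> - t) * p t)"
    unfolding set_lebesgue_integral_def using p_nonneg \<open>x = \<mu>\<close>
    by (intro integral_nonneg_AE) (auto split: split_indicator)
  then have "T y = 0"
    using T_split[of y x] T_nonneg[of y] T0 y(3) by linarith
  then show False
    using eq_mu[OF y(1,2)] y(3) \<open>x = \<mu>\<close> by simp
qed

lemma Q_pos: "x \<notin> X \<Longrightarrow> 0 < p x \<Longrightarrow> 0 < Q x"
  using T_pos[of x] T_eq[of x] by (simp add: zero_less_mult_iff)

section \<open>Finite moments and the recurrence of the lower integrals\<close>

lemma power_set_integrable_Icc: "set_integrable lborel {a..x} (\<lambda>t. (x - t) ^ m * p t)"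
  unfolding set_integrable_def
proof (rule Bochner_Integration.integrable_bound)
  show "integrable lborel (\<lambda>t. (x - a) ^ m * p t)"
    using p_integrable by simp
  have "\<bar>(x - t) ^ m * p t\<bar> \<le> \<bar>(x - a) ^ m * p t\<bar>" if "t \<in> {a..x}" for t
    using that p_nonneg[of t] by (auto simp: abs_mult intro!: mult_right_mono power_mono)
  then show "AE t in lborel. norm (indicator {a..x} t *\<^sub>R ((x - t) ^ m * p t)) \<le> norm ((x - a) ^ m * p t)"
    by (auto split: split_indicator)
qed measurable

text \<open>Integration by parts of \<open>(x - t) ^ Suc m\<close> against \<open>T' = (\<mu> - t) p\<close>, with \<open>T = Q p\<close> and \<open>Q\<close>
  expanded around \<open>x\<close>.\<close>

lemma truncated_moment_identity:
  assumes "a \<le> x"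
  defines "J \<equiv> \<lambda>k. LINT t:{a..x}|lborel. (x - t) ^ k * p t"
  shows "(1 - real (Suc m) * \<kappa>\<^sub>2) * J (Suc (Suc m)) + (real (Suc m) * Q' x + \<mu> - x) * J (Suc m)
    - real (Suc m) * Q x * J m = - ((x - a) ^ Suc m * T a)"
proof -
  have J: "((\<lambda>t. (x - t) ^ k * p t) has_integral J k) {a..x}" for k
    unfolding J_def
    using set_borel_integral_eq_integral[OF power_set_integrable_Icc] by (simp add: has_integral_integral)
  define F where "F = (\<lambda>t. (x - t) ^ Suc m * T t)"
  define c where "c = (\<lambda>t. (1 - real (Suc m) * \<kappa>\<^sub>2) * ((x - t) ^ Suc (Suc m) * p t)
    + (real (Suc m) * Q' x + \<mu> - x) * ((x - t) ^ Suc m * p t) - real (Suc m) * Q x * ((x - t) ^ m * p t))"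
  have h1: "(c has_integral (F x - F a)) {a..x}"
  proof (rule fundamental_theorem_of_calculus_interior_strong[OF finite_X \<open>a \<le> x\<close>])
    fix t assume "t \<in> {a<..<x} - X"
    then have t: "t \<notin> X" by blast
    have "((\<lambda>t. x - t) has_field_derivative - 1) (at t)"
      by (auto intro!: derivative_eq_intros)
    from DERIV_mult[OF DERIV_power[OF this, of "Suc m"] T_deriv[OF t]]
    have "(F has_field_derivative - (real (Suc m) * (x - t) ^ m) * T t + (\<mu> - t) * p t * (x - t) ^ Suc m) (at t)"
      unfolding F_def by simp
    moreover have "- (real (Suc m) * (x - t) ^ m) * T t + (\<mu> - t) * p t * (x - t) ^ Suc m = c t"
      unfolding c_def T_eq[OF t] Q_def Q'_def by (simp add: algebra_simps power2_eq_square)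
    ultimately show "(F has_vector_derivative c t) (at t)"
      by (simp add: has_real_derivative_iff_has_vector_derivative)
  next
    show "continuous_on {a..x} F"
      unfolding F_def by (intro continuous_intros continuous_at_imp_continuous_on ballI T_isCont)
  qed
  have h2: "(c has_integral ((1 - real (Suc m) * \<kappa>\<^sub>2) * J (Suc (Suc m)) + (real (Suc m) * Q' x + \<mu> - x) * J (Suc m)
    - real (Suc m) * Q x * J m)) {a..x}"
    unfolding c_def by (intro has_integral_add has_integral_diff has_integral_mult_right J)
  show ?thesis
    unfolding has_integral_unique[OF h2 h1] by (simp add: F_def)
qed

text \<open>In \<open>truncated_moment_identity\<close> the highest moment has coefficient
  \<open>c\<close>, positive because \<open>pearson_q\<close> is positive at \<open>k\<close>, and
  the boundary term has a favourable sign. Hence the two moments below bound it uniformly in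
  \<open>a\<close>. Orders 0 and 1 come from the integrability of \<open>p\<close> and the finite
  mean.\<close>

lemma power_set_integrable: "k \<le> N \<Longrightarrow> set_integrable lborel {..x} (\<lambda>t. (x - t) ^ k * p t)"
proof (induction k rule: less_induct)
  case (less k)
  consider "k = 0" | "k = 1" | m where "k = Suc (Suc m)"
    by (metis One_nat_def not0_implies_Suc)
  then show ?case
  proof cases
    case 1
    then show ?thesis
      using set_integrable_of_integrable[OF _ p_integrable] by simp
  next
    case 2
    have "integrable lborel (\<lambda>t. x * p t - t * p t)"
      using p_integrable mean_integrable by simp
    then show ?thesis
      using set_integrable_of_integrable[of "{..x}" "\<lambda>t. x * p t - t * p t"] 2 by (simp add: left_diff_distrib)
  next
    case 3
    define J where "J = (\<lambda>a k. LINT t:{a..x}|lborel. (x - t) ^ k * p t)"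
    have J_le: "\<bar>J a k'\<bar> \<le> M k' x" if "k' < k" "a \<le> x" for k' a
    proof -
      have "J a k' \<le> M k' x"
        unfolding J_def M_def set_lebesgue_integral_def
        using power_set_integrable_Icc[of a x k'] less.IH[OF that(1)] less.prems that p_nonneg
        by (intro integral_mono) (auto simp: set_integrable_def split: split_indicator)
      moreover have "0 \<le> J a k'"
        unfolding J_def set_lebesgue_integral_def using p_nonneg
        by (intro integral_nonneg_AE) (auto split: split_indicator)
      ultimately show ?thesis by simp
    qed
    define c where "c = 1 - real (Suc m) * \<kappa>\<^sub>2"
    have "c > 0"
      using q_pos[of k] 3 less.prems by (simp add: c_def pearson_q_def zero_less_mult_iff)
    define A where "A = real (Suc m) * Q' x + \<mu> - x"
    define B where "B = real (Suc m) * Q x"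
    show ?thesis
    proof (rule set_integrable_atMost_if_bounded[where C = "(\<bar>A\<bar> * M (Suc m) x + \<bar>B\<bar> * M m x) / c"])
      fix a assume "a \<le> x"
      have "c * J a k + A * J a (Suc m) - B * J a m = - ((x - a) ^ Suc m * T a)"
        using truncated_moment_identity[OF \<open>a \<le> x\<close>, of m] by (simp only: c_def A_def B_def J_def 3)
      moreover have "(x - a) ^ Suc m * T a \<ge> 0"
        using \<open>a \<le> x\<close> T_nonneg[of a] by simp
      ultimately have "c * J a k \<le> \<bar>A * J a (Suc m)\<bar> + \<bar>B * J a m\<bar>"
        by linarith
      also have "\<dots> \<le> \<bar>A\<bar> * M (Suc m) x + \<bar>B\<bar> * M m x"
        unfolding abs_mult using 3 \<open>a \<le> x\<close> by (intro add_mono mult_left_mono J_le) auto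
      finally show "(LINT t:{a..x}|lborel. (x - t) ^ k * p t) \<le> (\<bar>A\<bar> * M (Suc m) x + \<bar>B\<bar> * M m x) / c"
        using \<open>c > 0\<close> by (simp add: J_def pos_le_divide_eq mult.commute)
    qed (use p_nonneg power_set_integrable_Icc in auto)
  qed
qed

text \<open>The truncated identity as the cut-off tends to minus infinity. Under the integral
  defining \<open>T a\<close> the power \<open>(x - a) ^ Suc m\<close> is at most
  \<open>(x - s) ^ Suc m\<close>, so the boundary term is dominated by the tail of an integral of
  finite moments and vanishes.\<close>

lemma moment_identity:
  assumes "Suc (Suc m) \<le> N"
  shows "(1 - real (Suc m) * \<kappa>\<^sub>2) * M (Suc (Suc m)) x + (real (Suc m) * Q' x + \<mu> - x) * M (Suc m) x
    - real (Suc m) * Q x * M m x = 0"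
proof -
  define J where "J = (\<lambda>n k. LINT t:{x - real n..x}|lborel. (x - t) ^ k * p t)"
  have J: "(\<lambda>n. J n k) \<longlonglongrightarrow> M k x" if "k \<le> N" for k
    unfolding J_def M_def by (rule LINT_Icc_tendsto[OF power_set_integrable[OF that]])
  \<comment> \<open>The two summands come from
    \<open>\<mu> - s \<le> \<bar>\<mu> - x\<bar> + (x - s)\<close>.\<close>
  define g where "g = (\<lambda>s. \<bar>\<mu> - x\<bar> * ((x - s) ^ Suc m * p s) + (x - s) ^ Suc (Suc m) * p s)"
  have g: "set_integrable lborel {..x} g"
    unfolding g_def using assms
    by (intro set_integral_add(1) set_integrable_mult_right power_set_integrable) auto
  have "(\<lambda>n. (x - (x - real n)) ^ Suc m * T (x - real n)) \<longlonglongrightarrow> 0"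
  proof (rule tendsto_sandwich[OF _ _ tendsto_const LINT_atMost_tendsto_0[OF g]])
    show "\<forall>\<^sub>F n in sequentially. 0 \<le> (x - (x - real n)) ^ Suc m * T (x - real n)"
      using T_nonneg by (intro always_eventually) auto
    have le: "(x - a) ^ Suc m * T a \<le> (LINT s:{..a}|lborel. g s)" if "a \<le> x" for a
    proof -
      have "(x - a) ^ Suc m * T a = (LINT s:{..a}|lborel. (x - a) ^ Suc m * ((\<mu> - s) * p s))"
        by (simp add: T_def del: power_Suc)
      also have "\<dots> \<le> (LINT s:{..a}|lborel. g s)"
      proof (rule set_integral_mono)
        show "set_integrable lborel {..a} (\<lambda>s. (x - a) ^ Suc m * ((\<mu> - s) * p s))"
          by (intro set_integrable_mult_right centered_set_integrable) auto
        show "set_integrable lborel {..a} g"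
          using that by (intro set_integrable_subset[OF g]) auto
        fix s assume s: "s \<in> {..a}"
        have "(x - a) ^ Suc m * (\<mu> - s) \<le> (x - s) ^ Suc m * (\<bar>\<mu> - x\<bar> + (x - s))"
        proof (rule order_trans[OF mult_left_mono mult_right_mono])
          show "(x - a) ^ Suc m \<le> (x - s) ^ Suc m" "0 \<le> (x - a) ^ Suc m"
            using s that by (auto intro!: power_mono simp del: power_Suc)
        qed (use s that in auto)
        then have "(x - a) ^ Suc m * (\<mu> - s) * p s \<le> (x - s) ^ Suc m * (\<bar>\<mu> - x\<bar> + (x - s)) * p s"
          using p_nonneg[of s] by (rule mult_right_mono)
        then show "(x - a) ^ Suc m * ((\<mu> - s) * p s) \<le> g s"
          by (simp add: g_def algebra_simps)
      qed
      finally show ?thesis .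
    qed
    show "\<forall>\<^sub>F n in sequentially. (x - (x - real n)) ^ Suc m * T (x - real n) \<le> (LINT s:{..x - real n}|lborel. g s)"
      by (intro always_eventually allI le) simp
  qed
  then have lim1: "(\<lambda>n. - ((x - (x - real n)) ^ Suc m * T (x - real n))) \<longlonglongrightarrow> - 0"
    by (rule tendsto_minus)
  have "(\<lambda>n. (1 - real (Suc m) * \<kappa>\<^sub>2) * J n (Suc (Suc m)) + (real (Suc m) * Q' x + \<mu> - x) * J n (Suc m)
    - real (Suc m) * Q x * J n m) \<longlonglongrightarrow> (1 - real (Suc m) * \<kappa>\<^sub>2) * M (Suc (Suc m)) x + (real (Suc m) * Q' x + \<mu> - x) * M (Suc m) x
    - real (Suc m) * Q x * M m x"
    using assms by (intro tendsto_intros J) auto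
  moreover have "(1 - real (Suc m) * \<kappa>\<^sub>2) * J n (Suc (Suc m)) + (real (Suc m) * Q' x + \<mu> - x) * J n (Suc m)
    - real (Suc m) * Q x * J n m = - ((x - (x - real n)) ^ Suc m * T (x - real n))" for n
    unfolding J_def by (rule truncated_moment_identity) simp
  ultimately have "(\<lambda>n. - ((x - (x - real n)) ^ Suc m * T (x - real n))) \<longlonglongrightarrow>
    (1 - real (Suc m) * \<kappa>\<^sub>2) * M (Suc (Suc m)) x + (real (Suc m) * Q' x + \<mu> - x) * M (Suc m) x
    - real (Suc m) * Q x * M m x"
    by (simp only:)
  from LIMSEQ_unique[OF this lim1] show ?thesis
    by (simp only: minus_zero)
qed

text \<open>For \<open>k = m + 1\<close> this is \<open>moment_identity\<close> divided by
  \<open>fact k\<close>; for \<open>k = 0\<close> it is the kernel identity, with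
  \<open>\<mu> - t\<close> split into \<open>\<mu> - x\<close> and \<open>x - t\<close>.\<close>

lemma L_identity:
  assumes "Suc k \<le> N" "x \<notin> X"
  shows "Q x * L k x - (real k * Q' x + \<mu> - x) * L (Suc k) x = pearson_q \<kappa>\<^sub>2 (Suc k) * L (Suc (Suc k)) x"
proof (cases k)
  case 0
  have "T x = (LINT t:{..x}|lborel. (\<mu> - x) * p t + (x - t) * p t)"
    unfolding T_def by (intro set_lebesgue_integral_cong) (auto simp: algebra_simps)
  also have "\<dots> = (LINT t:{..x}|lborel. (\<mu> - x) * p t) + (LINT t:{..x}|lborel. (x - t) * p t)"
    using power_set_integrable[of 0 x] power_set_integrable[of 1 x] assms(1)
    by (intro set_integral_add(2)) auto
  finally show ?thesis
    using T_eq[OF assms(2)] 0 by (simp add: pearson_q_def)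
next
  case (Suc m)
  have id: "(1 - real (Suc m) * \<kappa>\<^sub>2) * M (Suc (Suc m)) x + (real (Suc m) * Q' x + \<mu> - x) * M (Suc m) x
    - real (Suc m) * Q x * M m x = 0"
    using assms(1) Suc by (intro moment_identity) simp
  have f: "fact m \<noteq> (0::real)" by simp
  have "(real (Suc m)) * ((real (Suc m) * Q' x + \<mu> - x) * L (Suc (Suc m)) x) * fact m =
      (real (Suc m) * Q' x + \<mu> - x) * M (Suc m) x"
    by (simp only: L_Suc_M fact_Suc of_nat_mult) simp
  moreover have "real (Suc m) * (Q x * L (Suc m) x) * fact m = real (Suc m) * Q x * M m x"
    by (simp only: L_Suc_M) simp
  moreover have "real (Suc m) * (pearson_q \<kappa>\<^sub>2 (Suc (Suc m)) * L (Suc (Suc (Suc m))) x) * fact m =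
      (1 - real (Suc m) * \<kappa>\<^sub>2) * M (Suc (Suc m)) x"
    by (simp only: L_Suc_M fact_Suc of_nat_mult pearson_q_def) simp
  ultimately have "real (Suc m) * fact m * (Q x * L (Suc m) x - (real (Suc m) * Q' x + \<mu> - x) * L (Suc (Suc m)) x
      - pearson_q \<kappa>\<^sub>2 (Suc (Suc m)) * L (Suc (Suc (Suc m))) x) = 0"
    using id by (simp only: right_diff_distrib) (simp only: ac_simps)
  then have "Q x * L (Suc m) x - (real (Suc m) * Q' x + \<mu> - x) * L (Suc (Suc m)) x
      - pearson_q \<kappa>\<^sub>2 (Suc (Suc m)) * L (Suc (Suc (Suc m))) x = 0"
    using f by (simp only: mult_eq_0_iff) auto
  then show ?thesis
    using Suc by (simp only:)
qed

lemma L_set_integrable: "k \<le> N \<Longrightarrow> set_integrable lborel {..x} (\<lambda>t. (x - t) ^ k / fact k * p t)"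
  by (simp add: power_set_integrable)

lemma
  assumes "k \<le> N"
  shows L_integrable: "set_integrable lborel {..x} (L k)"
    and L_Suc_LINT: "L (Suc k) = (\<lambda>x. LINT t:{..x}|lborel. L k t)"
proof -
  have "set_integrable lborel {..x} (L k) \<and> L (Suc k) x = (LINT t:{..x}|lborel. L k t)" for x
  proof (cases k)
    case 0
    then show ?thesis
      using set_integrable_of_integrable[OF _ p_integrable] by simp
  next
    case (Suc m)
    then show ?thesis
      using LINT_atMost_iterate[of p m x, OF _ p_nonneg L_set_integrable L_set_integrable] assms
      by (simp del: power_Suc fact_Suc)
  qed
  then show "set_integrable lborel {..x} (L k)" "L (Suc k) = (\<lambda>x. LINT t:{..x}|lborel. L k t)"
    by auto
qed

lemma L_Suc_isCont: "k \<le> N \<Longrightarrow> isCont (L (Suc k)) x"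
  using LINT_atMost_continuous[of "L k" x] L_integrable[of k] L_Suc_LINT[of k]
  by (simp del: L.simps)

lemma L_deriv:
  assumes "k \<le> N" "x \<notin> X"
  shows "(L (Suc k) has_field_derivative L k x) (at x)"
proof -
  have "isCont (L k) x"
  proof (cases k)
    case 0
    then show ?thesis
      using p_isCont[OF assms(2)] by simp
  qed (use L_Suc_isCont assms in auto)
  then show ?thesis
    unfolding L_Suc_LINT[OF assms(1)] using L_integrable[OF assms(1)] by (intro LINT_atMost_deriv)
qed

lemma L_nonneg: "0 \<le> L k x"
proof (cases k)
  case (Suc m)
  then show ?thesis
    using p_nonneg by (auto simp: set_lebesgue_integral_def intro!: integral_nonneg_AE split: split_indicator)
qed (use p_nonneg in auto)

end

section \<open>Upper integrals by reflection\<close>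

lemma LINT_reflect:
  fixes g :: "real \<Rightarrow> real"
  shows "(LINT t:A|lborel. g t) = (LINT t:uminus ` A|lborel. g (- t))"
proof -
  have "indicator (uminus ` A) t = (indicator A (- t) :: real)" for t
    by (auto simp: indicator_def image_iff minus_equation_iff) (metis minus_minus)
  then show ?thesis
    unfolding set_lebesgue_integral_def
    using lborel_integral_real_affine[of "-1" "\<lambda>t. indicator A t *\<^sub>R g t" 0] by simp
qed

lemma set_integrable_reflect:
  fixes g :: "real \<Rightarrow> real"
  shows "set_integrable lborel A g \<longleftrightarrow> set_integrable lborel (uminus ` A) (\<lambda>t. g (- t))"
proof -
  have "indicator (uminus ` A) t = (indicator A (- t) :: real)" for t
    by (auto simp: indicator_def image_iff minus_equation_iff) (metis minus_minus)
  then show ?thesis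
    unfolding set_integrable_def
    using lborel_integrable_real_affine_iff[of "-1" "\<lambda>t. indicator A t *\<^sub>R g t" 0] by simp
qed

lemma LINT_atLeast_greaterThan:
  fixes g :: "real \<Rightarrow> real"
  shows "(LINT t:{x..}|lborel. g t) = (LINT t:{x<..}|lborel. g t)"
  unfolding set_lebesgue_integral_def
  using AE_lborel_singleton[of x]
  by (intro integral_discrete_difference[of "{x}"]) (auto split: split_indicator)

context pearson
begin

text \<open>Reflection negates the mean and the linear coefficient but keeps
  \<open>\<kappa>\<^sub>2\<close>, hence every \<open>pearson_q\<close>. The reflected lower
  integral is, up to sign, the upper tail of the centered density, and this is again
  \<open>T\<close> because the total vanishes.\<close>

lemma reflect: "pearson (\<lambda>x. p (- x)) \<kappa>\<^sub>0 (- \<kappa>\<^sub>1) \<kappa>\<^sub>2 (- \<mu>) (uminus ` X) N"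
proof
  show "integrable lborel (\<lambda>x. p (- x))"
    using lborel_integrable_real_affine_iff[of "-1" p 0] p_integrable by simp
  show "(\<integral>t. p (- t) \<partial>lborel) = 1"
    using lborel_integral_real_affine[of "-1" p 0] p_total by simp
  show "integrable lborel (\<lambda>t. t * p (- t))"
    using lborel_integrable_real_affine_iff[of "-1" "\<lambda>t. t * p t" 0] mean_integrable by simp
  show "(\<integral>t. t * p (- t) \<partial>lborel) = - \<mu>"
    using lborel_integral_real_affine[of "-1" "\<lambda>t. t * p t" 0] mean by simp
  fix x assume "x \<notin> uminus ` X"
  then have x: "- x \<notin> X" by (metis imageI minus_minus)
  show "isCont (\<lambda>x. p (- x)) x"
    using isCont_o2[of x "\<lambda>x. - x" p] p_isCont[OF x] by (simp add: isCont_minus)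
  have "(LINT t:{..x}|lborel. (- \<mu> - t) * p (- t)) = (LINT t:{- x..}|lborel. - ((\<mu> - t) * p t))"
    unfolding LINT_reflect[of "{..x}"] by (simp add: algebra_simps)
  also have "\<dots> = T (- x)"
    unfolding T_upper LINT_atLeast_greaterThan
    by (rule set_integral_uminus) (simp add: centered_set_integrable)
  finally show "(LINT t:{..x}|lborel. (- \<mu> - t) * p (- t)) = (\<kappa>\<^sub>2 * x\<^sup>2 + - \<kappa>\<^sub>1 * x + \<kappa>\<^sub>0) * p (- x)"
    using T_eq[OF x] by (simp add: Q_def)
qed (use p_nonneg finite_X q_pos in auto)

primrec U :: "nat \<Rightarrow> real \<Rightarrow> real" where
  "U 0 = p"
| "U (Suc k) = (\<lambda>x. LINT t:{x..}|lborel. (t - x) ^ k / fact k * p t)"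

lemma U_reflect: "U k x = pearson.L (\<lambda>x. p (- x)) k (- x)"
proof -
  interpret R: pearson "\<lambda>x. p (- x)" \<kappa>\<^sub>0 "- \<kappa>\<^sub>1" \<kappa>\<^sub>2 "- \<mu>" "uminus ` X" N
    by (rule reflect)
  show ?thesis
  proof (cases k)
    case (Suc m)
    then show ?thesis
      by (simp add: LINT_reflect[of "{x..}"] minus_diff_commute)
  qed simp
qed

lemma U_set_integrable: "k \<le> N \<Longrightarrow> set_integrable lborel {x..} (\<lambda>t. (t - x) ^ k / fact k * p t)"
proof -
  interpret R: pearson "\<lambda>x. p (- x)" \<kappa>\<^sub>0 "- \<kappa>\<^sub>1" \<kappa>\<^sub>2 "- \<mu>" "uminus ` X" N
    by (rule reflect)
  assume "k \<le> N"
  then show ?thesis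
    using R.L_set_integrable[of k "- x"]
    by (simp add: set_integrable_reflect[of "{x..}"] minus_diff_commute)
qed

text \<open>\<open>Q'\<close> and \<open>\<mu> - x\<close> change sign under reflection, which turns
  the minus of \<open>L_identity\<close> into a plus.\<close>

lemma U_identity:
  assumes "Suc k \<le> N" "x \<notin> X"
  shows "Q x * U k x + (real k * Q' x + \<mu> - x) * U (Suc k) x = pearson_q \<kappa>\<^sub>2 (Suc k) * U (Suc (Suc k)) x"
proof -
  interpret R: pearson "\<lambda>x. p (- x)" \<kappa>\<^sub>0 "- \<kappa>\<^sub>1" \<kappa>\<^sub>2 "- \<mu>" "uminus ` X" N
    by (rule reflect)
  have "- x \<notin> uminus ` X"
    using assms(2) by auto
  from R.L_identity[OF assms(1) this] show ?thesis
    unfolding U_reflect by (simp add: R.Q_def R.Q'_def Q_def Q'_def algebra_simps del: R.L.simps)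
qed

lemma U_deriv:
  assumes "k \<le> N" "x \<notin> X"
  shows "(U (Suc k) has_field_derivative - U k x) (at x)"
proof -
  interpret R: pearson "\<lambda>x. p (- x)" \<kappa>\<^sub>0 "- \<kappa>\<^sub>1" \<kappa>\<^sub>2 "- \<mu>" "uminus ` X" N
    by (rule reflect)
  have "- x \<notin> uminus ` X"
    using assms(2) by auto
  from R.L_deriv[OF assms(1) this] have "((\<lambda>x. R.L (Suc k) (- x)) has_field_derivative R.L k (- x) * - 1) (at x)"
    by (rule DERIV_chain2) (auto intro!: derivative_eq_intros)
  then show ?thesis
    unfolding U_reflect[abs_def] by simp
qed

lemma U_nonneg: "0 \<le> U k x"
proof -
  interpret R: pearson "\<lambda>x. p (- x)" \<kappa>\<^sub>0 "- \<kappa>\<^sub>1" \<kappa>\<^sub>2 "- \<mu>" "uminus ` X" N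
    by (rule reflect)
  show ?thesis
    unfolding U_reflect by (rule R.L_nonneg)
qed

section \<open>Lower and upper integrals combined\<close>

lemma LINT_split:
  fixes g :: "real \<Rightarrow> real"
  assumes "integrable lborel g"
  shows "(LINT t:{..x}|lborel. g t) + (LINT t:{x..}|lborel. g t) = (\<integral>t. g t \<partial>lborel)"
proof -
  have u: "UNIV = {..x} \<union> {x<..}" by auto
  have "(\<integral>t. g t \<partial>lborel) = (LINT t:UNIV|lborel. g t)"
    by (simp add: set_lebesgue_integral_def)
  also have "\<dots> = (LINT t:{..x}|lborel. g t) + (LINT t:{x<..}|lborel. g t)"
    unfolding u using assms by (intro set_integral_Un set_integrable_of_integrable) auto
  finally show ?thesis
    by (simp add: LINT_atLeast_greaterThan)
qed

lemma L_U_1: "L 1 x + U 1 x = 1"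
  using LINT_split[OF p_integrable, of x] p_total by simp

text \<open>Off \<open>X\<close> and for \<open>k \<le> N\<close> this is the Wronskian of
  \<open>U (Suc k)\<close> and \<open>L (Suc k)\<close>, whose derivatives are \<open>- U k\<close>
  and \<open>L k\<close>.\<close>

definition W :: "nat \<Rightarrow> real \<Rightarrow> real" where
  "W k x = U (Suc k) x * L k x + L (Suc k) x * U k x"

text \<open>One factor \<open>pearson_q\<close> is picked up per differentiation in the ratio lemmas
  below.\<close>

definition cq :: "nat \<Rightarrow> real" where "cq k = (\<Prod>j=1..k. pearson_q \<kappa>\<^sub>2 j)"

lemma cq_Suc: "cq (Suc k) = cq k * pearson_q \<kappa>\<^sub>2 (Suc k)"
  by (simp add: cq_def)

lemma cq_pos: "k \<le> N \<Longrightarrow> 0 < cq k"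
  unfolding cq_def by (intro prod_pos) (auto intro: q_pos)

text \<open>The terms with \<open>real k * Q' x + \<mu> - x\<close> have opposite signs in the two
  recurrences and cancel.\<close>

lemma W_Suc:
  assumes "Suc k \<le> N" "x \<notin> X"
  shows "pearson_q \<kappa>\<^sub>2 (Suc k) * W (Suc k) x = Q x * W k x"
proof -
  have "pearson_q \<kappa>\<^sub>2 (Suc k) * W (Suc k) x =
      U (Suc k) x * (pearson_q \<kappa>\<^sub>2 (Suc k) * L (Suc (Suc k)) x) + L (Suc k) x * (pearson_q \<kappa>\<^sub>2 (Suc k) * U (Suc (Suc k)) x)"
    by (simp add: W_def algebra_simps del: L.simps U.simps)
  also have "\<dots> = Q x * W k x"
    unfolding L_identity[OF assms, symmetric] U_identity[OF assms, symmetric]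
    by (simp add: W_def algebra_simps del: L.simps U.simps)
  finally show ?thesis .
qed

lemma cq_W: "k \<le> N \<Longrightarrow> x \<notin> X \<Longrightarrow> cq k * W k x = Q x ^ k * p x"
proof (induction k)
  case 0
  have "W 0 x = (L 1 x + U 1 x) * p x"
    by (simp add: W_def algebra_simps)
  then show ?case
    unfolding L_U_1 by (simp add: cq_def)
next
  case (Suc k)
  have "cq (Suc k) * W (Suc k) x = cq k * (pearson_q \<kappa>\<^sub>2 (Suc k) * W (Suc k) x)"
    by (simp add: cq_Suc)
  also have "\<dots> = Q x * (cq k * W k x)"
    using W_Suc[of k x] Suc.prems by simp
  finally show ?case
    using Suc by simp
qed

section \<open>Quotients by a power of the kernel times the density\<close>

lemma Q_deriv: "(Q has_field_derivative Q' x) (at x)"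
proof -
  have "((\<lambda>x. \<kappa>\<^sub>2 * x\<^sup>2 + \<kappa>\<^sub>1 * x + \<kappa>\<^sub>0) has_field_derivative Q' x) (at x)"
    unfolding Q'_def by (auto intro!: derivative_eq_intros)
  then show ?thesis
    unfolding Q_def[abs_def] .
qed

text \<open>Continuity of \<open>p\<close> is known off \<open>X\<close> only, so removing
  \<open>X\<close> makes the support open.\<close>

definition I :: "real set" where "I = {x. 0 < p x} - X"

lemma open_I: "open I"
proof (subst open_subopen, rule ballI)
  fix x assume "x \<in> I"
  then have "\<forall>\<^sub>F y in nhds x. y \<in> I"
    using eventually_conj[OF off_X_nhds p_pos_nhds, of x] by (auto simp: I_def elim: eventually_mono)
  then show "\<exists>S. open S \<and> x \<in> S \<and> S \<subseteq> I"
    unfolding eventually_nhds by auto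
qed

lemma Q_pos_I: "x \<in> I \<Longrightarrow> 0 < Q x"
  using Q_pos by (simp add: I_def)

lemma Qp_deriv:
  assumes "x \<in> I"
  shows "((\<lambda>x. Q x ^ Suc k * p x) has_field_derivative Q x ^ k * p x * (real k * Q' x + \<mu> - x)) (at x)"
proof -
  have x: "x \<notin> X"
    using assms by (simp add: I_def)
  have "((\<lambda>x. Q x ^ k * T x) has_field_derivative
      real k * (Q' x * Q x ^ (k - Suc 0)) * T x + (\<mu> - x) * p x * Q x ^ k) (at x)"
    by (intro DERIV_mult DERIV_power[OF Q_deriv] T_deriv x)
  moreover have "real k * (Q' x * Q x ^ (k - Suc 0)) * T x + (\<mu> - x) * p x * Q x ^ k =
      Q x ^ k * p x * (real k * Q' x + \<mu> - x)"
    unfolding T_eq[OF x] by (cases k) (simp_all add: algebra_simps)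
  moreover have "\<forall>\<^sub>F y in nhds x. Q y ^ k * T y = Q y ^ Suc k * p y"
    using off_X_nhds[OF x] by eventually_elim (simp add: T_eq)
  ultimately show ?thesis
    using DERIV_cong_ev[OF refl _ refl, of "\<lambda>x. Q x ^ k * T x" "\<lambda>x. Q x ^ Suc k * p x" x] by simp
qed

text \<open>The quotient rule with the common factor \<open>Q x ^ k * p x\<close> cancelled. When
  \<open>g\<close> is one of the iterated integrals, \<open>eq\<close> has the shape of its
  recurrence, so differentiation raises the index by one.\<close>

lemma div_Qp_deriv:
  assumes x: "x \<in> I" and g: "(g has_field_derivative g') (at x)"
    and eq: "Q x * g' - (real k * Q' x + \<mu> - x) * g x = b"
  shows "((\<lambda>x. g x / (Q x ^ Suc k * p x)) has_field_derivative b / (Q x ^ Suc (Suc k) * p x)) (at x)"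
proof -
  have pos: "0 < Q x" "0 < p x"
    using x Q_pos_I by (auto simp: I_def)
  have "((\<lambda>x. g x / (Q x ^ Suc k * p x)) has_field_derivative
    (g' * (Q x ^ Suc k * p x) - g x * (Q x ^ k * p x * (real k * Q' x + \<mu> - x))) /
      ((Q x ^ Suc k * p x) * (Q x ^ Suc k * p x))) (at x)"
    using pos by (intro DERIV_divide[OF g Qp_deriv[OF x]]) simp
  moreover have "(g' * (Q x ^ Suc k * p x) - g x * (Q x ^ k * p x * (real k * Q' x + \<mu> - x))) /
      ((Q x ^ Suc k * p x) * (Q x ^ Suc k * p x)) = b / (Q x ^ Suc (Suc k) * p x)"
  proof -
    have "g' * (Q x ^ Suc k * p x) - g x * (Q x ^ k * p x * (real k * Q' x + \<mu> - x)) = b * (Q x ^ k * p x)"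
      unfolding eq[symmetric] by (simp add: algebra_simps)
    moreover have "(Q x ^ Suc k * p x) * (Q x ^ Suc k * p x) = (Q x ^ Suc (Suc k) * p x) * (Q x ^ k * p x)"
      by simp
    ultimately show ?thesis
      using nonzero_mult_divide_mult_cancel_right[of "Q x ^ k * p x" b "Q x ^ Suc (Suc k) * p x"] pos
      by (simp only:) auto
  qed
  ultimately show ?thesis by simp
qed

text \<open>On \<open>I\<close> the function at \<open>k = 0\<close> is \<open>lower_m\<close>, so
  iteration yields the derivatives that enter \<open>stein_U\<close>; likewise for
  \<open>upper_m\<close> below.\<close>

lemma lower_ratio_deriv:
  assumes "Suc k \<le> N" "x \<in> I"
  shows "((\<lambda>x. cq k * L (Suc k) x / (Q x ^ Suc k * p x)) has_field_derivative
    cq (Suc k) * L (Suc (Suc k)) x / (Q x ^ Suc (Suc k) * p x)) (at x)"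
proof (rule div_Qp_deriv[OF assms(2)])
  have x: "x \<notin> X"
    using assms by (simp add: I_def)
  show "((\<lambda>x. cq k * L (Suc k) x) has_field_derivative cq k * L k x) (at x)"
    using assms(1) by (intro DERIV_cmult L_deriv x) simp
  show "Q x * (cq k * L k x) - (real k * Q' x + \<mu> - x) * (cq k * L (Suc k) x) = cq (Suc k) * L (Suc (Suc k)) x"
  proof -
    have "cq (Suc k) * L (Suc (Suc k)) x = cq k * (pearson_q \<kappa>\<^sub>2 (Suc k) * L (Suc (Suc k)) x)"
      by (simp add: cq_Suc)
    then show ?thesis
      unfolding L_identity[OF assms(1) x, symmetric] by (simp add: algebra_simps del: L.simps)
  qed
qed

lemma upper_ratio_deriv:
  assumes "Suc k \<le> N" "x \<in> I"
  shows "((\<lambda>x. (- 1) ^ k * cq k * U (Suc k) x / (Q x ^ Suc k * p x)) has_field_derivative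
    (- 1) ^ Suc k * cq (Suc k) * U (Suc (Suc k)) x / (Q x ^ Suc (Suc k) * p x)) (at x)"
proof (rule div_Qp_deriv[OF assms(2)])
  have x: "x \<notin> X"
    using assms by (simp add: I_def)
  show "((\<lambda>x. (- 1) ^ k * cq k * U (Suc k) x) has_field_derivative (- 1) ^ k * cq k * - U k x) (at x)"
    using assms(1) by (intro DERIV_cmult U_deriv x) simp
  show "Q x * ((- 1) ^ k * cq k * - U k x) - (real k * Q' x + \<mu> - x) * ((- 1) ^ k * cq k * U (Suc k) x) =
      (- 1) ^ Suc k * cq (Suc k) * U (Suc (Suc k)) x"
  proof -
    have "(- 1) ^ Suc k * cq (Suc k) * U (Suc (Suc k)) x =
        - ((- 1) ^ k * cq k * (pearson_q \<kappa>\<^sub>2 (Suc k) * U (Suc (Suc k)) x))"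
      by (simp add: cq_Suc)
    then show ?thesis
      unfolding U_identity[OF assms(1) x, symmetric] by (simp add: algebra_simps del: U.simps)
  qed
qed

end

section \<open>Derivatives of the Stein solution\<close>

text \<open>In the theorem \<open>d i\<close> is the \<open>i\<close>-th derivative of \<open>h\<close>. Up to sign, \<open>S j\<close> and \<open>S' j\<close>
  integrate the Taylor remainder of order \<open>j\<close> of \<open>h\<close> at \<open>x\<close> against \<open>p\<close> over the two half lines.\<close>

locale pearson_test = pearson +
  fixes d :: "nat \<Rightarrow> real \<Rightarrow> real"
  assumes d_integrable: "integrable lborel (\<lambda>t. p t * d 0 t)"
begin

definition S :: "nat \<Rightarrow> real \<Rightarrow> real" where
  "S j x = (- 1) ^ j * ((LINT t:{..x}|lborel. p t * d 0 t) - (\<Sum>i<j. d i x * ((- 1) ^ i * L (Suc i) x)))"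

definition S' :: "nat \<Rightarrow> real \<Rightarrow> real" where
  "S' j x = (LINT t:{x..}|lborel. p t * d 0 t) - (\<Sum>i<j. d i x * U (Suc i) x)"

lemma S_Suc: "S (Suc j) x = L (Suc j) x * d j x - S j x"
proof -
  have "(- 1 :: real) ^ j * (- 1) ^ j = 1"
    by (simp flip: power_mult_distrib)
  then have "(- 1) ^ j * (d j x * ((- 1) ^ j * L (Suc j) x)) = L (Suc j) x * d j x"
    by (metis mult.assoc mult.commute mult_1)
  then show ?thesis
    by (simp add: S_def algebra_simps del: L.simps)
qed

lemma S'_Suc: "S' (Suc j) x = S' j x - U (Suc j) x * d j x"
  by (simp add: S'_def algebra_simps del: U.simps)

text \<open>The sign in \<open>S\<close> makes \<open>S_Suc\<close> subtract \<open>S j\<close>; the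
  product rule then cancels \<open>L j x * d j x\<close>, and only the term with the next derivative
  of \<open>h\<close> survives.\<close>

lemma S_deriv:
  assumes "j \<le> N" "x \<notin> X" "isCont (d 0) x" "\<And>i. i < j \<Longrightarrow> (d i has_field_derivative d (Suc i) x) (at x)"
  shows "(S j has_field_derivative L j x * d j x) (at x)"
  using assms(1,4)
proof (induction j)
  case 0
  have "((\<lambda>x. LINT t:{..x}|lborel. p t * d 0 t) has_field_derivative p x * d 0 x) (at x)"
    using p_isCont[OF assms(2)] assms(3)
    by (intro LINT_atMost_deriv set_integrable_of_integrable d_integrable) (auto intro!: continuous_intros)
  then show ?case
    by (simp add: S_def)
next
  case (Suc j)
  have "((\<lambda>x. L (Suc j) x * d j x - S j x) has_field_derivative
      L j x * d j x + d (Suc j) x * L (Suc j) x - L j x * d j x) (at x)"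
    using Suc by (intro DERIV_diff DERIV_mult L_deriv assms(2)) auto
  then show ?case
    unfolding S_Suc[abs_def] by (simp add: mult.commute del: L.simps)
qed

lemma S'_deriv:
  assumes "j \<le> N" "x \<notin> X" "isCont (d 0) x" "\<And>i. i < j \<Longrightarrow> (d i has_field_derivative d (Suc i) x) (at x)"
  shows "(S' j has_field_derivative - (U j x * d j x)) (at x)"
  using assms(1,4)
proof (induction j)
  case 0
  have "((\<lambda>x. LINT t:{..x}|lborel. p t * d 0 t) has_field_derivative p x * d 0 x) (at x)"
    using p_isCont[OF assms(2)] assms(3)
    by (intro LINT_atMost_deriv set_integrable_of_integrable d_integrable) (auto intro!: continuous_intros)
  from DERIV_diff[OF DERIV_const this]
  have "((\<lambda>x. (\<integral>t. p t * d 0 t \<partial>lborel) - (LINT t:{..x}|lborel. p t * d 0 t)) has_field_derivative - (p x * d 0 x)) (at x)"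
    by simp
  moreover have "S' 0 = (\<lambda>x. (\<integral>t. p t * d 0 t \<partial>lborel) - (LINT t:{..x}|lborel. p t * d 0 t))"
  proof
    fix x
    show "S' 0 x = (\<integral>t. p t * d 0 t \<partial>lborel) - (LINT t:{..x}|lborel. p t * d 0 t)"
      using LINT_split[OF d_integrable, of x] by (simp add: S'_def)
  qed
  ultimately show ?case
    by simp
next
  case (Suc j)
  have "((\<lambda>x. S' j x - U (Suc j) x * d j x) has_field_derivative
      - (U j x * d j x) - (- U j x * d j x + d (Suc j) x * U (Suc j) x)) (at x)"
    using Suc by (intro DERIV_diff DERIV_mult U_deriv assms(2)) auto
  then show ?case
    unfolding S'_Suc[abs_def] by (simp add: mult.commute del: U.simps)
qed

text \<open>\<open>Taylor_lipschitz\<close> integrated against \<open>p\<close>, over a general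
  \<open>A\<close> so as to serve both half lines. Moments up to order \<open>j\<close> are needed
  for the polynomial and the one of order \<open>j + 1\<close> for the bound.\<close>

lemma Taylor_remainder_integral:
  assumes A: "A \<in> sets borel"
    and int: "\<And>i. i \<le> Suc j \<Longrightarrow> set_integrable lborel A (\<lambda>t. (t - x) ^ i / fact i * p t)"
    and d: "\<And>i t. i < j \<Longrightarrow> (d i has_field_derivative d (Suc i) t) (at t)"
    and K: "\<And>s t. \<bar>d j t - d j s\<bar> \<le> K * \<bar>t - s\<bar>"
  shows "\<bar>(LINT t:A|lborel. p t * d 0 t) - (\<Sum>i<Suc j. d i x * (LINT t:A|lborel. (t - x) ^ i / fact i * p t))\<bar>
    \<le> K * (LINT t:A|lborel. \<bar>t - x\<bar> ^ Suc j / fact (Suc j) * p t)"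
proof -
  have int0: "set_integrable lborel A (\<lambda>t. p t * d 0 t)"
    using A d_integrable by (rule set_integrable_of_integrable)
  have intS: "set_integrable lborel A (\<lambda>t. \<Sum>i<Suc j. d i x * ((t - x) ^ i / fact i * p t))"
    and sum: "(LINT t:A|lborel. (\<Sum>i<Suc j. d i x * ((t - x) ^ i / fact i * p t))) =
      (\<Sum>i<Suc j. d i x * (LINT t:A|lborel. (t - x) ^ i / fact i * p t))"
  proof -
    have i: "integrable lborel (\<lambda>t. indicator A t *\<^sub>R (d i x * ((t - x) ^ i / fact i * p t)))" if "i < Suc j" for i
    proof -
      have "set_integrable lborel A (\<lambda>t. d i x * ((t - x) ^ i / fact i * p t))"
        using that by (intro set_integrable_mult_right int) simp
      then show ?thesis
        unfolding set_integrable_def .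
    qed
    show "set_integrable lborel A (\<lambda>t. \<Sum>i<Suc j. d i x * ((t - x) ^ i / fact i * p t))"
      unfolding set_integrable_def scaleR_sum_right by (intro Bochner_Integration.integrable_sum i) simp
    have "(LINT t:A|lborel. (\<Sum>i<Suc j. d i x * ((t - x) ^ i / fact i * p t))) =
      (\<Sum>i<Suc j. LINT t:A|lborel. d i x * ((t - x) ^ i / fact i * p t))"
      unfolding set_lebesgue_integral_def scaleR_sum_right
      by (intro Bochner_Integration.integral_sum i) simp
    then show "(LINT t:A|lborel. (\<Sum>i<Suc j. d i x * ((t - x) ^ i / fact i * p t))) =
      (\<Sum>i<Suc j. d i x * (LINT t:A|lborel. (t - x) ^ i / fact i * p t))"
      by (simp only: set_integral_mult_right)
  qed
  define r where "r = (\<lambda>t. p t * d 0 t - (\<Sum>i<Suc j. d i x * ((t - x) ^ i / fact i * p t)))"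
  have r_le: "\<bar>r t\<bar> \<le> K * (\<bar>t - x\<bar> ^ Suc j / fact (Suc j) * p t)" for t
  proof -
    have "r t = p t * (d 0 t - (\<Sum>i\<le>j. d i x * ((t - x) ^ i / fact i)))"
      unfolding r_def lessThan_Suc_atMost right_diff_distrib sum_distrib_left by (simp add: ac_simps)
    then have "\<bar>r t\<bar> = p t * \<bar>d 0 t - (\<Sum>i\<le>j. d i x * ((t - x) ^ i / fact i))\<bar>"
      using p_nonneg by (simp only: abs_mult) simp
    also have "\<dots> \<le> p t * (K * (\<bar>t - x\<bar> ^ Suc j / fact (Suc j)))"
      using Taylor_lipschitz[of j d K t x] d K p_nonneg by (intro mult_left_mono) auto
    finally show ?thesis
      by (simp add: ac_simps)
  qed
  have int_abs: "set_integrable lborel A (\<lambda>t. \<bar>t - x\<bar> ^ Suc j / fact (Suc j) * p t)"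
    using set_integrable_abs[OF int[of "Suc j"]] p_nonneg by (simp add: abs_mult power_abs)
  have int_r: "set_integrable lborel A r"
    unfolding r_def using int0 intS by (rule set_integral_diff(1))
  have "\<bar>LINT t:A|lborel. r t\<bar> \<le> (LINT t:A|lborel. K * (\<bar>t - x\<bar> ^ Suc j / fact (Suc j) * p t))"
  proof -
    have "\<bar>LINT t:A|lborel. r t\<bar> \<le> (LINT t:A|lborel. \<bar>r t\<bar>)"
      using integral_norm_bound[of lborel "\<lambda>t. indicator A t *\<^sub>R r t"]
      unfolding set_lebesgue_integral_def by (simp add: abs_mult)
    also have "\<dots> \<le> (LINT t:A|lborel. K * (\<bar>t - x\<bar> ^ Suc j / fact (Suc j) * p t))"
      using r_le by (intro set_integral_mono set_integrable_abs int_r set_integrable_mult_right int_abs)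
    finally show ?thesis .
  qed
  moreover have "(LINT t:A|lborel. r t) = (LINT t:A|lborel. p t * d 0 t) -
      (\<Sum>i<Suc j. d i x * (LINT t:A|lborel. (t - x) ^ i / fact i * p t))"
    unfolding r_def sum[symmetric] using int0 intS by (rule set_integral_diff(2))
  ultimately show ?thesis
    by (simp only: set_integral_mult_right)
qed

lemma lower_power_eq: "(- 1) ^ i * ((x - t) ^ i / fact i * p t) = (t - x) ^ i / fact i * p t"
proof -
  have "(t - x) ^ i = (- 1) ^ i * (x - t) ^ i"
    by (simp flip: power_mult_distrib)
  then show ?thesis by simp
qed

lemma S_bound:
  assumes "Suc j \<le> N" and d: "\<And>i t. i < j \<Longrightarrow> (d i has_field_derivative d (Suc i) t) (at t)"
    and K: "\<And>s t. \<bar>d j t - d j s\<bar> \<le> K * \<bar>t - s\<bar>"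
  shows "\<bar>S (Suc j) x\<bar> \<le> K * L (Suc (Suc j)) x"
proof -
  have L: "(LINT t:{..x}|lborel. (t - x) ^ i / fact i * p t) = (- 1) ^ i * L (Suc i) x" for i
    unfolding lower_power_eq[symmetric] by simp
  have "set_integrable lborel {..x} (\<lambda>t. (t - x) ^ i / fact i * p t)" if "i \<le> Suc j" for i
    unfolding lower_power_eq[symmetric] using that assms(1)
    by (intro set_integrable_mult_right L_set_integrable) simp
  note Taylor_remainder_integral[of "{..x}" j x K, OF _ this d K]
  moreover have "(LINT t:{..x}|lborel. \<bar>t - x\<bar> ^ Suc j / fact (Suc j) * p t) = L (Suc (Suc j)) x"
    unfolding L.simps by (intro set_lebesgue_integral_cong) auto
  moreover have "\<bar>S (Suc j) x\<bar> = \<bar>(LINT t:{..x}|lborel. p t * d 0 t) - (\<Sum>i<Suc j. d i x * ((- 1) ^ i * L (Suc i) x))\<bar>"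
    by (simp add: S_def abs_mult power_abs del: L.simps sum.lessThan_Suc power_Suc)
  ultimately show ?thesis
    by (simp only: L) simp
qed

lemma S'_bound:
  assumes "Suc j \<le> N" and d: "\<And>i t. i < j \<Longrightarrow> (d i has_field_derivative d (Suc i) t) (at t)"
    and K: "\<And>s t. \<bar>d j t - d j s\<bar> \<le> K * \<bar>t - s\<bar>"
  shows "\<bar>S' (Suc j) x\<bar> \<le> K * U (Suc (Suc j)) x"
proof -
  have "set_integrable lborel {x..} (\<lambda>t. (t - x) ^ i / fact i * p t)" if "i \<le> Suc j" for i
    using that assms(1) by (intro U_set_integrable) simp
  note Taylor_remainder_integral[of "{x..}" j x K, OF _ this d K]
  moreover have "(LINT t:{x..}|lborel. \<bar>t - x\<bar> ^ Suc j / fact (Suc j) * p t) = U (Suc (Suc j)) x"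
    unfolding U.simps by (intro set_lebesgue_integral_cong) auto
  ultimately show ?thesis
    unfolding S'_def U.simps by simp
qed

definition F :: "nat \<Rightarrow> real \<Rightarrow> real" where
  "F j x = cq j * (U (Suc j) x * S j x - L (Suc j) x * S' j x) / (Q x ^ Suc j * p x)"

text \<open>After \<open>S_Suc\<close> and \<open>S'_Suc\<close> the coefficients of
  \<open>d j x\<close> on the two sides agree as in \<open>W_Suc\<close>, and the remaining terms
  agree by the recurrences for \<open>L\<close> and \<open>U\<close>. \<open>F (Suc j)\<close>
  contains no derivative of \<open>h\<close> of order above \<open>j\<close>, so this one need not
  be differentiable.\<close>

lemma F_deriv:
  assumes "Suc j \<le> N" "x \<in> I" "isCont (d 0) x"
    and "\<And>i. i < j \<Longrightarrow> (d i has_field_derivative d (Suc i) x) (at x)"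
  shows "(F j has_field_derivative F (Suc j) x) (at x)"
  unfolding F_def[abs_def]
proof (rule div_Qp_deriv[OF assms(2)])
  have x: "x \<notin> X"
    using assms(2) by (simp add: I_def)
  show "((\<lambda>x. cq j * (U (Suc j) x * S j x - L (Suc j) x * S' j x)) has_field_derivative
    cq j * ((- U j x * S j x + L j x * d j x * U (Suc j) x) -
      (L j x * S' j x + - (U j x * d j x) * L (Suc j) x))) (at x)"
    using assms x by (intro DERIV_cmult DERIV_diff DERIV_mult U_deriv L_deriv S_deriv S'_deriv) auto
  have "cq (Suc j) * (U (Suc (Suc j)) x * S (Suc j) x - L (Suc (Suc j)) x * S' (Suc j) x) =
     cq j * (pearson_q \<kappa>\<^sub>2 (Suc j) * U (Suc (Suc j)) x * S (Suc j) x - pearson_q \<kappa>\<^sub>2 (Suc j) * L (Suc (Suc j)) x * S' (Suc j) x)"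
    by (simp add: cq_Suc algebra_simps del: L.simps U.simps)
  also have "\<dots> = Q x * (cq j * ((- U j x * S j x + L j x * d j x * U (Suc j) x) -
      (L j x * S' j x + - (U j x * d j x) * L (Suc j) x))) -
      (real j * Q' x + \<mu> - x) * (cq j * (U (Suc j) x * S j x - L (Suc j) x * S' j x))"
    unfolding L_identity[OF assms(1) x, symmetric] U_identity[OF assms(1) x, symmetric] S_Suc S'_Suc
    by (simp only: ring_distribs) (simp add: algebra_simps del: L.simps U.simps)
  finally show "Q x * (cq j * ((- U j x * S j x + L j x * d j x * U (Suc j) x) -
      (L j x * S' j x + - (U j x * d j x) * L (Suc j) x))) -
      (real j * Q' x + \<mu> - x) * (cq j * (U (Suc j) x * S j x - L (Suc j) x * S' j x)) =
     cq (Suc j) * (U (Suc (Suc j)) x * S (Suc j) x - L (Suc (Suc j)) x * S' (Suc j) x)"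
    by simp
qed

section \<open>The three estimates\<close>

lemma F_abs: "j \<le> N \<Longrightarrow> x \<in> I \<Longrightarrow>
  \<bar>F j x\<bar> = cq j * \<bar>U (Suc j) x * S j x - L (Suc j) x * S' j x\<bar> / (Q x ^ Suc j * p x)"
  using cq_pos[of j] Q_pos_I[of x] unfolding F_def by (simp add: abs_mult I_def del: L.simps U.simps)

lemma cq_W_div: "j \<le> N \<Longrightarrow> x \<in> I \<Longrightarrow> cq j * (C * W j x) / (Q x ^ Suc j * p x) = C / Q x"
proof -
  assume "j \<le> N" "x \<in> I"
  then have eq: "cq j * (C * W j x) = C * (Q x ^ j * p x)" and "Q x > 0" "p x > 0"
    using cq_W[of j x] Q_pos_I[of x] by (auto simp: I_def ac_simps)
  then show ?thesis
    unfolding eq by simp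
qed

text \<open>With \<open>n = j + 2\<close> only the derivative of order \<open>n - 2\<close> is
  Lipschitz, so the integrals of order \<open>n\<close> are traced back to order
  \<open>n - 1\<close>. The value \<open>d (n - 1) x\<close> contributes at most
  \<open>K * W n x\<close> and the integrals at most as much again, whence the factor 2.\<close>

lemma F_bound_1:
  assumes "Suc (Suc j) \<le> N" "x \<in> I" and d: "\<And>i t. i < j \<Longrightarrow> (d i has_field_derivative d (Suc i) t) (at t)"
    and K: "\<And>s t. \<bar>d j t - d j s\<bar> \<le> K * \<bar>t - s\<bar>" and x: "\<bar>d (Suc j) x\<bar> \<le> K"
  shows "\<bar>F (Suc (Suc j)) x\<bar> \<le> 2 / Q x * K"
proof -
  let ?n = "Suc (Suc j)"
  have "\<bar>U (Suc ?n) x * S ?n x - L (Suc ?n) x * S' ?n x\<bar> =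
      \<bar>W ?n x * d (Suc j) x - U (Suc ?n) x * S (Suc j) x - L (Suc ?n) x * S' (Suc j) x\<bar>"
    unfolding S_Suc[of "Suc j"] S'_Suc[of "Suc j"] W_def by (simp add: algebra_simps del: L.simps U.simps)
  also have "\<dots> \<le> \<bar>W ?n x * d (Suc j) x\<bar> + \<bar>U (Suc ?n) x * S (Suc j) x\<bar> + \<bar>L (Suc ?n) x * S' (Suc j) x\<bar>"
    by linarith
  also have "\<dots> \<le> W ?n x * K + U (Suc ?n) x * (K * L ?n x) + L (Suc ?n) x * (K * U ?n x)"
  proof (intro add_mono)
    have "0 \<le> W ?n x"
      unfolding W_def by (intro add_nonneg_nonneg mult_nonneg_nonneg L_nonneg U_nonneg)
    then show "\<bar>W ?n x * d (Suc j) x\<bar> \<le> W ?n x * K"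
      using x by (simp add: abs_mult mult_left_mono)
    show "\<bar>U (Suc ?n) x * S (Suc j) x\<bar> \<le> U (Suc ?n) x * (K * L ?n x)"
      using S_bound[of j K x] assms U_nonneg[of "Suc ?n" x] by (simp only: abs_mult) (intro mult_mono; simp)
    show "\<bar>L (Suc ?n) x * S' (Suc j) x\<bar> \<le> L (Suc ?n) x * (K * U ?n x)"
      using S'_bound[of j K x] assms L_nonneg[of "Suc ?n" x] by (simp only: abs_mult) (intro mult_mono; simp)
  qed
  also have "\<dots> = 2 * K * W ?n x"
    by (simp add: W_def algebra_simps del: L.simps U.simps)
  finally have "\<bar>F ?n x\<bar> \<le> cq ?n * (2 * K * W ?n x) / (Q x ^ Suc ?n * p x)"
    unfolding F_abs[OF assms(1,2)] using cq_pos[OF assms(1)] Q_pos_I[OF assms(2)] p_nonneg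
    by (intro divide_right_mono mult_left_mono) auto
  then show ?thesis
    unfolding cq_W_div[OF assms(1,2)] by (simp add: mult.commute)
qed

text \<open>The remainder estimates apply directly to the integrals of order \<open>Suc j\<close>.
  The two equal summands are kept apart to match \<open>stein_U_eq\<close>.\<close>

lemma F_bound_2:
  assumes "Suc j \<le> N" "x \<in> I" and d: "\<And>i t. i < j \<Longrightarrow> (d i has_field_derivative d (Suc i) t) (at t)"
    and K: "\<And>s t. \<bar>d j t - d j s\<bar> \<le> K * \<bar>t - s\<bar>"
  shows "\<bar>F (Suc j) x\<bar> \<le> (cq (Suc j) * U (Suc (Suc j)) x / (Q x ^ Suc (Suc j) * p x) * L (Suc (Suc j)) x +
    cq (Suc j) * L (Suc (Suc j)) x / (Q x ^ Suc (Suc j) * p x) * U (Suc (Suc j)) x) * K"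
proof -
  let ?n = "Suc j"
  have "\<bar>U (Suc ?n) x * S ?n x - L (Suc ?n) x * S' ?n x\<bar> \<le> \<bar>U (Suc ?n) x * S ?n x\<bar> + \<bar>L (Suc ?n) x * S' ?n x\<bar>"
    by linarith
  also have "\<dots> \<le> U (Suc ?n) x * (K * L (Suc ?n) x) + L (Suc ?n) x * (K * U (Suc ?n) x)"
  proof (intro add_mono)
    show "\<bar>U (Suc ?n) x * S ?n x\<bar> \<le> U (Suc ?n) x * (K * L (Suc ?n) x)"
      using S_bound[of j K x] assms U_nonneg[of "Suc ?n" x] by (simp only: abs_mult) (intro mult_mono; simp)
    show "\<bar>L (Suc ?n) x * S' ?n x\<bar> \<le> L (Suc ?n) x * (K * U (Suc ?n) x)"
      using S'_bound[of j K x] assms L_nonneg[of "Suc ?n" x] by (simp only: abs_mult) (intro mult_mono; simp)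
  qed
  finally have "\<bar>F ?n x\<bar> \<le> cq ?n * (U (Suc ?n) x * (K * L (Suc ?n) x) + L (Suc ?n) x * (K * U (Suc ?n) x)) / (Q x ^ Suc ?n * p x)"
    unfolding F_abs[OF assms(1,2)] using cq_pos[OF assms(1)] Q_pos_I[OF assms(2)] p_nonneg
    by (intro divide_right_mono mult_left_mono) auto
  also have "\<dots> = (cq ?n * U (Suc ?n) x / (Q x ^ Suc ?n * p x) * L (Suc ?n) x +
    cq ?n * L (Suc ?n) x / (Q x ^ Suc ?n * p x) * U (Suc ?n) x) * K"
    by (simp add: add_divide_distrib ring_distribs ac_simps del: L.simps U.simps power_Suc)
  finally show ?thesis .
qed

text \<open>Passing to the remainders of order \<open>n + 1\<close>, the two terms with
  \<open>d n x\<close> cancel. The rest is at most \<open>K * W (Suc n) x\<close>, and trading this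
  for \<open>W n x\<close> by \<open>W_Suc\<close> leaves exactly the constant
  \<open>1 / pearson_q \<kappa>\<^sub>2 (Suc n)\<close>.\<close>

lemma F_bound_3:
  assumes "Suc n \<le> N" "x \<in> I" and d: "\<And>i t. i < n \<Longrightarrow> (d i has_field_derivative d (Suc i) t) (at t)"
    and K: "\<And>s t. \<bar>d n t - d n s\<bar> \<le> K * \<bar>t - s\<bar>"
  shows "\<bar>F n x\<bar> \<le> 1 / pearson_q \<kappa>\<^sub>2 (Suc n) * K"
proof -
  have n: "n \<le> N"
    using assms(1) by simp
  have x: "x \<notin> X" and pos: "Q x > 0" "p x > 0"
    using assms(2) Q_pos_I by (auto simp: I_def)
  have q: "pearson_q \<kappa>\<^sub>2 (Suc n) > 0"
    using assms(1) by (intro q_pos) auto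
  have "\<bar>U (Suc n) x * S n x - L (Suc n) x * S' n x\<bar> = \<bar>- (U (Suc n) x * S (Suc n) x) - L (Suc n) x * S' (Suc n) x\<bar>"
    unfolding S_Suc S'_Suc by (simp add: algebra_simps del: L.simps U.simps)
  also have "\<dots> \<le> \<bar>U (Suc n) x * S (Suc n) x\<bar> + \<bar>L (Suc n) x * S' (Suc n) x\<bar>"
    by linarith
  also have "\<dots> \<le> U (Suc n) x * (K * L (Suc (Suc n)) x) + L (Suc n) x * (K * U (Suc (Suc n)) x)"
  proof (intro add_mono)
    show "\<bar>U (Suc n) x * S (Suc n) x\<bar> \<le> U (Suc n) x * (K * L (Suc (Suc n)) x)"
      using S_bound[of n K x] assms U_nonneg[of "Suc n" x] by (simp only: abs_mult) (intro mult_mono; simp)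
    show "\<bar>L (Suc n) x * S' (Suc n) x\<bar> \<le> L (Suc n) x * (K * U (Suc (Suc n)) x)"
      using S'_bound[of n K x] assms L_nonneg[of "Suc n" x] by (simp only: abs_mult) (intro mult_mono; simp)
  qed
  also have "\<dots> = K * W (Suc n) x"
    by (simp add: W_def algebra_simps del: L.simps U.simps)
  also have "W (Suc n) x = Q x * W n x / pearson_q \<kappa>\<^sub>2 (Suc n)"
    using W_Suc[OF assms(1) x] q by (simp add: field_simps)
  finally have "\<bar>F n x\<bar> \<le> cq n * (K * (Q x * W n x / pearson_q \<kappa>\<^sub>2 (Suc n))) / (Q x ^ Suc n * p x)"
    unfolding F_abs[OF n assms(2)] using cq_pos[OF n] pos
    by (intro divide_right_mono mult_left_mono) auto
  also have "cq n * (K * (Q x * W n x / pearson_q \<kappa>\<^sub>2 (Suc n))) / (Q x ^ Suc n * p x) =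
      cq n * ((K * Q x / pearson_q \<kappa>\<^sub>2 (Suc n)) * W n x) / (Q x ^ Suc n * p x)"
    by simp
  also have "\<dots> = 1 / pearson_q \<kappa>\<^sub>2 (Suc n) * K"
    unfolding cq_W_div[OF n assms(2)] using pos by simp
  finally show ?thesis .
qed

end

section \<open>Lipschitz functions on compact intervals\<close>

text \<open>The route to local absolute continuity of the derivatives of the solution: on compact
  intervals this class is closed under products and reciprocals of positive functions. The constant
  is immaterial and therefore hidden.\<close>

definition lipschitz_Icc :: "real \<Rightarrow> real \<Rightarrow> (real \<Rightarrow> real) \<Rightarrow> bool" where
  "lipschitz_Icc a b f \<longleftrightarrow> (\<exists>K. K-lipschitz_on {a..b} f)"

lemma lipschitz_IccI: "(\<And>s t. s \<in> {a..b} \<Longrightarrow> t \<in> {a..b} \<Longrightarrow> \<bar>f t - f s\<bar> \<le> K * \<bar>t - s\<bar>) \<Longrightarrow> lipschitz_Icc a b f"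
  unfolding lipschitz_Icc_def
proof (intro exI lipschitz_onI)
  assume K: "\<And>s t. s \<in> {a..b} \<Longrightarrow> t \<in> {a..b} \<Longrightarrow> \<bar>f t - f s\<bar> \<le> K * \<bar>t - s\<bar>"
  fix s t assume "s \<in> {a..b}" "t \<in> {a..b}"
  then have "\<bar>f s - f t\<bar> \<le> K * \<bar>s - t\<bar>"
    by (intro K)
  also have "\<dots> \<le> max 0 K * \<bar>s - t\<bar>"
    by (intro mult_right_mono) auto
  finally show "dist (f s) (f t) \<le> max 0 K * dist s t"
    by (simp add: dist_real_def)
qed simp

lemma lipschitz_Icc_bounded:
  assumes "lipschitz_Icc a b f"
  obtains B where "B > 0" "\<And>x. x \<in> {a..b} \<Longrightarrow> \<bar>f x\<bar> \<le> B"
proof -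
  have "continuous_on {a..b} f"
    using assms lipschitz_on_continuous_on unfolding lipschitz_Icc_def by blast
  then have "bounded (f ` {a..b})"
    by (intro compact_imp_bounded compact_continuous_image) auto
  then show ?thesis
    using that unfolding bounded_pos by auto
qed

lemma lipschitz_Icc_C1:
  assumes f: "\<And>x. x \<in> {a..b} \<Longrightarrow> (f has_field_derivative f' x) (at x)" and f': "continuous_on {a..b} f'"
  shows "lipschitz_Icc a b f"
proof -
  have "bounded (f' ` {a..b})"
    using f' by (intro compact_imp_bounded compact_continuous_image) auto
  then obtain B where B: "\<forall>x\<in>{a..b}. \<bar>f' x\<bar> \<le> B"
    unfolding bounded_iff by auto
  show ?thesis
  proof (rule lipschitz_IccI)
    fix s t assume "s \<in> {a..b}" "t \<in> {a..b}"
    then have "norm (f t - f s) \<le> B * norm (t - s)"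
      using B by (intro field_differentiable_bound[of "{a..b}" f f']) (auto intro!: has_field_derivative_at_within f)
    then show "\<bar>f t - f s\<bar> \<le> B * \<bar>t - s\<bar>" by simp
  qed
qed

lemma lipschitz_Icc_diff: "lipschitz_Icc a b f \<Longrightarrow> lipschitz_Icc a b g \<Longrightarrow> lipschitz_Icc a b (\<lambda>x. f x - g x)"
  unfolding lipschitz_Icc_def using lipschitz_on_diff by blast

lemma lipschitz_Icc_const: "lipschitz_Icc a b (\<lambda>x. k)"
  unfolding lipschitz_Icc_def using lipschitz_on_constant by blast

lemma lipschitz_Icc_mult:
  assumes f: "lipschitz_Icc a b f" and g: "lipschitz_Icc a b g"
  shows "lipschitz_Icc a b (\<lambda>x. f x * g x)"
proof -
  obtain K where K: "\<And>s t. s \<in> {a..b} \<Longrightarrow> t \<in> {a..b} \<Longrightarrow> \<bar>f t - f s\<bar> \<le> K * \<bar>t - s\<bar>"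
    using f unfolding lipschitz_Icc_def lipschitz_on_def dist_real_def by metis
  obtain K' where K': "\<And>s t. s \<in> {a..b} \<Longrightarrow> t \<in> {a..b} \<Longrightarrow> \<bar>g t - g s\<bar> \<le> K' * \<bar>t - s\<bar>"
    using g unfolding lipschitz_Icc_def lipschitz_on_def dist_real_def by metis
  obtain B where B: "B > 0" "\<And>x. x \<in> {a..b} \<Longrightarrow> \<bar>f x\<bar> \<le> B"
    using lipschitz_Icc_bounded[OF f] by blast
  obtain B' where B': "B' > 0" "\<And>x. x \<in> {a..b} \<Longrightarrow> \<bar>g x\<bar> \<le> B'"
    using lipschitz_Icc_bounded[OF g] by blast
  show ?thesis
  proof (rule lipschitz_IccI)
    fix s t assume st: "s \<in> {a..b}" "t \<in> {a..b}"
    have "f t * g t - f s * g s = f t * (g t - g s) + g s * (f t - f s)"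
      by (simp add: algebra_simps)
    then have "\<bar>f t * g t - f s * g s\<bar> \<le> \<bar>f t\<bar> * \<bar>g t - g s\<bar> + \<bar>g s\<bar> * \<bar>f t - f s\<bar>"
      using abs_triangle_ineq by (simp flip: abs_mult)
    also have "\<dots> \<le> B * (K' * \<bar>t - s\<bar>) + B' * (K * \<bar>t - s\<bar>)"
      using st B B' by (intro add_mono mult_mono K K') auto
    finally show "\<bar>f t * g t - f s * g s\<bar> \<le> (B * K' + B' * K) * \<bar>t - s\<bar>"
      by (simp add: algebra_simps)
  qed
qed

lemma lipschitz_Icc_inverse:
  assumes f: "lipschitz_Icc a b f" and pos: "\<And>x. x \<in> {a..b} \<Longrightarrow> 0 < f x"
  shows "lipschitz_Icc a b (\<lambda>x. inverse (f x))"
proof (cases "a \<le> b")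
  case True
  obtain K where K: "\<And>s t. s \<in> {a..b} \<Longrightarrow> t \<in> {a..b} \<Longrightarrow> \<bar>f t - f s\<bar> \<le> K * \<bar>t - s\<bar>"
    using f unfolding lipschitz_Icc_def lipschitz_on_def dist_real_def by metis
  have "continuous_on {a..b} f"
    using f lipschitz_on_continuous_on unfolding lipschitz_Icc_def by blast
  then obtain x0 where x0: "x0 \<in> {a..b}" "\<And>x. x \<in> {a..b} \<Longrightarrow> f x0 \<le> f x"
    using continuous_attains_inf[of "{a..b}" f] True by auto
  define m where "m = f x0"
  have m: "m > 0" "\<And>x. x \<in> {a..b} \<Longrightarrow> m \<le> f x"
    using x0 pos by (auto simp: m_def)
  show ?thesis
  proof (rule lipschitz_IccI)
    fix s t assume st: "s \<in> {a..b}" "t \<in> {a..b}"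
    then have p: "m \<le> f s" "m \<le> f t" "0 < f s" "0 < f t"
      using m pos by auto
    have "\<bar>inverse (f t) - inverse (f s)\<bar> = \<bar>f t - f s\<bar> / (f t * f s)"
      using p by (simp add: inverse_eq_divide diff_frac_eq abs_minus_commute abs_mult)
    also have "\<dots> \<le> \<bar>f t - f s\<bar> / (m * m)"
      using p m(1) by (intro divide_left_mono mult_mono) auto
    also have "\<dots> \<le> K * \<bar>t - s\<bar> / (m * m)"
      using K[OF st] m(1) by (intro divide_right_mono) auto
    finally show "\<bar>inverse (f t) - inverse (f s)\<bar> \<le> K / (m * m) * \<bar>t - s\<bar>"
      by simp
  qed
qed (auto intro: lipschitz_IccI)

lemma lipschitz_Icc_power: "lipschitz_Icc a b f \<Longrightarrow> lipschitz_Icc a b (\<lambda>x. f x ^ k)"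
  by (induction k) (auto intro: lipschitz_Icc_mult lipschitz_Icc_const)

lemma lipschitz_Icc_cong:
  "(\<And>x. x \<in> {a..b} \<Longrightarrow> f x = g x) \<Longrightarrow> lipschitz_Icc a b f \<longleftrightarrow> lipschitz_Icc a b g"
  unfolding lipschitz_Icc_def lipschitz_on_def by simp

lemma lipschitz_Icc_abs_cont:
  assumes "lipschitz_Icc a b f"
  shows "abs_cont_on a b f"
proof -
  obtain K where K: "\<And>s t. s \<in> {a..b} \<Longrightarrow> t \<in> {a..b} \<Longrightarrow> \<bar>f t - f s\<bar> \<le> K * \<bar>t - s\<bar>"
    using assms unfolding lipschitz_Icc_def lipschitz_on_def dist_real_def by metis
  have "\<bar>f t - f s\<bar> \<le> K * (t - s)" if "a \<le> s" "s \<le> t" "t \<le> b" for s t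
    using K[of s t] that by simp
  then show ?thesis
    by (rule abs_cont_on_lipschitz)
qed

section \<open>Iterated derivatives on open sets and regularity of the closed form\<close>

text \<open>\<open>deriv\<close> depends only on the values near the point, so equality on an open
  set passes from each order to the next.\<close>

lemma
  fixes g :: "real \<Rightarrow> real"
  assumes "open A" and g: "\<And>x. x \<in> A \<Longrightarrow> g x = G 0 x"
    and G: "\<And>k x. k < n \<Longrightarrow> x \<in> A \<Longrightarrow> (G k has_field_derivative G (Suc k) x) (at x)"
  shows deriv_iterate_on_open: "j \<le> n \<Longrightarrow> x \<in> A \<Longrightarrow> (deriv ^^ j) g x = G j x"
    and deriv_iterate_differentiable: "j < n \<Longrightarrow> x \<in> A \<Longrightarrow> (deriv ^^ j) g field_differentiable (at x)"
proof -
  have cong: "((deriv ^^ j) g has_field_derivative D) (at x)"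
    if "\<And>x. x \<in> A \<Longrightarrow> (deriv ^^ j) g x = G j x" "x \<in> A" "(G j has_field_derivative D) (at x)" for j x D
  proof -
    have "\<forall>\<^sub>F y in nhds x. (deriv ^^ j) g y = G j y"
      using that(1,2) \<open>open A\<close> unfolding eventually_nhds by blast
    from DERIV_cong_ev[OF refl this refl] show ?thesis
      using that(3) by simp
  qed
  have eq: "(deriv ^^ j) g x = G j x" if "j \<le> n" "x \<in> A" for j x
    using that
  proof (induction j arbitrary: x)
    case 0
    then show ?case using g by simp
  next
    case (Suc j)
    have "((deriv ^^ j) g has_field_derivative G (Suc j) x) (at x)"
      using Suc by (intro cong G) auto
    then show ?case
      by (simp add: DERIV_imp_deriv)
  qed
  then show "j \<le> n \<Longrightarrow> x \<in> A \<Longrightarrow> (deriv ^^ j) g x = G j x" .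
  show "(deriv ^^ j) g field_differentiable (at x)" if "j < n" "x \<in> A"
    using cong[of j x "G (Suc j) x"] eq[of j] G[of j x] that unfolding field_differentiable_def by auto
qed

context pearson_test
begin

lemma U_isCont: "k \<le> N \<Longrightarrow> x \<notin> X \<Longrightarrow> isCont (U k) x"
  using p_isCont[of x] DERIV_isCont[OF U_deriv[of "k - 1" x]] by (cases k) auto

lemma L_isCont: "k \<le> N \<Longrightarrow> x \<notin> X \<Longrightarrow> isCont (L k) x"
  using p_isCont[of x] DERIV_isCont[OF L_deriv[of "k - 1" x]] by (cases k) auto

text \<open>\<open>S (Suc j)\<close> is no smoother than \<open>d j\<close>, so \<open>S_Suc\<close>
  splits \<open>d j\<close> off, and what remains is \<open>S j\<close> with a continuous
  derivative. The density in the denominator is Lipschitz because it equals \<open>T / Q\<close> on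
  the interval.\<close>

lemma F_lipschitz:
  assumes j: "Suc (Suc j) \<le> N" and ab: "{a..b} \<subseteq> I"
    and d: "\<And>i t. i < j \<Longrightarrow> (d i has_field_derivative d (Suc i) t) (at t)"
    and cont: "\<And>t. isCont (d 0) t" and lip: "lipschitz_Icc a b (d j)"
  shows "lipschitz_Icc a b (F (Suc j))"
proof -
  have X: "x \<notin> X" if "x \<in> {a..b}" for x
    using that ab by (auto simp: I_def)
  have pos: "0 < Q x" "0 < p x" if "x \<in> {a..b}" for x
    using that ab Q_pos_I by (auto simp: I_def)
  have cd: "continuous_on {a..b} (d j)"
    using lip lipschitz_on_continuous_on unfolding lipschitz_Icc_def by blast
  have cU: "continuous_on {a..b} (U k)" and cL: "continuous_on {a..b} (L k)" if "k \<le> N" for k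
    using that X by (auto intro!: continuous_at_imp_continuous_on U_isCont L_isCont)
  have lQ: "lipschitz_Icc a b Q"
  proof (rule lipschitz_Icc_C1)
    show "continuous_on {a..b} Q'"
      unfolding Q'_def[abs_def] by (intro continuous_intros)
  qed (rule Q_deriv)
  have "lipschitz_Icc a b T"
  proof (rule lipschitz_Icc_C1)
    show "continuous_on {a..b} (\<lambda>x. (\<mu> - x) * p x)"
      using cL[of 0] by (intro continuous_intros) simp
  qed (rule T_deriv[OF X])
  then have "lipschitz_Icc a b (\<lambda>x. T x * inverse (Q x))"
    using lQ pos by (intro lipschitz_Icc_mult lipschitz_Icc_inverse)
  moreover have "T x * inverse (Q x) = p x" if "x \<in> {a..b}" for x
    using T_eq[OF X[OF that]] pos[OF that] by (simp add: field_simps)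
  ultimately have lp: "lipschitz_Icc a b p"
    using lipschitz_Icc_cong[of a b p "\<lambda>x. T x * inverse (Q x)"] by simp
  have lU: "lipschitz_Icc a b (U (Suc k))" if "k \<le> N" for k
    by (rule lipschitz_Icc_C1[OF U_deriv[OF that X]]) (assumption, intro continuous_intros cU that)
  have lL: "lipschitz_Icc a b (L (Suc k))" if "k \<le> N" for k
    by (rule lipschitz_Icc_C1[OF L_deriv[OF that X]]) (assumption, intro cL that)
  have lS: "lipschitz_Icc a b (S j)"
    by (rule lipschitz_Icc_C1[OF S_deriv[OF _ X cont d]]) (use j cL cd in \<open>auto intro!: continuous_intros\<close>)
  have lS': "lipschitz_Icc a b (S' j)"
    by (rule lipschitz_Icc_C1[OF S'_deriv[OF _ X cont d]]) (use j cU cd in \<open>auto intro!: continuous_intros\<close>)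
  have "lipschitz_Icc a b (\<lambda>x. cq (Suc j) * (U (Suc (Suc j)) x * (L (Suc j) x * d j x - S j x) -
      L (Suc (Suc j)) x * (S' j x - U (Suc j) x * d j x)) * inverse (Q x ^ Suc (Suc j) * p x))"
    using j pos
    by (intro lipschitz_Icc_mult lipschitz_Icc_diff lipschitz_Icc_const lipschitz_Icc_inverse lipschitz_Icc_power
        lU lL lS lS' lp lQ lip) (auto intro!: mult_pos_pos)
  then show ?thesis
    by (simp only: F_def[abs_def] S_Suc S'_Suc divide_inverse)
qed

end

section \<open>Seminorms, the weight \<open>U\<close>, and the bounds\<close>

text \<open>If \<open>x\<close> lies below \<open>l\<close>, the interval integral runs backwards,
  but \<open>g\<close> vanishes on its whole range, so both sides are 0.\<close>

lemma LBINT_eq_LINT_atMost: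
  fixes g :: "real \<Rightarrow> real"
  assumes g: "\<And>t. ereal t \<le> l \<Longrightarrow> g t = 0"
  shows "(LBINT t=l..ereal x. g t) = (LINT t:{..x}|lborel. g t)"
proof (cases "l \<le> ereal x")
  case True
  have "(LINT t:{..x}|lborel. g t) = (LINT t:einterval l (ereal x)|lborel. g t)"
    unfolding set_lebesgue_integral_def
  proof (rule integral_discrete_difference[of "{x}"])
    fix t assume "t \<notin> {x}"
    then show "indicator {..x} t *\<^sub>R g t = indicator (einterval l (ereal x)) t *\<^sub>R g t"
      using g[of t] by (auto simp: einterval_iff split: split_indicator)
  qed auto
  with True show ?thesis
    by (simp add: interval_lebesgue_integral_def)
next
  case False
  have "(LINT t:einterval (ereal x) l|lborel. g t) = (LINT t:einterval (ereal x) l|lborel. 0)"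
    using g by (intro set_lebesgue_integral_cong) (auto simp: einterval_iff)
  moreover have "(LINT t:{..x}|lborel. g t) = (LINT t:{..x}|lborel. 0)"
  proof (intro set_lebesgue_integral_cong allI impI)
    fix t assume "t \<in> {..x}"
    then have "ereal t \<le> ereal x" by simp
    then show "g t = 0"
      using False g[of t] by (metis le_cases order_trans)
  qed simp
  ultimately show ?thesis
    using False by (simp add: interval_lebesgue_integral_def)
qed

lemma LBINT_eq_LINT_atLeast:
  fixes g :: "real \<Rightarrow> real"
  assumes g: "\<And>t. u \<le> ereal t \<Longrightarrow> g t = 0"
  shows "(LBINT t=ereal x..u. g t) = (LINT t:{x..}|lborel. g t)"
proof (cases "ereal x \<le> u")
  case True
  have "(LINT t:{x..}|lborel. g t) = (LINT t:einterval (ereal x) u|lborel. g t)"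
    unfolding set_lebesgue_integral_def
  proof (rule integral_discrete_difference[of "{x}"])
    fix t assume "t \<notin> {x}"
    then show "indicator {x..} t *\<^sub>R g t = indicator (einterval (ereal x) u) t *\<^sub>R g t"
      using g[of t] by (auto simp: einterval_iff split: split_indicator)
  qed auto
  with True show ?thesis
    by (simp add: interval_lebesgue_integral_def)
next
  case False
  have "(LINT t:einterval u (ereal x)|lborel. g t) = (LINT t:einterval u (ereal x)|lborel. 0)"
    using g by (intro set_lebesgue_integral_cong) (auto simp: einterval_iff)
  moreover have "(LINT t:{x..}|lborel. g t) = (LINT t:{x..}|lborel. 0)"
  proof (intro set_lebesgue_integral_cong allI impI)
    fix t assume "t \<in> {x..}"
    then have "ereal x \<le> ereal t" by simp
    then show "g t = 0"
      using False g[of t] by (metis le_cases order_trans)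
  qed simp
  ultimately show ?thesis
    using False by (simp add: interval_lebesgue_integral_def)
qed

text \<open>The bound on the derivative of order \<open>i + 1\<close> holds almost everywhere only,
  yet the Lipschitz bound for order \<open>i\<close> holds between all points, by
  \<open>lipschitz_of_deriv_bounded_ae\<close>.\<close>

lemma deriv_seminorm_finiteE:
  assumes "deriv_seminorm (Suc i) h < \<infinity>"
  obtains K where "deriv_seminorm (Suc i) h = ereal K"
    "\<And>j t. j < i \<Longrightarrow> ((deriv ^^ j) h has_field_derivative (deriv ^^ Suc j) h t) (at t)"
    "\<And>s t. \<bar>(deriv ^^ i) h t - (deriv ^^ i) h s\<bar> \<le> K * \<bar>t - s\<bar>"
    "AE x in lborel. ((deriv ^^ i) h has_field_derivative (deriv ^^ Suc i) h x) (at x) \<and> \<bar>(deriv ^^ Suc i) h x\<bar> \<le> K"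
proof -
  have ac: "deriv_loc_abs_cont_on i UNIV h"
    and s: "deriv_seminorm (Suc i) h = esssup lebesgue (\<lambda>x. ereal \<bar>(deriv ^^ Suc i) h x\<bar>)"
    using assms by (auto simp: deriv_seminorm_def simp del: funpow.simps split: if_splits)
  have ac_i: "loc_abs_cont_on UNIV ((deriv ^^ i) h)"
    using ac by (simp add: deriv_loc_abs_cont_on_def)
  have AE: "AE x in lebesgue. ereal \<bar>(deriv ^^ Suc i) h x\<bar> \<le> deriv_seminorm (Suc i) h"
    unfolding s by (rule esssup_AE)
  \<comment> \<open>An essential supremum \<open>- \<infinity>\<close> would put an absolute value
    below it almost everywhere, impossible since Lebesgue measure is not zero.\<close>
  have "deriv_seminorm (Suc i) h \<noteq> - \<infinity>"
  proof
    assume "deriv_seminorm (Suc i) h = - \<infinity>"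
    then have "AE x::real in lborel. False"
      using AE by (simp add: AE_completion_iff)
    then show False
      by (simp add: eventually_False ae_filter_eq_bot_iff)
  qed
  with assms obtain K where K: "deriv_seminorm (Suc i) h = ereal K"
    by (cases "deriv_seminorm (Suc i) h") auto
  have AEK: "AE x in lebesgue. \<bar>(deriv ^^ Suc i) h x\<bar> \<le> K"
    using AE unfolding K by simp
  show ?thesis
  proof (rule that[OF K])
    show "((deriv ^^ j) h has_field_derivative (deriv ^^ Suc j) h t) (at t)" if "j < i" for j t
      using ac that by (simp add: deriv_loc_abs_cont_on_def DERIV_deriv_iff_field_differentiable)
    show "\<bar>(deriv ^^ i) h t - (deriv ^^ i) h s\<bar> \<le> K * \<bar>t - s\<bar>" for s t
      using AEK by (intro lipschitz_of_deriv_bounded_ae[OF ac_i]) simp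
    have "AE x in lebesgue. (deriv ^^ i) h field_differentiable (at x)"
      using loc_abs_cont_differentiable_ae[OF ac_i]
      by (intro AE_I'[of "{x. \<not> (deriv ^^ i) h field_differentiable (at x)}"]) (auto simp: negligible_iff_null_sets)
    with AEK have "AE x in lebesgue. ((deriv ^^ i) h has_field_derivative (deriv ^^ Suc i) h x) (at x) \<and> \<bar>(deriv ^^ Suc i) h x\<bar> \<le> K"
      by eventually_elim (simp add: DERIV_deriv_iff_field_differentiable)
    then show "AE x in lborel. ((deriv ^^ i) h has_field_derivative (deriv ^^ Suc i) h x) (at x) \<and> \<bar>(deriv ^^ Suc i) h x\<bar> \<le> K"
      by (simp add: AE_completion_iff)
  qed
qed

context pearson
begin

lemma U_Suc_LINT:
  assumes "k \<le> N"
  shows "U (Suc k) x = (LINT t:{x..}|lborel. U k t)"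
proof -
  interpret R: pearson "\<lambda>x. p (- x)" \<kappa>\<^sub>0 "- \<kappa>\<^sub>1" \<kappa>\<^sub>2 "- \<mu>" "uminus ` X" N
    by (rule reflect)
  show ?thesis
    unfolding U_reflect R.L_Suc_LINT[OF assms] LINT_reflect[of "{x..}"] by simp
qed

lemma L_eq_0:
  assumes "\<And>t. ereal t \<le> l \<Longrightarrow> p t = 0" "ereal x \<le> l"
  shows "L k x = 0"
proof (cases k)
  case (Suc m)
  have "(LINT t:{..x}|lborel. (x - t) ^ m / fact m * p t) = (LINT t:{..x}|lborel. 0)"
  proof (intro set_lebesgue_integral_cong allI impI)
    fix t assume "t \<in> {..x}"
    then have "ereal t \<le> ereal x" by simp
    then have "p t = 0"
      using assms order_trans by blast
    then show "(x - t) ^ m / fact m * p t = 0" by simp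
  qed simp
  then show ?thesis
    using Suc by simp
qed (use assms in simp)

lemma U_eq_0:
  assumes "\<And>t. u \<le> ereal t \<Longrightarrow> p t = 0" "u \<le> ereal x"
  shows "U k x = 0"
proof (cases k)
  case (Suc m)
  have "(LINT t:{x..}|lborel. (t - x) ^ m / fact m * p t) = (LINT t:{x..}|lborel. 0)"
  proof (intro set_lebesgue_integral_cong allI impI)
    fix t assume "t \<in> {x..}"
    then have "ereal x \<le> ereal t" by simp
    then have "p t = 0"
      using assms order_trans by blast
    then show "(t - x) ^ m / fact m * p t = 0" by simp
  qed simp
  then show ?thesis
    using Suc by simp
qed (use assms in simp)

text \<open>Below \<open>l\<close> the density and all its lower integrals vanish, so integrating
  from \<open>l\<close> is integrating over the half line at every stage.\<close>

lemma lower_P_eq_L: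
  assumes "\<And>t. ereal t \<le> l \<Longrightarrow> p t = 0" "k \<le> Suc N"
  shows "lower_P p l k = L k"
  using assms(2)
proof (induction k)
  case (Suc k)
  have "lower_P p l (Suc k) x = (LINT t:{..x}|lborel. L k t)" for x
    unfolding lower_P.simps using Suc L_eq_0[OF assms(1)]
    by (simp only: Suc_leD) (rule LBINT_eq_LINT_atMost)
  then show ?case
    using L_Suc_LINT[of k] Suc.prems by (simp add: fun_eq_iff del: L.simps lower_P.simps)
qed simp

lemma upper_P_eq_U:
  assumes "\<And>t. u \<le> ereal t \<Longrightarrow> p t = 0" "k \<le> Suc N"
  shows "upper_P p u k = U k"
  using assms(2)
proof (induction k)
  case (Suc k)
  have "upper_P p u (Suc k) x = (LINT t:{x..}|lborel. U k t)" for x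
    unfolding upper_P.simps using Suc U_eq_0[OF assms(1)]
    by (simp only: Suc_leD) (rule LBINT_eq_LINT_atLeast)
  then show ?case
    using U_Suc_LINT[of k] Suc.prems by (simp add: fun_eq_iff del: U.simps upper_P.simps)
qed simp

text \<open>The derivatives of the two weights are read off from \<open>lower_ratio_deriv\<close>
  and \<open>upper_ratio_deriv\<close>; the alternating sign of the latter disappears in the
  absolute value.\<close>

lemma stein_U_eq:
  assumes l: "\<And>t. ereal t \<le> l \<Longrightarrow> p t = 0" and u: "\<And>t. u \<le> ereal t \<Longrightarrow> p t = 0"
    and \<tau>: "\<And>x. x \<in> I \<Longrightarrow> \<tau> x = Q x" and n: "n \<le> N" and x: "x \<in> I"
  shows "stein_U p l u \<tau> n x = cq n * U (Suc n) x / (Q x ^ Suc n * p x) * L (Suc n) x +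
    cq n * L (Suc n) x / (Q x ^ Suc n * p x) * U (Suc n) x"
proof -
  have "(deriv ^^ n) (lower_m p l \<tau>) x = cq n * L (Suc n) x / (Q x ^ Suc n * p x)"
  proof (rule deriv_iterate_on_open[OF open_I, where G = "\<lambda>k x. cq k * L (Suc k) x / (Q x ^ Suc k * p x)"])
    show "lower_m p l \<tau> x = cq 0 * L (Suc 0) x / (Q x ^ Suc 0 * p x)" if "x \<in> I" for x
      using LBINT_eq_LINT_atMost[of l p x] l \<tau>[OF that] by (simp add: lower_m_def cq_def)
  qed (use n x lower_ratio_deriv in auto)
  moreover have "(deriv ^^ n) (upper_m p u \<tau>) x = (- 1) ^ n * cq n * U (Suc n) x / (Q x ^ Suc n * p x)"
  proof (rule deriv_iterate_on_open[OF open_I, where G = "\<lambda>k x. (- 1) ^ k * cq k * U (Suc k) x / (Q x ^ Suc k * p x)"])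
    show "upper_m p u \<tau> x = (- 1) ^ 0 * cq 0 * U (Suc 0) x / (Q x ^ Suc 0 * p x)" if "x \<in> I" for x
      using LBINT_eq_LINT_atLeast[of u p x] u \<tau>[OF that] by (simp add: upper_m_def cq_def)
  qed (use n x upper_ratio_deriv in auto)
  moreover have "0 \<le> cq n" "0 < Q x" "0 < p x" "0 \<le> L (Suc n) x" "0 \<le> U (Suc n) x"
    using cq_pos[OF n] Q_pos_I[OF x] x L_nonneg U_nonneg by (auto simp: I_def simp del: L.simps U.simps)
  ultimately show ?thesis
    using lower_P_eq_L[of l "Suc n"] upper_P_eq_U[of u "Suc n"] l u n
    by (simp add: stein_U_def abs_mult power_abs del: L.simps U.simps lower_P.simps upper_P.simps power_Suc)
qed

end

context pearson_test
begin

text \<open>Splitting the mean at \<open>x\<close> as \<open>S 0 x + S' 0 x\<close> and using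
  \<open>1 - L 1 x = U 1 x\<close> brings the centered integral into the form, antisymmetric in the
  two tails, on which \<open>F_deriv\<close> operates.\<close>

lemma stein_solution_eq:
  assumes l: "\<And>t. ereal t \<le> l \<Longrightarrow> p t = 0" and \<tau>: "\<And>x. x \<in> I \<Longrightarrow> \<tau> x = Q x" and x: "x \<in> I"
    and Eh: "Eh = (\<integral>t. p t * d 0 t \<partial>lborel)"
  shows "stein_solution p l \<tau> (d 0) Eh x = F 0 x"
proof -
  have si: "set_integrable lborel {..x} (\<lambda>t. p t * d 0 t)" "set_integrable lborel {..x} (\<lambda>t. Eh * p t)"
    using set_integrable_of_integrable[OF _ d_integrable] set_integrable_of_integrable[OF _ p_integrable] by simp_all
  have Eh_split: "Eh = S 0 x + S' 0 x"
    unfolding Eh S_def S'_def using LINT_split[OF d_integrable, of x] by simp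
  have "(LBINT t=l..ereal x. (d 0 t - Eh) * p t) = (LINT t:{..x}|lborel. (d 0 t - Eh) * p t)"
    using l by (intro LBINT_eq_LINT_atMost) simp
  also have "\<dots> = (LINT t:{..x}|lborel. p t * d 0 t - Eh * p t)"
    by (simp add: algebra_simps)
  also have "\<dots> = S 0 x - Eh * L 1 x"
    using set_integral_diff(2)[OF si] by (simp add: S_def)
  also have "\<dots> = S 0 x * (1 - L 1 x) - S' 0 x * L 1 x"
    unfolding Eh_split by (simp add: algebra_simps)
  also have "1 - L 1 x = U 1 x"
    using L_U_1[of x] by linarith
  finally have eq: "(LBINT t=l..ereal x. (d 0 t - Eh) * p t) = S 0 x * U 1 x - S' 0 x * L 1 x" .
  show ?thesis
    unfolding stein_solution_def \<tau>[OF x] F_def eq by (simp add: cq_def mult.commute)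
qed

text \<open>With \<open>n = j + 2\<close> this gives the derivative of order \<open>n\<close> its
  almost everywhere meaning; a locally Lipschitz derivative of \<open>h\<close> of order
  \<open>j\<close> suffices.\<close>

lemma solution_regularity:
  assumes j: "Suc (Suc j) \<le> N" and f: "\<And>x. x \<in> I \<Longrightarrow> f x = F 0 x"
    and d: "\<And>i t. i < j \<Longrightarrow> (d i has_field_derivative d (Suc i) t) (at t)"
    and cont: "\<And>t. isCont (d 0) t" and lip: "\<And>a b. lipschitz_Icc a b (d j)"
  shows "x \<in> I \<Longrightarrow> (deriv ^^ Suc j) f x = F (Suc j) x" "deriv_loc_abs_cont_on (Suc j) I f"
proof -
  have F: "(F k has_field_derivative F (Suc k) x) (at x)" if "k < Suc j" "x \<in> I" for k x
    using that j by (intro F_deriv cont d) auto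
  have eq: "(deriv ^^ Suc j) f x = F (Suc j) x" if "x \<in> I" for x
    using that by (intro deriv_iterate_on_open[where n = "Suc j" and G = F, OF open_I f F]) auto
  then show "x \<in> I \<Longrightarrow> (deriv ^^ Suc j) f x = F (Suc j) x" .
  show "deriv_loc_abs_cont_on (Suc j) I f"
    unfolding deriv_loc_abs_cont_on_def loc_abs_cont_on_def
  proof (intro conjI allI impI ballI)
    show "(deriv ^^ k) f field_differentiable (at x)" if "k < Suc j" "x \<in> I" for k x
      using that by (intro deriv_iterate_differentiable[where n = "Suc j" and G = F, OF open_I f F]) auto
    fix a b assume ab: "a \<le> b \<and> {a..b} \<subseteq> I"
    have "lipschitz_Icc a b (F (Suc j))"
      using F_lipschitz[OF j _ d cont lip] ab by blast
    moreover have "(deriv ^^ Suc j) f x = F (Suc j) x" if "x \<in> {a..b}" for x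
      using eq ab that by blast
    ultimately show "abs_cont_on a b ((deriv ^^ Suc j) f)"
      using lipschitz_Icc_cong[of a b "(deriv ^^ Suc j) f" "F (Suc j)"] lipschitz_Icc_abs_cont by blast
  qed
qed

lemma solution_deriv:
  assumes n: "n \<le> N" and f: "\<And>x. x \<in> I \<Longrightarrow> f x = F 0 x" and cont: "\<And>t. isCont (d 0) t"
    and d: "\<And>i t. Suc i < n \<Longrightarrow> (d i has_field_derivative d (Suc i) t) (at t)"
    and x: "x \<in> I"
  shows "(deriv ^^ n) f x = F n x"
proof (rule deriv_iterate_on_open[where n = n and G = F, OF open_I f _ order_refl x])
  show "(F k has_field_derivative F (Suc k) x) (at x)" if "k < n" "x \<in> I" for k x
    using that n by (intro F_deriv cont d) auto
qed

text \<open>For the first bound \<open>d j\<close> is differentiable almost everywhere only. All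
  orders but the last are computed on the whole of \<open>I\<close>; the last differentiation takes
  place at a single point where \<open>d j\<close> has a derivative.\<close>

lemma solution_deriv_at:
  assumes j: "Suc (Suc j) \<le> N" and f: "\<And>x. x \<in> I \<Longrightarrow> f x = F 0 x" and cont: "\<And>t. isCont (d 0) t"
    and d: "\<And>i t. i < j \<Longrightarrow> (d i has_field_derivative d (Suc i) t) (at t)"
    and x: "x \<in> I" and dx: "(d j has_field_derivative d (Suc j) x) (at x)"
  shows "(deriv ^^ Suc (Suc j)) f x = F (Suc (Suc j)) x"
proof -
  have eq: "(deriv ^^ Suc j) f y = F (Suc j) y" if "y \<in> I" for y
    using j d that by (intro solution_deriv f cont) auto
  have "\<forall>\<^sub>F y in nhds x. (deriv ^^ Suc j) f y = F (Suc j) y"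
    using eq x open_I unfolding eventually_nhds by blast
  moreover have "(F (Suc j) has_field_derivative F (Suc (Suc j)) x) (at x)"
    using j d dx by (intro F_deriv x cont) (auto simp: less_Suc_eq)
  ultimately have "((deriv ^^ Suc j) f has_field_derivative F (Suc (Suc j)) x) (at x)"
    using DERIV_cong_ev[OF refl _ refl] by blast
  then show ?thesis
    by (simp add: DERIV_imp_deriv)
qed

end

section \<open>From the interval density to the abstract setting\<close>

lemma endpoints_mono:
  fixes e :: "nat \<Rightarrow> ereal"
  assumes e: "\<forall>r\<in>{1..m}. e (r - 1) < e r" and "r \<le> s" "s \<le> m"
  shows "e r \<le> e s"
  using assms(2,3)
proof (induction s rule: dec_induct)
  case (step s)
  then show ?case
    using bspec[OF e, of "Suc s"] by simp
qed simp

lemma interval_union_bounds: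
  assumes "\<forall>r\<in>{1..m}. e (r - 1) < e r" "x \<in> interval_union m e"
  shows "e 0 < ereal x" "ereal x < e m"
proof -
  obtain r where r: "1 \<le> r" "r \<le> m" "e (r - 1) < ereal x" "ereal x < e r"
    using assms(2) by (auto simp: interval_union_def einterval_iff)
  show "e 0 < ereal x"
    using endpoints_mono[OF assms(1), of 0 "r - 1"] r by (meson diff_le_self le_zero_eq linear order_trans order_le_less_trans zero_le)
  show "ereal x < e m"
    using endpoints_mono[OF assms(1), of r m] r by (meson order_less_le_trans order_refl)
qed

lemma interval_union_cases:
  assumes "e 0 < ereal x" "ereal x < e m"
  shows "x \<in> interval_union m e \<or> (\<exists>r\<le>m. e r = ereal x)"
proof -
  define r where "r = (LEAST r. ereal x \<le> e r)"
  have r: "ereal x \<le> e r"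
    unfolding r_def by (rule LeastI[of _ m]) (use assms in simp)
  have "r \<le> m"
    unfolding r_def by (rule Least_le) (use assms in simp)
  have "r \<noteq> 0"
    using r assms(1) by (metis not_less)
  then have "\<not> ereal x \<le> e (r - 1)"
    using not_less_Least[of "r - 1" "\<lambda>r. ereal x \<le> e r"] by (simp add: r_def)
  then have lt: "e (r - 1) < ereal x"
    by simp
  show ?thesis
  proof (cases "e r = ereal x")
    case False
    then have "ereal x < e r"
      using r by simp
    then have "x \<in> einterval (e (r - 1)) (e r)"
      using lt by (simp add: einterval_iff)
    then show ?thesis
      using \<open>r \<le> m\<close> \<open>r \<noteq> 0\<close> unfolding interval_union_def by force
  qed (use \<open>r \<le> m\<close> in blast)
qed

text \<open>Continuity of \<open>p\<close> and the kernel identity may fail at the endpoints, hence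
  \<open>X\<close>; subtracting the union ensures that \<open>X\<close> takes nothing from the
  support. Beyond the outermost endpoints the identity reads \<open>0 = 0\<close>.\<close>

lemma pearson_integrated_pearson:
  fixes Z :: "'a \<Rightarrow> real" and p :: "real \<Rightarrow> real" and e :: "nat \<Rightarrow> ereal"
  assumes "prob_space M" and dist: "distributed M lborel Z (\<lambda>x. ennreal (p x))"
    and dens: "interval_density m e p"
    and ip: "integrated_pearson M Z m e p \<kappa>\<^sub>0 \<kappa>\<^sub>1 \<kappa>\<^sub>2" and adm: "admissible \<kappa>\<^sub>2 N"
  defines "X \<equiv> {x. \<exists>r\<le>m. e r = ereal x} - interval_union m e"
  shows "pearson p \<kappa>\<^sub>0 \<kappa>\<^sub>1 \<kappa>\<^sub>2 (integral\<^sup>L M Z) X N" "pearson.I p X = interval_union m e"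
    "\<And>t. ereal t \<le> e 0 \<Longrightarrow> p t = 0" "\<And>t. e m \<le> ereal t \<Longrightarrow> p t = 0"
proof -
  interpret prob_space M by fact
  define \<mu> where "\<mu> = integral\<^sup>L M Z"
  have p0: "0 \<le> p x" for x
    using dens by (simp add: interval_density_def)
  have pos: "{x. 0 < p x} = interval_union m e" and e: "\<forall>r\<in>{1..m}. e (r - 1) < e r"
    using dens by (auto simp: interval_density_def)
  have zero: "p x = 0" if "x \<notin> interval_union m e" for x
    using that pos p0[of x] by (metis (mono_tags) antisym_conv2 mem_Collect_eq)
  show l: "\<And>t. ereal t \<le> e 0 \<Longrightarrow> p t = 0" and u: "\<And>t. e m \<le> ereal t \<Longrightarrow> p t = 0"
    using zero interval_union_bounds[OF e] by (meson not_less)+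
  have [measurable]: "p \<in> borel_measurable borel"
    using distributed_real_measurable[OF p0 dist] by simp
  have int: "integrable lborel p"
    using distributed_integrable[OF dist, of "\<lambda>_. 1"] p0 by simp
  have tot: "(\<integral>t. p t \<partial>lborel) = 1"
    using distributed_integral[OF dist, of "\<lambda>_. 1"] p0 by (simp add: prob_space)
  have mean_int: "integrable lborel (\<lambda>t. t * p t)"
    using distributed_integrable[OF dist, of "\<lambda>t. t"] p0 ip by (simp add: integrated_pearson_def mult.commute)
  have mean: "(\<integral>t. t * p t \<partial>lborel) = \<mu>"
    using distributed_integral[OF dist, of "\<lambda>t. t"] p0 by (simp add: \<mu>_def mult.commute)
  have fin: "finite X"
  proof (rule finite_subset)
    show "X \<subseteq> real_of_ereal ` e ` {..m}"
      unfolding X_def by (auto simp: image_image) (metis atMost_iff image_eqI real_of_ereal.simps(1))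
  qed simp
  have kernel: "isCont p x \<and> (LINT t:{..x}|lborel. (\<mu> - t) * p t) = (\<kappa>\<^sub>2 * x\<^sup>2 + \<kappa>\<^sub>1 * x + \<kappa>\<^sub>0) * p x"
    if x: "x \<notin> X" for x
  proof -
    have T: "(LBINT t=e 0..ereal x. (\<mu> - t) * p t) = (LINT t:{..x}|lborel. (\<mu> - t) * p t)"
      using l by (intro LBINT_eq_LINT_atMost) simp
    consider "x \<in> interval_union m e" | "ereal x < e 0" | "e m < ereal x"
    proof (cases "ereal x < e 0 \<or> e m < ereal x \<or> x \<in> interval_union m e")
      case False
      then have "\<not> (\<exists>r\<le>m. e r = ereal x)"
        using x by (simp add: X_def)
      then have "e 0 \<noteq> ereal x" "e m \<noteq> ereal x"
        by auto
      then have "e 0 < ereal x" "ereal x < e m"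
        using False by (auto simp: not_less)
      then show ?thesis
        using interval_union_cases[of e x m] False \<open>\<not> (\<exists>r\<le>m. e r = ereal x)\<close> by blast
    qed (use that in blast)
    then show ?thesis
    proof cases
      case 1
      then obtain r where r: "r \<in> {1..m}" "x \<in> einterval (e (r - 1)) (e r)"
        by (auto simp: interval_union_def)
      then have "isCont p x"
        using dens by (intro loc_abs_cont_on_isCont[of "einterval (e (r - 1)) (e r)"]) (auto simp: interval_density_def)
      moreover have "p x > 0"
        using 1 pos by blast
      moreover have "1 / p x * (LBINT t=e 0..ereal x. (\<mu> - t) * p t) = \<kappa>\<^sub>2 * x\<^sup>2 + \<kappa>\<^sub>1 * x + \<kappa>\<^sub>0"
        using ip 1 by (simp add: integrated_pearson_def stein_kernel_def \<mu>_def)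
      ultimately show ?thesis
        unfolding T by (simp add: field_simps)
    next
      case 2
      then have "open {y. ereal y < e 0}" "x \<in> {y. ereal y < e 0}"
        by (auto intro!: open_Collect_less continuous_intros)
      then have "\<forall>\<^sub>F y in nhds x. p y = 0"
        unfolding eventually_nhds using l by (meson less_imp_le mem_Collect_eq)
      then have "isCont p x"
        using isCont_cong[of p "\<lambda>_. 0" x] by simp
      moreover have "(LINT t:{..x}|lborel. (\<mu> - t) * p t) = (LINT t:{..x}|lborel. 0)"
      proof (intro set_lebesgue_integral_cong allI impI)
        fix t assume "t \<in> {..x}"
        then have "ereal t \<le> e 0"
          using 2 by (meson atMost_iff ereal_less_eq(3) less_imp_le order_trans)
        then show "(\<mu> - t) * p t = 0"
          using l by simp
      qed simp
      ultimately show ?thesis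
        using l[of x] 2 by simp
    next
      case 3
      then have "open {y. e m < ereal y}" "x \<in> {y. e m < ereal y}"
        by (auto intro!: open_Collect_less continuous_intros)
      then have "\<forall>\<^sub>F y in nhds x. p y = 0"
        unfolding eventually_nhds using u by (meson less_imp_le mem_Collect_eq)
      then have "isCont p x"
        using isCont_cong[of p "\<lambda>_. 0" x] by simp
      \<comment> \<open>Beyond the last endpoint nothing is cut off, so the integral is the total
        one, \<open>\<mu> - \<mu> = 0\<close>.\<close>
      moreover have "(LINT t:{..x}|lborel. (\<mu> - t) * p t) = (\<integral>t. \<mu> * p t - t * p t \<partial>lborel)"
        unfolding set_lebesgue_integral_def
      proof (rule Bochner_Integration.integral_cong[OF refl])
        fix t
        have "p t = 0" if "t > x"
          using u[of t] 3 that by (meson ereal_less_le less_imp_le order_trans less_ereal.simps(1))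
        then show "indicator {..x} t *\<^sub>R ((\<mu> - t) * p t) = \<mu> * p t - t * p t"
          by (auto simp: left_diff_distrib split: split_indicator)
      qed
      ultimately show ?thesis
        using u[of x] 3 int mean_int by (simp add: tot mean)
    qed
  qed
  show P: "pearson p \<kappa>\<^sub>0 \<kappa>\<^sub>1 \<kappa>\<^sub>2 (integral\<^sup>L M Z) X N"
    unfolding \<mu>_def[symmetric]
  proof
    show "0 < pearson_q \<kappa>\<^sub>2 j" if "1 \<le> j" "j \<le> N" for j
      using adm that by (simp add: admissible_def)
  qed (use p0 int tot mean_int mean fin kernel in auto)
  show "pearson.I p X = interval_union m e"
    unfolding pearson.I_def[OF P] pos by (auto simp: X_def)
qed

section \<open>Assembly of the bounds\<close>

context pearson_test
begin

text \<open>The bounds are proved separately because each may assume only its own seminorm to be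
  finite; where that seminorm is infinite, \<open>bound_term\<close> is infinite too.\<close>

lemma solution_bounds:
  assumes h: "d = (\<lambda>i. (deriv ^^ i) h)" and n: "n = Suc (Suc j)" "Suc n \<le> N"
    and l: "\<And>t. ereal t \<le> l \<Longrightarrow> p t = 0" and u: "\<And>t. u \<le> ereal t \<Longrightarrow> p t = 0"
    and \<tau>: "\<And>x. x \<in> I \<Longrightarrow> \<tau> x = Q x" and f: "\<And>x. x \<in> I \<Longrightarrow> f x = F 0 x"
  shows "deriv_seminorm (n - 1) h < \<infinity> \<or> deriv_seminorm n h < \<infinity> \<or> deriv_seminorm (n + 1) h < \<infinity> \<Longrightarrow>
      deriv_loc_abs_cont_on (n - 1) I f" (is "?fin \<Longrightarrow> _")
    and "AE x in lborel. x \<in> I \<longrightarrow> ereal \<bar>(deriv ^^ n) f x\<bar> \<le>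
      bound_term (2 / \<tau> x) (deriv_seminorm (n - 1) h)"
    and "x \<in> I \<Longrightarrow> ereal \<bar>(deriv ^^ n) f x\<bar> \<le> bound_term (stein_U p l u \<tau> n x) (deriv_seminorm n h)"
    and "x \<in> I \<Longrightarrow> ereal \<bar>(deriv ^^ n) f x\<bar> \<le>
      bound_term (1 / pearson_q \<kappa>\<^sub>2 (n + 1)) (deriv_seminorm (n + 1) h)"
proof -
  have d: "(deriv ^^ i) h = d i" for i
    by (simp add: h)
  \<comment> \<open>\<open>F_deriv\<close> needs \<open>h\<close> continuous: the Lipschitz bound
    gives this for \<open>k = 0\<close>, differentiability for \<open>k > 0\<close>.\<close>
  have cont: "isCont (d 0) t"
    if "\<And>i t. i < k \<Longrightarrow> (d i has_field_derivative d (Suc i) t) (at t)" and "\<And>s t. \<bar>d k t - d k s\<bar> \<le> K * \<bar>t - s\<bar>" for k K t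
  proof (cases k)
    case 0
    have "(max 0 K)-lipschitz_on UNIV (d 0)"
    proof (rule lipschitz_onI)
      fix s t
      have "\<bar>d 0 s - d 0 t\<bar> \<le> K * \<bar>s - t\<bar>"
        using that(2) 0 by simp
      also have "\<dots> \<le> max 0 K * \<bar>s - t\<bar>"
        by (intro mult_right_mono) auto
      finally show "dist (d 0 s) (d 0 t) \<le> max 0 K * dist s t"
        by (simp add: dist_real_def)
    qed simp
    then show ?thesis
      using lipschitz_on_continuous_on continuous_on_eq_continuous_at by blast
  next
    case (Suc k')
    then show ?thesis
      using that(1)[of 0 t] DERIV_isCont by blast
  qed
  note finE = deriv_seminorm_finiteE[where h = h, unfolded d]
  show "deriv_loc_abs_cont_on (n - 1) I f" if ?fin
  proof -
    \<comment> \<open>The regularity claim needs \<open>d j\<close> Lipschitz on compact intervals.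
      In the first case this is the seminorm bound itself; in the other two \<open>d j\<close> is
      continuously differentiable.\<close>
    have lipC1: "lipschitz_Icc a b (d j)"
      if "\<And>i t. i < Suc j \<Longrightarrow> (d i has_field_derivative d (Suc i) t) (at t)" "\<And>t. isCont (d (Suc j)) t" for a b
      using that by (intro lipschitz_Icc_C1[of _ _ _ "d (Suc j)"] continuous_at_imp_continuous_on) auto
    have "(\<forall>i t. i < j \<longrightarrow> (d i has_field_derivative d (Suc i) t) (at t)) \<and> (\<forall>t. isCont (d 0) t) \<and>
        (\<forall>a b. lipschitz_Icc a b (d j))"
    proof -
      consider "deriv_seminorm (Suc j) h < \<infinity>" | "deriv_seminorm (Suc (Suc j)) h < \<infinity>"
        | "deriv_seminorm (Suc (Suc (Suc j))) h < \<infinity>"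
        using \<open>?fin\<close> n by auto
      then show ?thesis
      proof cases
        case 1
        then obtain K where K: "\<And>i t. i < j \<Longrightarrow> (d i has_field_derivative d (Suc i) t) (at t)"
          "\<And>s t. \<bar>d j t - d j s\<bar> \<le> K * \<bar>t - s\<bar>"
          by (rule finE) (rule that)
        then show ?thesis
          using cont[of j K] lipschitz_IccI[of _ _ "d j" K] by blast
      next
        case 2
        then obtain K where K: "\<And>i t. i < Suc j \<Longrightarrow> (d i has_field_derivative d (Suc i) t) (at t)"
          "\<And>s t. \<bar>d (Suc j) t - d (Suc j) s\<bar> \<le> K * \<bar>t - s\<bar>"
          by (rule finE) (rule that)
        have "isCont (d (Suc j)) t" for t
        proof -
          have "lipschitz_Icc (t - 1) (t + 1) (d (Suc j))"
            using K(2) by (intro lipschitz_IccI)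
          then have "continuous_on {t - 1..t + 1} (d (Suc j))"
            using lipschitz_on_continuous_on unfolding lipschitz_Icc_def by blast
          then show ?thesis
            by (rule continuous_on_interior) simp
        qed
        then show ?thesis
          using K(1) cont[OF K] lipC1 by (simp add: less_SucI)
      next
        case 3
        then obtain K where K: "\<And>i t. i < Suc (Suc j) \<Longrightarrow> (d i has_field_derivative d (Suc i) t) (at t)"
          "\<And>s t. \<bar>d (Suc (Suc j)) t - d (Suc (Suc j)) s\<bar> \<le> K * \<bar>t - s\<bar>"
          by (rule finE) (rule that)
        have "isCont (d (Suc j)) t" for t
          using K(1)[of "Suc j" t] DERIV_isCont by blast
        then show ?thesis
          using K(1) cont[OF K] lipC1 by (simp add: less_SucI)
      qed
    qed
    then have "deriv_loc_abs_cont_on (Suc j) I f"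
      using n by (intro solution_regularity(2) f) auto
    then show ?thesis
      using n by simp
  qed
  show "AE x in lborel. x \<in> I \<longrightarrow> ereal \<bar>(deriv ^^ n) f x\<bar> \<le> bound_term (2 / \<tau> x) (deriv_seminorm (n - 1) h)"
  proof (cases "deriv_seminorm (Suc j) h < \<infinity>")
    case True
    then obtain K where K: "deriv_seminorm (Suc j) h = ereal K"
      "\<And>i t. i < j \<Longrightarrow> (d i has_field_derivative d (Suc i) t) (at t)"
      "\<And>s t. \<bar>d j t - d j s\<bar> \<le> K * \<bar>t - s\<bar>"
      "AE x in lborel. (d j has_field_derivative d (Suc j) x) (at x) \<and> \<bar>d (Suc j) x\<bar> \<le> K"
      by (rule finE) (rule that)
    have bt: "bound_term (2 / \<tau> x) (deriv_seminorm (n - 1) h) = ereal (2 / \<tau> x * K)" for x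
      using n K(1) by (simp add: bound_term_def)
    have le: "\<bar>(deriv ^^ n) f x\<bar> \<le> 2 / \<tau> x * K"
      if "(d j has_field_derivative d (Suc j) x) (at x) \<and> \<bar>d (Suc j) x\<bar> \<le> K" "x \<in> I" for x
    proof -
      have "(deriv ^^ n) f x = F n x"
        unfolding n(1) using n that K(2) cont[OF K(2,3)] by (intro solution_deriv_at f) auto
      moreover have "\<bar>F n x\<bar> \<le> 2 / Q x * K"
        unfolding n(1) using n that K(2,3) by (intro F_bound_1) auto
      ultimately show ?thesis
        using \<tau> that(2) by simp
    qed
    show ?thesis
      unfolding bt ereal_less_eq(3) using K(4) by (rule eventually_mono) (use le in blast)
  qed (use n in \<open>auto simp: bound_term_def\<close>)
  show "ereal \<bar>(deriv ^^ n) f x\<bar> \<le> bound_term (stein_U p l u \<tau> n x) (deriv_seminorm n h)" if x: "x \<in> I"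
  proof (cases "deriv_seminorm (Suc (Suc j)) h < \<infinity>")
    case True
    then obtain K where K: "deriv_seminorm (Suc (Suc j)) h = ereal K"
      "\<And>i t. i < Suc j \<Longrightarrow> (d i has_field_derivative d (Suc i) t) (at t)"
      "\<And>s t. \<bar>d (Suc j) t - d (Suc j) s\<bar> \<le> K * \<bar>t - s\<bar>"
      by (rule finE) (rule that)
    have "(deriv ^^ n) f x = F n x"
      using n K(2) cont[OF K(2,3)] x by (intro solution_deriv f) auto
    moreover have "\<bar>F n x\<bar> \<le> stein_U p l u \<tau> n x * K"
      unfolding n(1) using stein_U_eq[of l u \<tau> "Suc (Suc j)" x] l u \<tau> F_bound_2[of "Suc j" x K] n K(2,3) x
      by (simp del: L.simps U.simps power_Suc)
    ultimately show ?thesis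
      using n K(1) by (simp add: bound_term_def)
  qed (use n in \<open>auto simp: bound_term_def\<close>)
  show "ereal \<bar>(deriv ^^ n) f x\<bar> \<le> bound_term (1 / pearson_q \<kappa>\<^sub>2 (n + 1)) (deriv_seminorm (n + 1) h)" if x: "x \<in> I"
  proof (cases "deriv_seminorm (Suc n) h < \<infinity>")
    case True
    then obtain K where K: "deriv_seminorm (Suc n) h = ereal K"
      "\<And>i t. i < n \<Longrightarrow> (d i has_field_derivative d (Suc i) t) (at t)"
      "\<And>s t. \<bar>d n t - d n s\<bar> \<le> K * \<bar>t - s\<bar>"
      by (rule finE) (rule that)
    have "(deriv ^^ n) f x = F n x"
      using n K(2) cont[OF K(2,3)] x by (intro solution_deriv f) auto
    moreover have "\<bar>F n x\<bar> \<le> 1 / pearson_q \<kappa>\<^sub>2 (Suc n) * K"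
      using n K(2,3) x by (intro F_bound_3) auto
    ultimately show ?thesis
      using K(1) by (simp add: bound_term_def)
  qed (auto simp: bound_term_def)
qed

end

theorem corollary3p9:
  fixes M :: "'a measure" and Z :: "'a \<Rightarrow> real"
    and p h \<tau> f :: "real \<Rightarrow> real"
    and m n :: nat and e :: "nat \<Rightarrow> ereal"
    and \<kappa>\<^sub>0 \<kappa>\<^sub>1 \<kappa>\<^sub>2 :: real
  defines "\<tau> \<equiv> stein_kernel p (e 0) (integral\<^sup>L M Z)"
    and "f \<equiv> stein_solution p (e 0) \<tau> h (\<integral>\<omega>. h (Z \<omega>) \<partial>M)"
  assumes "prob_space M"
    and "distributed M lborel Z (\<lambda>x. ennreal (p x))"
    and "interval_density m e p"
    and "integrated_pearson M Z m e p \<kappa>\<^sub>0 \<kappa>\<^sub>1 \<kappa>\<^sub>2"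
    and "n \<ge> 2"
    and "admissible \<kappa>\<^sub>2 (n + 1)"
    and "integrable (density lborel (\<lambda>x. ennreal (p x))) h"
  shows "(deriv_seminorm (n - 1) h < \<infinity> \<or> deriv_seminorm n h < \<infinity> \<or>
            deriv_seminorm (n + 1) h < \<infinity> \<longrightarrow>
          deriv_loc_abs_cont_on (n - 1) (interval_union m e) f) \<and>
         (AE x in lborel. x \<in> interval_union m e \<longrightarrow>
            ereal \<bar>(deriv ^^ n) f x\<bar> \<le>
              Min {bound_term (2 / \<tau> x) (deriv_seminorm (n - 1) h),
                   bound_term (stein_U p (e 0) (e m) \<tau> n x) (deriv_seminorm n h),
                   bound_term (1 / pearson_q \<kappa>\<^sub>2 (n + 1)) (deriv_seminorm (n + 1) h)})"
proof -
  interpret prob_space M by fact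
  define X where "X = {x. \<exists>r\<le>m. e r = ereal x} - interval_union m e"
  note P = pearson_integrated_pearson[OF assms(3-6,8), folded X_def]
  \<comment> \<open>The order is \<open>n + 1\<close> because the third bound involves
    \<open>L (n + 2)\<close>, built from the moment of order \<open>n + 1\<close>.\<close>
  interpret pearson p \<kappa>\<^sub>0 \<kappa>\<^sub>1 \<kappa>\<^sub>2 "integral\<^sup>L M Z" X "n + 1"
    by (rule P(1))
  have [measurable]: "h \<in> borel_measurable borel"
    using borel_measurable_integrable[OF assms(9)] by simp
  have ph: "integrable lborel (\<lambda>t. p t * h t)"
    using integrable_real_density[of p lborel h] assms(9) p_nonneg by simp
  interpret pearson_test p \<kappa>\<^sub>0 \<kappa>\<^sub>1 \<kappa>\<^sub>2 "integral\<^sup>L M Z" X "n + 1" "\<lambda>i. (deriv ^^ i) h"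
    by unfold_locales (simp add: ph)
  have Eh: "(\<integral>\<omega>. h (Z \<omega>) \<partial>M) = (\<integral>t. p t * h t \<partial>lborel)"
    using distributed_integral[OF assms(4), of h] p_nonneg by simp
  have \<tau>: "\<tau> x = Q x" if "x \<in> I" for x
    using assms(6) that P(2) by (simp add: integrated_pearson_def \<tau>_def Q_def)
  have f: "f x = F 0 x" if "x \<in> I" for x
    using stein_solution_eq[of "e 0" \<tau> x "\<integral>\<omega>. h (Z \<omega>) \<partial>M"] P(3) \<tau> that Eh by (simp add: f_def)
  obtain j where j: "n = Suc (Suc j)"
    using \<open>n \<ge> 2\<close> by (metis One_nat_def Suc_1 Suc_le_D Suc_le_mono)
  note B = solution_bounds[OF refl j _ P(3,4) \<tau> f]
  have "AE x in lborel. x \<in> I \<longrightarrow> ereal \<bar>(deriv ^^ n) f x\<bar> \<le>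
              Min {bound_term (2 / \<tau> x) (deriv_seminorm (n - 1) h),
                   bound_term (stein_U p (e 0) (e m) \<tau> n x) (deriv_seminorm n h),
                   bound_term (1 / pearson_q \<kappa>\<^sub>2 (n + 1)) (deriv_seminorm (n + 1) h)}"
    using B(2) B(3,4) by (auto elim!: eventually_mono)
  then show ?thesis
    using B(1) P(2) by simp
qed

end
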